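(* Let $f:\mathbb{R}^d\to\mathbb{R}$ be differentiable, $(L_0,L_1)$-smooth with respect to a positive semi-definite matrix $\bm{H}\in\mathbb{R}^{d\times d}$, and lower bounded. Let $\delta\in(0,1)$, $k\ge4$, $\varepsilon>0$ (the target precision), and let $\bm{S}_t\in\mathbb{R}^{d\times\ell}$ be Gaussian or Rademacher sketching matrices with $\ell=16k\log(4T/\delta)$. Run the deterministic adaptive zeroth-order method (see context) with smoothing parameter $\alpha$ and step size $\eta$ satisfying $$\alpha^2\le\min\left\{\frac{1}{2L_1^2\zeta_1T},\ \frac{3\varepsilon^2}{8L_0^2\zeta_1}\right\},\qquad\eta=\frac{\alpha}{\sqrt{(\ell-1)\zeta_2T}},$$ with $T>0$ large enough that $\eta\le\frac{3\alpha}{64L_1\zeta_2\sqrt{\ell-1}}$. If the total number of iterations satisfies $$T=\mathcal{O}\left(\frac{\|\bm{H}\|}{\varepsilon^2}+\frac{\mathrm{tr}(\bm{H})}{k\,\varepsilon^2}\right),$$ then with probability at least $1-\delta$ the generated sequence $\{\bm{x}_t\}_{t=0}^{T-1}$ satisfies $\min_{t=0,\dots,T-1}\|\nabla f(\bm{x}_t)\|\le\varepsilon$. Furthermore, the total query complexity (number of function evaluations) is $$Q=\mathcal{O}\left(\left(\frac{k\|\bm{H}\|}{\varepsilon^2}+\frac{\mathrm{tr}(\bm{H})}{\varepsilon^2}\right)\log\frac{1}{\varepsilon\delta}\right).$$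
   Context: Notation: $\|\cdot\|$ is the Euclidean norm of vectors and the spectral norm of matrices, and $\|\bm{x}\|_{\bm{A}}=\sqrt{\bm{x}^\top\bm{A}\bm{x}}$ for positive semi-definite $\bm{A}$. The statement on $T$ means that a number of iterations of this order is sufficient; $\mathcal{O}(\cdot)$ hides problem parameters not displayed ($L_0$, $L_1$, $f(\bm{x}_0)-\inf f$) and absolute constants. $(L_0,L_1)$-smoothness w.r.t. $\bm{H}$: for all $\bm{x},\bm{y}\in\mathbb{R}^d$ with $\|\bm{y}-\bm{x}\|_{\bm{H}}\le 1/(L_1\sqrt{\|\bm{H}\|})$, $\big|f(\bm{y})-f(\bm{x})-\langle\nabla f(\bm{x}),\bm{y}-\bm{x}\rangle\big|\le\frac{L_0+L_1\|\nabla f(\bm{x})\|}{2}\|\bm{y}-\bm{x}\|_{\bm{H}}^2$. Lower bounded: $\inf_{\bm{x}} f(\bm{x})>-\infty$. Gaussian sketching matrix: $\bm{S}\in\mathbb{R}^{d\times\ell}$ with i.i.d. $\mathcal{N}(0,1/\ell)$ entries. Rademacher sketching matrix: i.i.d. entries uniform on $\{\pm1/\sqrt\ell\}$. Algorithm (deterministic adaptive ZO): at each $t$ draw a fresh sketching matrix $\bm{S}_t$ with columns $\bm{s}_1,\dots,\bm{s}_\ell$; set $\mathbf{g}(\bm{x}_t)=\sum_{i=1}^\ell\frac{f(\bm{x}_t+\alpha\bm{s}_i)-f(\bm{x}_t)}{\alpha}\bm{s}_i$ and $\sigma_t=\sqrt{\frac{1}{\ell-1}\sum_{j=1}^\ell\big(f(\bm{x}_t+\alpha\bm{s}_j)-\frac1\ell\sum_{i=1}^\ell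 f(\bm{x}_t+\alpha\bm{s}_i)\big)^2}$; update $\bm{x}_{t+1}=\bm{x}_t-\eta\,\mathbf{g}(\bm{x}_t)/\sigma_t$. Constants: $\zeta_1=\|\bm{H}\|^2\left(\frac{5\ell}{4}+\frac{d\ell}{4k}\right)^2$, $\zeta_2=\frac{5\|\bm{H}\|}{4}+\frac{\mathrm{tr}(\bm{H})}{4k}$. *)

theory Defs
  imports "HOL-Probability.Probability"
begin

text \<open>
  The constant hidden in the iteration bound must not depend on the dimension \<open>d\<close>, so \<open>d\<close> has to be
  quantified inside the statement. Vectors are therefore functions \<open>nat \<Rightarrow> real\<close> vanishing
  from index \<open>d\<close> on, and matrices are functions of two indices of which only the entries below
  the relevant bounds are ever used. The Euclidean norm is \<^term>\<open>L2_set x {..<d}\<close>. On \<open>Rn d\<close> the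
  product topology of \<^typ>\<open>nat \<Rightarrow> real\<close> is the usual topology.
\<close>

definition Rn :: "nat \<Rightarrow> (nat \<Rightarrow> real) set" where
  "Rn d = {x. \<forall>i\<ge>d. x i = 0}"

definition dot :: "nat \<Rightarrow> (nat \<Rightarrow> real) \<Rightarrow> (nat \<Rightarrow> real) \<Rightarrow> real" where
  "dot d x y = (\<Sum>i<d. x i * y i)"

definition mat_vec :: "nat \<Rightarrow> (nat \<Rightarrow> nat \<Rightarrow> real) \<Rightarrow> (nat \<Rightarrow> real) \<Rightarrow> nat \<Rightarrow> real" where
  "mat_vec d A x = (\<lambda>i. if i < d then \<Sum>j<d. A i j * x j else 0)"

definition spectral_norm :: "nat \<Rightarrow> (nat \<Rightarrow> nat \<Rightarrow> real) \<Rightarrow> real" where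
  "spectral_norm d A =
     (SUP x\<in>{x \<in> Rn d. L2_set x {..<d} \<le> 1}. L2_set (mat_vec d A x) {..<d})"

definition mat_trace :: "nat \<Rightarrow> (nat \<Rightarrow> nat \<Rightarrow> real) \<Rightarrow> real" where
  "mat_trace d A = (\<Sum>i<d. A i i)"

definition pos_semidef :: "nat \<Rightarrow> (nat \<Rightarrow> nat \<Rightarrow> real) \<Rightarrow> bool" where
  "pos_semidef d A \<longleftrightarrow>
     (\<forall>i<d. \<forall>j<d. A i j = A j i) \<and> (\<forall>x\<in>Rn d. 0 \<le> dot d x (mat_vec d A x))"

definition weighted_norm :: "nat \<Rightarrow> (nat \<Rightarrow> nat \<Rightarrow> real) \<Rightarrow> (nat \<Rightarrow> real) \<Rightarrow> real" where
  "weighted_norm d A x = sqrt (dot d x (mat_vec d A x))"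

definition has_gradient ::
    "nat \<Rightarrow> ((nat \<Rightarrow> real) \<Rightarrow> real) \<Rightarrow> (nat \<Rightarrow> real) \<Rightarrow> (nat \<Rightarrow> real) \<Rightarrow> bool" where
  "has_gradient d f g x \<longleftrightarrow> g \<in> Rn d \<and>
     ((\<lambda>y. (f y - f x - dot d g (y - x)) / L2_set (y - x) {..<d}) \<longlongrightarrow> 0) (at x within Rn d)"

text \<open>
  The restriction \<open>\<parallel>y - x\<parallel>\<^sub>H \<le> 1 / (L1 * sqrt \<parallel>H\<parallel>)\<close> is written without division, so that
  the radius is infinite if the denominator is 0.
\<close>

definition L0_L1_smooth ::
    "nat \<Rightarrow> (nat \<Rightarrow> nat \<Rightarrow> real) \<Rightarrow> real \<Rightarrow> real \<Rightarrow> ((nat \<Rightarrow> real) \<Rightarrow> real) \<Rightarrow>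
     ((nat \<Rightarrow> real) \<Rightarrow> nat \<Rightarrow> real) \<Rightarrow> bool" where
  "L0_L1_smooth d H L0 L1 f grad \<longleftrightarrow>
     (\<forall>x\<in>Rn d. \<forall>y\<in>Rn d. L1 * sqrt (spectral_norm d H) * weighted_norm d H (y - x) \<le> 1 \<longrightarrow>
        \<bar>f y - f x - dot d (grad x) (y - x)\<bar>
          \<le> (L0 + L1 * L2_set (grad x) {..<d}) / 2 * (weighted_norm d H (y - x))\<^sup>2)"

text \<open>
  \<open>S t \<omega> i j\<close> is the entry in row \<open>i < d\<close> and column \<open>j < l\<close> of the matrix drawn in iteration
  \<open>t < T\<close>. Independence ranges over all three indices at once: the entries of each matrix are
  independent, and a fresh matrix is drawn in each iteration.
\<close>

definition indep_entries ::
    "'w measure \<Rightarrow> nat \<Rightarrow> nat \<Rightarrow> nat \<Rightarrow> (nat \<Rightarrow> 'w \<Rightarrow> nat \<Rightarrow> nat \<Rightarrow> real) \<Rightarrow> bool" where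
  "indep_entries M d l T S \<longleftrightarrow>
     prob_space.indep_vars M (\<lambda>_. borel) (\<lambda>(t, i, j) \<omega>. S t \<omega> i j)
       ({..<T} \<times> {..<d} \<times> {..<l})"

definition gaussian_sketches ::
    "'w measure \<Rightarrow> nat \<Rightarrow> nat \<Rightarrow> nat \<Rightarrow> (nat \<Rightarrow> 'w \<Rightarrow> nat \<Rightarrow> nat \<Rightarrow> real) \<Rightarrow> bool" where
  "gaussian_sketches M d l T S \<longleftrightarrow> indep_entries M d l T S \<and>
     (\<forall>t<T. \<forall>i<d. \<forall>j<l.
        distributed M lborel (\<lambda>\<omega>. S t \<omega> i j) (normal_density 0 (1 / sqrt (real l))))"

definition rademacher_sketches ::
    "'w measure \<Rightarrow> nat \<Rightarrow> nat \<Rightarrow> nat \<Rightarrow> (nat \<Rightarrow> 'w \<Rightarrow> nat \<Rightarrow> nat \<Rightarrow> real) \<Rightarrow> bool" where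
  "rademacher_sketches M d l T S \<longleftrightarrow> indep_entries M d l T S \<and>
     (\<forall>t<T. \<forall>i<d. \<forall>j<l.
        measure M {\<omega> \<in> space M. S t \<omega> i j = 1 / sqrt (real l)} = 1 / 2 \<and>
        measure M {\<omega> \<in> space M. S t \<omega> i j = - 1 / sqrt (real l)} = 1 / 2)"

definition column :: "nat \<Rightarrow> (nat \<Rightarrow> nat \<Rightarrow> real) \<Rightarrow> nat \<Rightarrow> nat \<Rightarrow> real" where
  "column d S j = (\<lambda>i. if i < d then S i j else 0)"

definition probe :: "nat \<Rightarrow> real \<Rightarrow> (nat \<Rightarrow> nat \<Rightarrow> real) \<Rightarrow> (nat \<Rightarrow> real) \<Rightarrow> nat \<Rightarrow> nat \<Rightarrow> real" where
  "probe d \<alpha> S x j = (\<lambda>i. x i + \<alpha> * column d S j i)"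

definition grad_estimate ::
    "nat \<Rightarrow> nat \<Rightarrow> real \<Rightarrow> ((nat \<Rightarrow> real) \<Rightarrow> real) \<Rightarrow> (nat \<Rightarrow> nat \<Rightarrow> real) \<Rightarrow> (nat \<Rightarrow> real) \<Rightarrow> nat \<Rightarrow> real"
  where
  "grad_estimate d l \<alpha> f S x =
     (\<lambda>i. \<Sum>j<l. (f (probe d \<alpha> S x j) - f x) / \<alpha> * column d S j i)"

definition std_estimate ::
    "nat \<Rightarrow> nat \<Rightarrow> real \<Rightarrow> ((nat \<Rightarrow> real) \<Rightarrow> real) \<Rightarrow> (nat \<Rightarrow> nat \<Rightarrow> real) \<Rightarrow> (nat \<Rightarrow> real) \<Rightarrow> real" where
  "std_estimate d l \<alpha> f S x =
     sqrt (1 / (real l - 1) *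
       (\<Sum>j<l. (f (probe d \<alpha> S x j) - 1 / real l * (\<Sum>i<l. f (probe d \<alpha> S x i)))\<^sup>2))"

text \<open>If \<open>\<sigma>\<^sub>t = 0\<close>, the convention \<open>a / 0 = 0\<close> makes the method stay where it is.\<close>

primrec zo_iterate ::
    "nat \<Rightarrow> nat \<Rightarrow> real \<Rightarrow> real \<Rightarrow> ((nat \<Rightarrow> real) \<Rightarrow> real) \<Rightarrow> (nat \<Rightarrow> nat \<Rightarrow> nat \<Rightarrow> real) \<Rightarrow>
     (nat \<Rightarrow> real) \<Rightarrow> nat \<Rightarrow> nat \<Rightarrow> real" where
  "zo_iterate d l \<alpha> \<eta> f S x0 0 = x0"
| "zo_iterate d l \<alpha> \<eta> f S x0 (Suc t) =
     (let x = zo_iterate d l \<alpha> \<eta> f S x0 t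
      in (\<lambda>i. x i - \<eta> * grad_estimate d l \<alpha> f (S t) x i / std_estimate d l \<alpha> f (S t) x))"

text \<open>The points at which a run of \<open>T\<close> iterations evaluates \<open>f\<close>, in order and with repetitions.\<close>

definition zo_queries ::
    "nat \<Rightarrow> nat \<Rightarrow> real \<Rightarrow> real \<Rightarrow> ((nat \<Rightarrow> real) \<Rightarrow> real) \<Rightarrow> (nat \<Rightarrow> nat \<Rightarrow> nat \<Rightarrow> real) \<Rightarrow>
     (nat \<Rightarrow> real) \<Rightarrow> nat \<Rightarrow> (nat \<Rightarrow> real) list" where
  "zo_queries d l \<alpha> \<eta> f S x0 T =
     concat (map (\<lambda>t. let x = zo_iterate d l \<alpha> \<eta> f S x0 t
                      in x # map (probe d \<alpha> (S t) x) [0..<l]) [0..<T])"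

definition sketch_size :: "real \<Rightarrow> nat \<Rightarrow> real \<Rightarrow> nat" where
  "sketch_size k T \<delta> = nat \<lceil>16 * k * ln (4 * real T / \<delta>)\<rceil>"

definition zeta1 :: "nat \<Rightarrow> (nat \<Rightarrow> nat \<Rightarrow> real) \<Rightarrow> real \<Rightarrow> nat \<Rightarrow> real" where
  "zeta1 d H k l = (spectral_norm d H)\<^sup>2 * (5 * real l / 4 + real d * real l / (4 * k))\<^sup>2"

definition zeta2 :: "nat \<Rightarrow> (nat \<Rightarrow> nat \<Rightarrow> real) \<Rightarrow> real \<Rightarrow> real" where
  "zeta2 d H k = 5 * spectral_norm d H / 4 + mat_trace d H / (4 * k)"

text \<open>
  The upper bounds \<open>\<alpha>\<^sup>2 \<le> min {1 / (2 * L1\<^sup>2 * \<zeta>\<^sub>1 * T), 3 * \<epsilon>\<^sup>2 / (8 * L0\<^sup>2 * \<zeta>\<^sub>1)}\<close> and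
  \<open>\<eta> \<le> 3 * \<alpha> / (64 * L1 * \<zeta>\<^sub>2 * sqrt (l - 1))\<close> are written without division, so that a bound
  with denominator 0 is no restriction.
\<close>

definition zo_parameters ::
    "nat \<Rightarrow> (nat \<Rightarrow> nat \<Rightarrow> real) \<Rightarrow> real \<Rightarrow> real \<Rightarrow> real \<Rightarrow> nat \<Rightarrow> nat \<Rightarrow> real \<Rightarrow> real \<Rightarrow> real \<Rightarrow> bool" where
  "zo_parameters d H L0 L1 k l T \<epsilon> \<alpha> \<eta> \<longleftrightarrow>
     0 < \<alpha> \<and>
     \<alpha>\<^sup>2 * (2 * L1\<^sup>2 * zeta1 d H k l * real T) \<le> 1 \<and>
     \<alpha>\<^sup>2 * (8 * L0\<^sup>2 * zeta1 d H k l) \<le> 3 * \<epsilon>\<^sup>2 \<and>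
     \<eta> = \<alpha> / sqrt ((real l - 1) * zeta2 d H k * real T) \<and>
     \<eta> * (64 * L1 * zeta2 d H k * sqrt (real l - 1)) \<le> 3 * \<alpha>"

definition iteration_order :: "nat \<Rightarrow> (nat \<Rightarrow> nat \<Rightarrow> real) \<Rightarrow> real \<Rightarrow> real \<Rightarrow> real" where
  "iteration_order d H k \<epsilon> = spectral_norm d H / \<epsilon>\<^sup>2 + mat_trace d H / (k * \<epsilon>\<^sup>2)"

definition query_order :: "nat \<Rightarrow> (nat \<Rightarrow> nat \<Rightarrow> real) \<Rightarrow> real \<Rightarrow> real \<Rightarrow> real \<Rightarrow> real" where
  "query_order d H k \<epsilon> \<delta> =
     (k * spectral_norm d H / \<epsilon>\<^sup>2 + mat_trace d H / \<epsilon>\<^sup>2) * ln (1 / (\<epsilon> * \<delta>))"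

end

theory Submission
  imports Defs
begin

text \<open>
  Gaussian and Rademacher sketches are treated alike: only the subgaussian moment generating function
  and the second moments of the independent entries matter. For a fixed gradient \<open>g\<close>, with
  probability at least \<open>1 - \<delta> / T\<close> the sketch \<open>S\<close> satisfies \<open>\<parallel>S\<^sup>T g\<parallel>\<^sup>2 \<ge> \<parallel>g\<parallel>\<^sup>2 / 2\<close>, the entries of
  \<open>S\<^sup>T g\<close> nearly sum to zero, the columns of \<open>S\<close> are not too long, and \<open>\<parallel>S S\<^sup>T g\<parallel>\<^sub>H\<^sup>2\<close> is of order \<open>\<zeta>\<^sub>2 \<parallel>g\<parallel>\<^sup>2\<close>. The last bound
  avoids the operator norm of \<open>S\<close>: \<open>S S\<^sup>T g\<close> is a sum of \<open>l\<close> independent vectors \<open>\<langle>s\<^sub>j, g\<rangle> s\<^sub>j\<close>,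
  and Pinelis' argument controls \<open>E cosh (\<lambda> \<parallel>S S\<^sup>T g\<parallel>\<^sub>H)\<close> one summand at a time.

  On this event the finite-difference errors are of relative size \<open>O(1 / sqrt l)\<close>, so one
  normalised step decreases \<open>f\<close> by a multiple of \<open>\<parallel>\<nabla>f(x\<^sub>t)\<parallel> / sqrt (\<zeta>\<^sub>2 T)\<close> up to \<open>O(L\<^sub>0 / T)\<close>, and the claim
  follows by telescoping. Since \<open>x\<^sub>t\<close> depends only on earlier sketches, Fubini transfers the bound for
  fixed \<open>g\<close> to \<open>g = \<nabla>f(x\<^sub>t)\<close>.
\<close>

section \<open>Positive semi-definite matrices\<close>

text \<open>The sketch size and \<zeta>2 come with explicit constants, so every tail bound has to
  carry explicit ones too. The summands <s_j, g> s_j are products of subgaussian variables, hence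
  only subexponential, which confines the exponential parameter to t \<le> 1/8; and they are not
  centred but have mean g / l. In the cosh recursion for a unit vector g, one column therefore costs
  a factor 1 + r G / l + 2 t^2 with G = |g|_H. Over l columns the drift accumulates to r G and
  reappears as the term |g|_H of the final bound; the quadratic part 2 l t^2 is balanced against a
  deviation sqrt (tr H / (2 k)), and the best t leaves failure probability 2 exp (- l / (16 k)):
  this is what the factor 16 k in the sketch size pays for. A factorisation H = B^T B turns the
  H-norm of x into the Euclidean norm of B x. The smoothing parameter is tied to \<epsilon>, so
  difference errors are small relative to the gradient only while its norm is at least \<epsilon>;
  descent is proved under this assumption and used by contradiction.\<close>

lemma quadratic_form_eq:
  "dot d x (mat_vec d H x) = (\<Sum>i<d. \<Sum>j<d. x i * H i j * x j)"
  unfolding dot_def mat_vec_def by (intro sum.cong) (auto simp: sum_distrib_left algebra_simps)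

lemma pos_semidef_quadratic_nonneg:
  assumes "pos_semidef d H"
  shows "0 \<le> (\<Sum>i<d. \<Sum>j<d. x i * H i j * x j)"
proof -
  let ?x = "\<lambda>i. if i < d then x i else 0"
  have "?x \<in> Rn d" by (simp add: Rn_def)
  then have "0 \<le> (\<Sum>i<d. \<Sum>j<d. ?x i * H i j * ?x j)"
    using assms unfolding pos_semidef_def quadratic_form_eq by (elim conjE bspec)
  then show ?thesis by simp
qed

text \<open>Testing the form at e_i + u e_j leaves an affine function of u that is nonnegative for
  all u, so its slope vanishes. The factorisation below relies on this when a pivot is zero.\<close>

lemma pos_semidef_zero_diag:
  assumes "pos_semidef d H" "i < d" "j < d" "H j j = 0"
  shows "H i j = 0"
proof (cases "i = j")
  case False
  have sym: "H j i = H i j" using assms unfolding pos_semidef_def by blast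
  have key: "0 \<le> H i i + 2 * u * H i j" for u
  proof -
    let ?x = "\<lambda>m. if m = i then 1 else if m = j then u else (0::real)"
    have row: "(\<Sum>n<d. ?x m * H m n * ?x n) = ?x m * (H m i + u * H m j)" for m
    proof -
      have "(\<Sum>n<d. ?x m * H m n * ?x n) = (\<Sum>n\<in>{i,j}. ?x m * H m n * ?x n)"
        using assms(2,3) by (intro sum.mono_neutral_right) auto
      then show ?thesis using False by (simp add: algebra_simps)
    qed
    have "(\<Sum>m<d. ?x m * (H m i + u * H m j)) = (\<Sum>m\<in>{i,j}. ?x m * (H m i + u * H m j))"
      using assms(2,3) by (intro sum.mono_neutral_right) auto
    also have "\<dots> = H i i + 2 * u * H i j"
      using False sym assms(4) by (simp add: algebra_simps)
    finally show ?thesis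
      using pos_semidef_quadratic_nonneg[OF assms(1), of ?x] row by simp
  qed
  show ?thesis
  proof (rule ccontr)
    assume "H i j \<noteq> 0"
    \<comment> \<open>At this u the affine function takes the value -1.\<close>
    then show False using key[of "- (H i i + 1) / (2 * H i j)"] by (simp add: field_simps)
  qed
qed (use assms in simp)

text \<open>Cholesky factorisation by induction on the dimension: the last pivot \<open>a\<close> is
  split off and the Schur complement \<open>H'\<close> is factored. For a = 0 the last column
  vanishes, so that x / 0 = 0 gives the right \<open>H'\<close> and the right last row of
  \<open>B\<close>.\<close>

lemma pos_semidef_factor:
  assumes "pos_semidef d H"
  shows "\<exists>B. \<forall>i<d. \<forall>j<d. H i j = (\<Sum>k<d. B k i * B k j :: real)"
  using assms
proof (induction d arbitrary: H)
  case (Suc d)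
  have sym: "\<And>i j. i < Suc d \<Longrightarrow> j < Suc d \<Longrightarrow> H i j = H j i"
    using Suc.prems unfolding pos_semidef_def by blast
  have quad: "\<And>x. 0 \<le> (\<Sum>i<Suc d. \<Sum>j<Suc d. x i * H i j * x j)"
    using pos_semidef_quadratic_nonneg[OF Suc.prems] .
  define a where "a = H d d"
  have a0: "0 \<le> a"
    using quad[of "\<lambda>i. if i = d then 1 else 0"] by (simp add: a_def if_distrib sum.delta cong: if_cong)
  have col0: "H i d = 0" if "a = 0" "i < Suc d" for i
    using pos_semidef_zero_diag[OF Suc.prems that(2)] that(1) by (simp add: a_def)
  define H' where "H' i j = H i j - H i d * H j d / a" for i j
  have "pos_semidef d H'"
    unfolding pos_semidef_def
  proof (intro conjI allI impI ballI)
    fix i j assume "i < d" "j < d"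
    then show "H' i j = H' j i" using sym[of i j] by (simp add: H'_def)
  next
    fix x assume "x \<in> Rn d"
    define b where "b = (\<Sum>i<d. H i d * x i)"
    define c where "c = b / a"
    \<comment> \<open>The last coordinate is the one that minimises the form for given
      \<open>x\<close>; there the form of \<open>H\<close> reduces to that of the Schur
      complement.\<close>
    define y where "y = x(d := - c)"
    have bc: "b = c * a" using col0 by (cases "a = 0") (auto simp: b_def c_def)
    have b': "(\<Sum>j<d. H d j * x j) = b"
      unfolding b_def by (intro sum.cong) (auto simp: sym)
    have "(\<Sum>i<Suc d. \<Sum>j<Suc d. y i * H i j * y j)
        = (\<Sum>i<d. \<Sum>j<d. x i * H i j * x j) + (\<Sum>i<d. x i * H i d * (- c))
          + (\<Sum>j<d. (- c) * H d j * x j) + c * a * c"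
      by (simp add: y_def a_def sum.distrib sum_subtractf sum_negf algebra_simps)
    also have "(\<Sum>i<d. x i * H i d * (- c)) = - c * b"
      by (simp add: b_def sum_distrib_left algebra_simps)
    also have "(\<Sum>j<d. (- c) * H d j * x j) = - c * (\<Sum>j<d. H d j * x j)"
      by (simp add: sum_distrib_left algebra_simps)
    also have "\<dots> = - c * b" by (simp add: b')
    also have "(\<Sum>i<d. \<Sum>j<d. x i * H i j * x j) + - c * b + - c * b + c * a * c
        = (\<Sum>i<d. \<Sum>j<d. x i * H i j * x j) - b * b / a"
      using bc by (auto simp: c_def)
    also have "b * b / a = (\<Sum>i<d. \<Sum>j<d. x i * (H i d * H j d / a) * x j)"
      by (simp add: b_def sum_product sum_divide_distrib algebra_simps)
    finally have "(\<Sum>i<Suc d. \<Sum>j<Suc d. y i * H i j * y j) = (\<Sum>i<d. \<Sum>j<d. x i * H' i j * x j)"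
      by (simp add: H'_def algebra_simps sum_subtractf)
    then show "0 \<le> dot d x (mat_vec d H' x)"
      using quad[of y] by (simp add: quadratic_form_eq)
  qed
  then obtain B' where B': "\<And>i j. i < d \<Longrightarrow> j < d \<Longrightarrow> H' i j = (\<Sum>k<d. B' k i * B' k j)"
    using Suc.IH by blast
  define B where "B k i = (if k = d then H i d / sqrt a else if i = d then 0 else B' k i)" for k i
  have "H i j = (\<Sum>k<Suc d. B k i * B k j)" if "i < Suc d" "j < Suc d" for i j
  proof -
    have last: "B d i * B d j = H i d * H j d / a"
      using a0 by (simp add: B_def)
    consider "i < d" "j < d" | "i = d" | "j = d" using \<open>i < Suc d\<close> \<open>j < Suc d\<close> by linarith
    then show ?thesis
    proof cases
      case 1
      then have "(\<Sum>k<d. B k i * B k j) = H' i j" by (simp add: B_def B')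
      with last show ?thesis by (simp add: H'_def)
    next
      case 2
      have "H d j = H d d * H j d / a"
        using col0[of j] sym[of d j] that by (cases "a = 0") (auto simp: a_def)
      with 2 last a0 show ?thesis by (simp add: B_def)
    next
      case 3
      have "H i d = H i d * H d d / a"
        using col0[of i] that by (cases "a = 0") (auto simp: a_def)
      with 3 last a0 show ?thesis by (simp add: B_def)
    qed
  qed
  then show ?case by blast
qed simp

lemma quadratic_form_factor:
  assumes "\<And>i j. i < d \<Longrightarrow> j < d \<Longrightarrow> H i j = (\<Sum>k<d. B k i * B k j :: real)"
  shows "dot d x (mat_vec d H x) = (\<Sum>k<d. (dot d (B k) x)\<^sup>2)"
proof -
  have "dot d x (mat_vec d H x) = (\<Sum>i<d. \<Sum>j<d. \<Sum>k<d. (B k i * x i) * (B k j * x j))"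
    unfolding quadratic_form_eq
    by (intro sum.cong) (auto simp: assms sum_distrib_left sum_distrib_right algebra_simps)
  also have "\<dots> = (\<Sum>i<d. \<Sum>k<d. \<Sum>j<d. (B k i * x i) * (B k j * x j))"
    by (rule sum.cong[OF refl]) (rule sum.swap)
  also have "\<dots> = (\<Sum>k<d. \<Sum>i<d. \<Sum>j<d. (B k i * x i) * (B k j * x j))"
    by (rule sum.swap)
  also have "\<dots> = (\<Sum>k<d. (dot d (B k) x)\<^sup>2)"
    unfolding dot_def power2_eq_square sum_product ..
  finally show ?thesis .
qed

lemma weighted_norm_factor:
  assumes "\<And>i j. i < d \<Longrightarrow> j < d \<Longrightarrow> H i j = (\<Sum>k<d. B k i * B k j :: real)"
  shows "weighted_norm d H x = L2_set (\<lambda>k. dot d (B k) x) {..<d}"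
  using quadratic_form_factor[OF assms] unfolding weighted_norm_def L2_set_def by presburger

lemma mat_trace_factor:
  assumes "\<And>i j. i < d \<Longrightarrow> j < d \<Longrightarrow> H i j = (\<Sum>k<d. B k i * B k j :: real)"
  shows "mat_trace d H = (\<Sum>k<d. \<Sum>i<d. (B k i)\<^sup>2)"
  unfolding mat_trace_def by (subst sum.swap) (auto intro!: sum.cong simp: assms power2_eq_square)

section \<open>Euclidean, spectral and weighted norms\<close>

lemma L2_set_scale: "L2_set (\<lambda>i. c * x i) A = \<bar>c\<bar> * L2_set x A" for c :: real
  by (simp add: L2_set_def power_mult_distrib sum_distrib_left[symmetric] real_sqrt_mult)

lemma L2_set_sq: "(L2_set x A)\<^sup>2 = (\<Sum>i\<in>A. (x i)\<^sup>2)"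
  by (simp add: L2_set_def sum_nonneg)

lemma dot_le_L2: "\<bar>dot d x y\<bar> \<le> L2_set x {..<d} * L2_set y {..<d}"
proof -
  have "\<bar>dot d x y\<bar> \<le> (\<Sum>i<d. \<bar>x i\<bar> * \<bar>y i\<bar>)"
    unfolding dot_def by (rule order_trans[OF sum_abs]) (simp add: abs_mult)
  also have "\<dots> \<le> L2_set x {..<d} * L2_set y {..<d}" by (rule L2_set_mult_ineq)
  finally show ?thesis .
qed

text \<open>The supremum in \<open>spectral_norm\<close> carries information only for a bounded set;
  a crude entrywise bound is enough for that.\<close>

lemma bdd_above_spectral:
  "bdd_above ((\<lambda>x. L2_set (mat_vec d A x) {..<d}) ` {x \<in> Rn d. L2_set x {..<d} \<le> 1})"
proof (rule bdd_aboveI2)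
  fix x assume x: "x \<in> {x \<in> Rn d. L2_set x {..<d} \<le> 1}"
  have "L2_set (mat_vec d A x) {..<d} \<le> (\<Sum>i<d. \<bar>mat_vec d A x i\<bar>)"
    by (rule L2_set_le_sum_abs)
  also have "\<dots> \<le> (\<Sum>i<d. \<Sum>j<d. \<bar>A i j\<bar>)"
  proof (rule sum_mono)
    fix i assume "i \<in> {..<d}"
    then have "\<bar>mat_vec d A x i\<bar> \<le> (\<Sum>j<d. \<bar>A i j * x j\<bar>)"
      by (simp add: mat_vec_def sum_abs)
    also have "\<dots> \<le> (\<Sum>j<d. \<bar>A i j\<bar>)"
    proof (rule sum_mono)
      fix j assume "j \<in> {..<d}"
      then have "\<bar>x j\<bar> \<le> L2_set x {..<d}"
        using member_le_L2_set[of "{..<d}" j "\<lambda>i. \<bar>x i\<bar>"] by (simp add: L2_set_def)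
      with x have "\<bar>x j\<bar> \<le> 1" by simp
      then show "\<bar>A i j * x j\<bar> \<le> \<bar>A i j\<bar>"
        by (simp add: abs_mult mult_left_le)
    qed
    finally show "\<bar>mat_vec d A x i\<bar> \<le> (\<Sum>j<d. \<bar>A i j\<bar>)" .
  qed
  finally show "L2_set (mat_vec d A x) {..<d} \<le> (\<Sum>i<d. \<Sum>j<d. \<bar>A i j\<bar>)" .
qed

lemma spectral_norm_nonneg: "0 \<le> spectral_norm d A"
proof -
  have "(\<lambda>_. 0) \<in> {x \<in> Rn d. L2_set x {..<d} \<le> 1}" by (simp add: Rn_def L2_set_def)
  from cSUP_upper[OF this bdd_above_spectral[of d A]] show ?thesis
    unfolding spectral_norm_def using L2_set_nonneg order_trans by blast
qed

lemma L2_set_mat_vec_le: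
  assumes "x \<in> Rn d"
  shows "L2_set (mat_vec d A x) {..<d} \<le> spectral_norm d A * L2_set x {..<d}"
proof (cases "L2_set x {..<d} = 0")
  case True
  then have "\<forall>i<d. x i = 0" by (simp add: L2_set_eq_0_iff)
  then have "L2_set (mat_vec d A x) {..<d} = 0" by (simp add: mat_vec_def L2_set_eq_0_iff)
  with True show ?thesis by simp
next
  case False
  define n where "n = L2_set x {..<d}"
  have n: "n > 0" using False by (simp add: n_def order_less_le L2_set_nonneg)
  define y where "y = (\<lambda>i. 1 / n * x i)"
  have y: "y \<in> {x \<in> Rn d. L2_set x {..<d} \<le> 1}"
    using assms n unfolding y_def mem_Collect_eq L2_set_scale by (simp add: Rn_def n_def)
  have "mat_vec d A y = (\<lambda>i. 1 / n * mat_vec d A x i)"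
    by (rule ext) (simp add: y_def mat_vec_def sum_divide_distrib)
  then have "L2_set (mat_vec d A y) {..<d} = 1 / n * L2_set (mat_vec d A x) {..<d}"
    using n by (simp only: L2_set_scale) simp
  moreover have "L2_set (mat_vec d A y) {..<d} \<le> spectral_norm d A"
    unfolding spectral_norm_def by (rule cSUP_upper[OF y bdd_above_spectral])
  ultimately have "1 / n * L2_set (mat_vec d A x) {..<d} \<le> spectral_norm d A" by simp
  then show ?thesis using n by (simp add: n_def[symmetric] field_simps)
qed

lemma weighted_norm_sq:
  assumes "pos_semidef d H" "x \<in> Rn d"
  shows "(weighted_norm d H x)\<^sup>2 = dot d x (mat_vec d H x)"
  using assms unfolding pos_semidef_def weighted_norm_def by simp

lemma weighted_norm_le:
  assumes "pos_semidef d H" "x \<in> Rn d"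
  shows "(weighted_norm d H x)\<^sup>2 \<le> spectral_norm d H * (L2_set x {..<d})\<^sup>2"
proof -
  have "dot d x (mat_vec d H x) \<le> L2_set x {..<d} * L2_set (mat_vec d H x) {..<d}"
    using dot_le_L2 by (metis abs_le_D1)
  also have "\<dots> \<le> L2_set x {..<d} * (spectral_norm d H * L2_set x {..<d})"
    by (intro mult_left_mono L2_set_mat_vec_le assms L2_set_nonneg)
  finally show ?thesis using weighted_norm_sq[OF assms] by (simp add: power2_eq_square algebra_simps)
qed

lemma mat_trace_nonneg:
  assumes "pos_semidef d H"
  shows "0 \<le> mat_trace d H"
proof -
  obtain B where "\<And>i j. i < d \<Longrightarrow> j < d \<Longrightarrow> H i j = (\<Sum>k<d. B k i * B k j)"
    using pos_semidef_factor[OF assms] by blast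
  from mat_trace_factor[OF this] show ?thesis by (simp add: sum_nonneg)
qed

section \<open>The hyperbolic cosine of a norm\<close>

definition exp_rest :: "real \<Rightarrow> real" where
  "exp_rest r = exp r - 1 - r"

lemma exp_rest_mono:
  assumes "0 \<le> r" "r \<le> s"
  shows "exp_rest r \<le> exp_rest s"
proof -
  have "1 + (s - r) \<le> exp (s - r)" by (rule exp_ge_add_one_self)
  then have "exp r * (1 + (s - r)) \<le> exp r * exp (s - r)" by (rule mult_left_mono) simp
  also have "\<dots> = exp s" by (simp flip: exp_add)
  finally have "exp r * (1 + (s - r)) \<le> exp s" .
  moreover have "s - r \<le> exp r * (s - r)"
    using mult_right_mono[of 1 "exp r" "s - r"] assms by simp
  ultimately show ?thesis unfolding exp_rest_def by (simp add: algebra_simps)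
qed

text \<open>Midpoint convexity. It is applied after the arithmetic-geometric mean inequality to
  separate two dependent factors whose exponential moments are known one at a time.\<close>

lemma exp_rest_mean:
  "exp_rest ((a + b) / 2) \<le> (exp_rest a + exp_rest b) / 2"
proof -
  have "exp ((1 - 1/2) *\<^sub>R a + (1/2) *\<^sub>R b) \<le> (1 - 1/2) * exp a + 1/2 * exp b"
    by (rule convex_onD[OF exp_convex]) auto
  then have "exp ((a + b) / 2) \<le> (exp a + exp b) / 2" by (simp add: add_divide_distrib)
  then show ?thesis unfolding exp_rest_def by (simp add: field_simps)
qed

lemma le_sinh:
  assumes "0 \<le> r"
  shows "r \<le> sinh (r :: real)"
proof -
  have "\<exists>y. DERIV (\<lambda>x. sinh x - x) x :> y \<and> 0 \<le> y" for x :: real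
    by (rule exI[of _ "cosh x - 1"]) (auto intro!: derivative_eq_intros simp: cosh_real_ge_1)
  from DERIV_nonneg_imp_nondecreasing[OF assms, of "\<lambda>x. sinh x - x"] this show ?thesis by simp
qed

text \<open>Equivalent to \<open>r \<le> sinh r\<close>. For nonnegative X it lets a bound on E exp
  (t X) control E exp (- t X) as well, and hence the lower tail.\<close>

lemma exp_minus_le_exp_rest:
  assumes "0 \<le> r"
  shows "exp (- r) \<le> 1 - r + exp_rest r"
  using le_sinh[OF assms] by (simp add: exp_rest_def sinh_field_def)

lemma convex_on_power_nonneg: "convex_on {0::real..} (\<lambda>x. x ^ n)"
proof (cases "even n")
  case True
  then show ?thesis by (intro convex_on_subset[OF convex_power_even]) auto
qed (rule convex_power_odd)

text \<open>As a function of q, cosh (sqrt q) is the power series with terms q^m / (2 m)!, and each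
  power is convex on the nonnegative reals. The series are compared termwise; the odd terms
  vanish.\<close>

lemma cosh_sqrt_convex:
  fixes p q t :: real
  assumes "0 \<le> p" "0 \<le> q" "0 \<le> t" "t \<le> 1"
  shows "cosh (sqrt ((1 - t) * p + t * q)) \<le> (1 - t) * cosh (sqrt p) + t * cosh (sqrt q)"
proof (rule sums_le)
  let ?u = "\<lambda>q n. if even n then sqrt q ^ n /\<^sub>R fact n else 0 :: real"
  show "?u ((1 - t) * p + t * q) sums cosh (sqrt ((1 - t) * p + t * q))"
    by (rule cosh_converges)
  show "(\<lambda>n. (1 - t) * ?u p n + t * ?u q n) sums ((1 - t) * cosh (sqrt p) + t * cosh (sqrt q))"
    by (intro sums_add sums_mult cosh_converges)
  fix n
  have "((1 - t) * p + t * q) ^ m \<le> (1 - t) * p ^ m + t * q ^ m" for m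
    using convex_onD[OF convex_on_power_nonneg, of t p q m] assms by simp
  moreover have "sqrt x ^ (2 * m) = x ^ m" if "0 \<le> x" for x m
    using that by (simp add: power_mult)
  ultimately have "sqrt ((1 - t) * p + t * q) ^ (2 * m) / fact (2 * m)
      \<le> ((1 - t) * sqrt p ^ (2 * m) + t * sqrt q ^ (2 * m)) / fact (2 * m)" for m
    using assms by (intro divide_right_mono) simp_all
  note even_case = this
  show "?u ((1 - t) * p + t * q) n \<le> (1 - t) * ?u p n + t * ?u q n"
  proof (cases "even n")
    case True
    then obtain m where n: "n = 2 * m" by (rule evenE)
    define F where "F = (fact n :: real)"
    have "inverse F * sqrt ((1 - t) * p + t * q) ^ n \<le> inverse F * ((1 - t) * sqrt p ^ n + t * sqrt q ^ n)"
      using even_case[of m] unfolding n F_def divide_inverse_commute .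
    with True show ?thesis
      unfolding F_def[symmetric] real_scaleR_def distrib_left by (simp only: if_True mult.left_commute)
  qed simp
qed

text \<open>
  The left-hand side is convex in \<open>c\<close> and the right-hand side affine, so that only \<open>c = \<plusminus>a b\<close>
  needs to be checked.
\<close>

lemma cosh_sqrt_sum_le:
  fixes a b c :: real
  assumes "0 \<le> a" "0 \<le> b" "\<bar>c\<bar> \<le> a * b"
  shows "cosh (sqrt (a\<^sup>2 + 2 * c + b\<^sup>2)) \<le> cosh a + sinh a / a * c + cosh a * exp_rest b"
proof -
  have sb: "b \<le> sinh b" using assms by (simp add: le_sinh)
  have eb: "exp_rest b = (cosh b - 1) + (sinh b - b)"
    using cosh_plus_sinh[of b] by (simp add: exp_rest_def)
  have "sinh a * (sinh b - b) \<le> cosh a * (sinh b - b)"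
    using sb by (intro mult_right_mono sinh_le_cosh_real) simp
  then have plus: "cosh (a + b) \<le> cosh a + b * sinh a + cosh a * exp_rest b"
    unfolding cosh_add eb by (simp add: algebra_simps)
  have "0 \<le> sinh a * (sinh b - b)" "0 \<le> cosh a * (sinh b - b)"
    using sb assms by (auto intro!: mult_nonneg_nonneg)
  then have minus: "cosh (a - b) \<le> cosh a - b * sinh a + cosh a * exp_rest b"
    unfolding cosh_diff eb right_diff_distrib distrib_left mult_1_right by (simp only: mult.commute[of b])
  show ?thesis
  proof (cases "a * b = 0")
    case True
    \<comment> \<open>For a = 0 the quotient \<open>sinh a / a\<close> is 0 by convention, which
      does no harm because it multiplies c = 0.\<close>
    then have c: "c = 0" using assms(3) by (simp only: True)
    then have "sqrt (a\<^sup>2 + 2 * c + b\<^sup>2) = a + b" using True assms by auto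
    moreover have "b * sinh a = 0" using True by auto
    ultimately show ?thesis using plus c by (metis add.right_neutral mult_zero_right)
  next
    case False
    then have ab: "0 < a * b" "a \<noteq> 0" "b \<noteq> 0" using assms by (auto simp: order_less_le)
    \<comment> \<open>The weight that expresses \<open>c\<close> as a convex combination of - a b
      and a b.\<close>
    define t where "t = (c / (a * b) + 1) / 2"
    have t: "0 \<le> t" "t \<le> 1" using assms(3) ab by (auto simp: t_def abs_le_iff field_simps)
    have c: "c = (2 * t - 1) * (a * b)" using ab by (simp add: t_def field_simps)
    have "a\<^sup>2 + 2 * c + b\<^sup>2 = (1 - t) * (a - b)\<^sup>2 + t * (a + b)\<^sup>2"
      unfolding c by (simp add: power2_eq_square algebra_simps)
    then have "cosh (sqrt (a\<^sup>2 + 2 * c + b\<^sup>2)) \<le> (1 - t) * cosh (a - b) + t * cosh (a + b)"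
      using cosh_sqrt_convex[of "(a - b)\<^sup>2" "(a + b)\<^sup>2" t] t by simp
    also have "\<dots> \<le> (1 - t) * (cosh a - b * sinh a + cosh a * exp_rest b)
        + t * (cosh a + b * sinh a + cosh a * exp_rest b)"
      using t plus minus by (intro add_mono mult_left_mono) auto
    also have "\<dots> = cosh a + (2 * t - 1) * b * sinh a + cosh a * exp_rest b"
      by (simp add: algebra_simps)
    also have "(2 * t - 1) * b * sinh a = sinh a / a * c"
      using ab by (simp add: c)
    finally show ?thesis .
  qed
qed

lemma L2_set_add_sq:
  "(L2_set (\<lambda>i. x i + y i) A)\<^sup>2 = (L2_set x A)\<^sup>2 + 2 * (\<Sum>i\<in>A. x i * y i) + (L2_set y A)\<^sup>2"
  unfolding L2_set_sq by (simp add: power2_sum sum.distrib sum_distrib_left algebra_simps)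

text \<open>The second-order inequality behind Pinelis' argument: a term linear in \<open>y\<close>,
  whose mean can be computed, plus a remainder that is a multiple of the old cosh, so that the
  estimate can be iterated.\<close>

lemma cosh_L2_set_add_le:
  fixes x y :: "'a \<Rightarrow> real"
  shows "cosh (L2_set (\<lambda>i. x i + y i) A) \<le> cosh (L2_set x A)
    + sinh (L2_set x A) / L2_set x A * (\<Sum>i\<in>A. x i * y i) + cosh (L2_set x A) * exp_rest (L2_set y A)"
proof -
  have "\<bar>\<Sum>i\<in>A. x i * y i\<bar> \<le> (\<Sum>i\<in>A. \<bar>x i\<bar> * \<bar>y i\<bar>)"
    by (rule order_trans[OF sum_abs]) (simp add: abs_mult)
  also have "\<dots> \<le> L2_set x A * L2_set y A" by (rule L2_set_mult_ineq)
  finally have *: "\<bar>\<Sum>i\<in>A. x i * y i\<bar> \<le> L2_set x A * L2_set y A" .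
  have "L2_set (\<lambda>i. x i + y i) A = sqrt ((L2_set x A)\<^sup>2 + 2 * (\<Sum>i\<in>A. x i * y i) + (L2_set y A)\<^sup>2)"
    unfolding L2_set_add_sq[symmetric] by (simp add: L2_set_nonneg)
  with cosh_sqrt_sum_le[OF L2_set_nonneg L2_set_nonneg *] show ?thesis by simp
qed

section \<open>Exponential moments and independence\<close>

text \<open>Fubini for independent variables, the inner one being evaluated at a second sample
  point. Bounds valid for a frozen outer value can then be used under the outer integral.\<close>

lemma (in prob_space) nn_integral_indep_var:
  assumes ind: "indep_var N X L Y" and h: "h \<in> borel_measurable (N \<Otimes>\<^sub>M L)"
  shows "(\<integral>\<^sup>+\<omega>. h (X \<omega>, Y \<omega>) \<partial>M) = (\<integral>\<^sup>+\<omega>. \<integral>\<^sup>+\<omega>'. h (X \<omega>, Y \<omega>') \<partial>M \<partial>M)"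
proof -
  have X: "X \<in> measurable M N" and Y: "Y \<in> measurable M L"
    and eq: "distr M N X \<Otimes>\<^sub>M distr M L Y = distr M (N \<Otimes>\<^sub>M L) (\<lambda>\<omega>. (X \<omega>, Y \<omega>))"
    using ind unfolding indep_var_distribution_eq by auto
  interpret Y: prob_space "distr M L Y" by (rule prob_space_distr) fact
  have h': "h \<in> borel_measurable (distr M N X \<Otimes>\<^sub>M distr M L Y)"
    using h by (simp cong: measurable_cong_sets sets_pair_measure_cong)
  have "(\<integral>\<^sup>+\<omega>. h (X \<omega>, Y \<omega>) \<partial>M) = integral\<^sup>N (distr M (N \<Otimes>\<^sub>M L) (\<lambda>\<omega>. (X \<omega>, Y \<omega>))) h"
    using X Y h by (subst nn_integral_distr) (auto intro: measurable_Pair)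
  also have "\<dots> = (\<integral>\<^sup>+x. \<integral>\<^sup>+y. h (x, y) \<partial>distr M L Y \<partial>distr M N X)"
    unfolding eq[symmetric] using Y.nn_integral_fst[OF h'] by simp
  also have "\<dots> = (\<integral>\<^sup>+\<omega>. \<integral>\<^sup>+y. h (X \<omega>, y) \<partial>distr M L Y \<partial>M)"
    using X h' by (subst nn_integral_distr) (auto intro!: Y.borel_measurable_nn_integral_fst)
  also have "\<dots> = (\<integral>\<^sup>+\<omega>. \<integral>\<^sup>+\<omega>'. h (X \<omega>, Y \<omega>') \<partial>M \<partial>M)"
  proof (rule nn_integral_cong)
    fix \<omega> assume "\<omega> \<in> space M"
    then have "X \<omega> \<in> space N" using X by (rule measurable_space[rotated])
    then show "(\<integral>\<^sup>+y. h (X \<omega>, y) \<partial>distr M L Y) = (\<integral>\<^sup>+\<omega>'. h (X \<omega>, Y \<omega>') \<partial>M)"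
      using Y h by (intro nn_integral_distr) auto
  qed
  finally show ?thesis .
qed

lemma (in prob_space) prob_ge_le_nn_integral:
  fixes u :: "'a \<Rightarrow> real"
  assumes [measurable]: "u \<in> borel_measurable M"
    and u: "\<And>\<omega>. \<omega> \<in> space M \<Longrightarrow> 0 \<le> u \<omega>" and c: "0 < c" and K: "0 \<le> K"
    and le: "(\<integral>\<^sup>+\<omega>. ennreal (u \<omega>) \<partial>M) \<le> ennreal K"
  shows "prob {\<omega> \<in> space M. c \<le> u \<omega>} \<le> K / c"
proof -
  have fin: "(\<integral>\<^sup>+\<omega>. ennreal (u \<omega>) \<partial>M) < \<infinity>"
    using le by (rule order_le_less_trans) simp
  have int: "integrable M u"
    using u fin by (intro integrableI_nonneg) auto
  have "ennreal (expectation u) \<le> ennreal K"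
    using le nn_integral_eq_integral[OF int] u by simp
  then have "expectation u \<le> K" using K by (simp add: ennreal_le_iff)
  moreover have "prob {\<omega> \<in> space M. c \<le> u \<omega>} \<le> expectation u / c"
    using u c int by (intro integral_Markov_inequality_measure[where A = "space M"]) auto
  ultimately show ?thesis using c by (meson divide_right_mono less_imp_le order_trans)
qed

lemma (in prob_space) chernoff_sum:
  fixes X :: "'i \<Rightarrow> 'a \<Rightarrow> real" and a b :: real
  assumes I: "finite I" and ind: "indep_vars (\<lambda>_. borel) X I"
    and le: "\<And>i. i \<in> I \<Longrightarrow> (\<integral>\<^sup>+\<omega>. ennreal (exp (X i \<omega>)) \<partial>M) \<le> ennreal (exp a)"
  shows "prob {\<omega> \<in> space M. b \<le> (\<Sum>i\<in>I. X i \<omega>)} \<le> exp (card I * a - b)"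
proof -
  have X: "X i \<in> borel_measurable M" if "i \<in> I" for i
    using ind that by (simp add: indep_vars_def)
  have "(\<integral>\<^sup>+\<omega>. ennreal (exp (\<Sum>i\<in>I. X i \<omega>)) \<partial>M) = (\<integral>\<^sup>+\<omega>. (\<Prod>i\<in>I. ennreal (exp (X i \<omega>))) \<partial>M)"
    by (simp add: exp_sum I prod_ennreal)
  also have "\<dots> = (\<Prod>i\<in>I. \<integral>\<^sup>+\<omega>. ennreal (exp (X i \<omega>)) \<partial>M)"
    by (intro indep_vars_nn_integral I indep_vars_compose2[OF ind]) auto
  also have "\<dots> \<le> (\<Prod>i\<in>I. ennreal (exp a))"
    by (intro prod_mono_ennreal le)
  also have "\<dots> = ennreal (exp (card I * a))"
    by (simp add: ennreal_power exp_of_nat_mult)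
  finally have *: "(\<integral>\<^sup>+\<omega>. ennreal (exp (\<Sum>i\<in>I. X i \<omega>)) \<partial>M) \<le> ennreal (exp (card I * a))" .
  have "prob {\<omega> \<in> space M. exp b \<le> exp (\<Sum>i\<in>I. X i \<omega>)} \<le> exp (card I * a) / exp b"
    using X by (intro prob_ge_le_nn_integral *) auto
  then show ?thesis by (simp add: exp_diff)
qed

lemma nn_integral_normal_density:
  "0 < \<sigma> \<Longrightarrow> (\<integral>\<^sup>+x. ennreal (normal_density \<mu> \<sigma> x) \<partial>lborel) = 1"
  by (subst nn_integral_eq_integral) auto

lemma normal_density_mgf:
  assumes "0 < \<sigma>"
  shows "(\<integral>\<^sup>+x. ennreal (normal_density 0 \<sigma> x * exp (c * x)) \<partial>lborel) = ennreal (exp (c\<^sup>2 * \<sigma>\<^sup>2 / 2))"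
proof -
  have "normal_density 0 \<sigma> x * exp (c * x) = exp (c\<^sup>2 * \<sigma>\<^sup>2 / 2) * normal_density (c * \<sigma>\<^sup>2) \<sigma> x" for x
  proof -
    have "- x\<^sup>2 / (2 * \<sigma>\<^sup>2) + c * x = c\<^sup>2 * \<sigma>\<^sup>2 / 2 + - (x - c * \<sigma>\<^sup>2)\<^sup>2 / (2 * \<sigma>\<^sup>2)"
      using assms by (simp add: field_simps power2_eq_square)
    then have "exp (- x\<^sup>2 / (2 * \<sigma>\<^sup>2)) * exp (c * x) = exp (c\<^sup>2 * \<sigma>\<^sup>2 / 2) * exp (- (x - c * \<sigma>\<^sup>2)\<^sup>2 / (2 * \<sigma>\<^sup>2))"
      unfolding exp_add[symmetric] by simp
    then show ?thesis by (simp add: normal_density_def)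
  qed
  then have "(\<integral>\<^sup>+x. ennreal (normal_density 0 \<sigma> x * exp (c * x)) \<partial>lborel)
      = ennreal (exp (c\<^sup>2 * \<sigma>\<^sup>2 / 2)) * (\<integral>\<^sup>+x. ennreal (normal_density (c * \<sigma>\<^sup>2) \<sigma> x) \<partial>lborel)"
    by (subst nn_integral_cmult[symmetric]) (auto simp: ennreal_mult'')
  then show ?thesis using assms by (simp add: nn_integral_normal_density)
qed

text \<open>Multiplication by exp (t x^2) turns the density into a multiple of the normal density
  with variance 1 / (1 - 2 t).\<close>

lemma std_normal_exp_square:
  assumes "t < 1 / 2"
  shows "(\<integral>\<^sup>+x. ennreal (std_normal_density x * exp (t * x\<^sup>2)) \<partial>lborel) = ennreal (1 / sqrt (1 - 2 * t))"
proof -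
  define \<sigma> where "\<sigma> = 1 / sqrt (1 - 2 * t)"
  have \<sigma>: "0 < \<sigma>" "\<sigma>\<^sup>2 = 1 / (1 - 2 * t)" using assms by (auto simp: \<sigma>_def power_divide)
  have "std_normal_density x * exp (t * x\<^sup>2) = \<sigma> * normal_density 0 \<sigma> x" for x
  proof -
    have "- x\<^sup>2 / 2 + t * x\<^sup>2 = - x\<^sup>2 / (2 * \<sigma>\<^sup>2)"
      unfolding \<sigma>(2) using assms by (simp add: field_simps)
    then have "exp (- x\<^sup>2 / 2) * exp (t * x\<^sup>2) = exp (- x\<^sup>2 / (2 * \<sigma>\<^sup>2))"
      unfolding exp_add[symmetric] by simp
    then show ?thesis using \<sigma>(1) by (simp add: normal_density_def real_sqrt_mult)
  qed
  then have "(\<integral>\<^sup>+x. ennreal (std_normal_density x * exp (t * x\<^sup>2)) \<partial>lborel)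
      = ennreal \<sigma> * (\<integral>\<^sup>+x. ennreal (normal_density 0 \<sigma> x) \<partial>lborel)"
    using \<sigma>(1) by (subst nn_integral_cmult[symmetric]) (auto simp: ennreal_mult'')
  then show ?thesis using \<sigma>(1) by (simp add: nn_integral_normal_density \<sigma>_def)
qed

text \<open>After squaring, the claim becomes u^2 (1 - 6 u - 4 u^2 - 8 u^3) \<ge> 0, which holds up
  to u = 1/8. The coefficient of u is exactly 1, so that it cancels later against a mean of
  1.\<close>

lemma inverse_sqrt_le:
  fixes u :: real
  assumes "0 \<le> u" "u \<le> 1 / 8"
  shows "1 / sqrt (1 - 2 * u) \<le> 1 + u + 2 * u\<^sup>2"
proof -
  have pos: "0 < 1 - 2 * u" using assms by simp
  have uu: "u * u \<le> 1/8 * (1/8)" using assms by (intro mult_mono) simp_all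
  moreover have "u * u * u \<le> 1/8 * (1/8) * (1/8)" using assms uu by (intro mult_mono) simp_all
  ultimately have "0 \<le> u\<^sup>2 * (1 - 6 * u - 4 * (u * u) - 8 * (u * u * u))"
    using assms by (intro mult_nonneg_nonneg) auto
  then have "1 \<le> (1 + u + 2 * u\<^sup>2)\<^sup>2 * (1 - 2 * u)"
    by (simp add: power2_eq_square algebra_simps)
  then have "sqrt 1 \<le> sqrt ((1 + u + 2 * u\<^sup>2)\<^sup>2 * (1 - 2 * u))" by (rule real_sqrt_le_mono)
  also have "\<dots> = (1 + u + 2 * u\<^sup>2) * sqrt (1 - 2 * u)"
    using assms by (simp add: real_sqrt_mult)
  finally show ?thesis using pos by (simp add: divide_le_eq)
qed

text \<open>Linearises the square by \<open>exp (t X\<^sup>2) = \<integral> exp (sqrt (2 t) X \<xi>)\<close> over a standard normal \<open>\<xi>\<close>.\<close>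

lemma (in prob_space) subgaussian_exp_square_le:
  fixes X :: "'a \<Rightarrow> real"
  assumes X[measurable]: "X \<in> borel_measurable M"
    and sg: "\<And>c. (\<integral>\<^sup>+\<omega>. ennreal (exp (c * X \<omega>)) \<partial>M) \<le> ennreal (exp (c\<^sup>2 * v / 2))"
    and t: "0 \<le> t" "0 \<le> v" "t * v \<le> 1 / 8"
  shows "(\<integral>\<^sup>+\<omega>. ennreal (exp (t * (X \<omega>)\<^sup>2)) \<partial>M) \<le> ennreal (1 + t * v + 2 * (t * v)\<^sup>2)"
proof -
  interpret pair_sigma_finite M lborel ..
  define r where "r = sqrt (2 * t)"
  have r: "r\<^sup>2 = 2 * t" using t by (simp add: r_def)
  have "(\<integral>\<^sup>+\<omega>. ennreal (exp (t * (X \<omega>)\<^sup>2)) \<partial>M)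
      = (\<integral>\<^sup>+\<omega>. (\<integral>\<^sup>+\<xi>. ennreal (std_normal_density \<xi> * exp (r * X \<omega> * \<xi>)) \<partial>lborel) \<partial>M)"
    using r by (subst normal_density_mgf) (auto simp: power_mult_distrib)
  also have "\<dots> = (\<integral>\<^sup>+\<xi>. (\<integral>\<^sup>+\<omega>. ennreal (std_normal_density \<xi> * exp (r * X \<omega> * \<xi>)) \<partial>M) \<partial>lborel)"
    by (intro Fubini'[symmetric]) measurable
  also have "\<dots> \<le> (\<integral>\<^sup>+\<xi>. ennreal (std_normal_density \<xi> * exp (t * v * \<xi>\<^sup>2)) \<partial>lborel)"
  proof (rule nn_integral_mono)
    fix \<xi> :: real
    have "(\<integral>\<^sup>+\<omega>. ennreal (std_normal_density \<xi> * exp (r * X \<omega> * \<xi>)) \<partial>M)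
        = ennreal (std_normal_density \<xi>) * (\<integral>\<^sup>+\<omega>. ennreal (exp ((r * \<xi>) * X \<omega>)) \<partial>M)"
      by (subst nn_integral_cmult[symmetric]) (auto simp: ennreal_mult'' ac_simps)
    also have "\<dots> \<le> ennreal (std_normal_density \<xi>) * ennreal (exp ((r * \<xi>)\<^sup>2 * v / 2))"
      by (intro mult_left_mono sg) simp
    also have "\<dots> = ennreal (std_normal_density \<xi> * exp (t * v * \<xi>\<^sup>2))"
      using r by (simp add: ennreal_mult'' power_mult_distrib ac_simps)
    finally show "(\<integral>\<^sup>+\<omega>. ennreal (std_normal_density \<xi> * exp (r * X \<omega> * \<xi>)) \<partial>M)
        \<le> ennreal (std_normal_density \<xi> * exp (t * v * \<xi>\<^sup>2))" .
  qed
  also have "\<dots> = ennreal (1 / sqrt (1 - 2 * (t * v)))"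
    using t by (intro std_normal_exp_square) simp
  also have "\<dots> \<le> ennreal (1 + t * v + 2 * (t * v)\<^sup>2)"
    using t by (intro ennreal_leI inverse_sqrt_le) auto
  finally show ?thesis .
qed

text \<open>The variance proxy in \<open>entry_mgf\<close> equals the variance 1 / l, as it does for
  both distributions. This keeps the first-order terms of the moment bounds exact.\<close>

locale subgaussian_matrix = prob_space +
  fixes d l :: nat and W :: "'a \<Rightarrow> nat \<Rightarrow> nat \<Rightarrow> real"
  assumes l_pos: "0 < l"
    and indep: "indep_vars (\<lambda>_. borel) (\<lambda>(i, j) \<omega>. W \<omega> i j) ({..<d} \<times> {..<l})"
    and entry_mgf: "\<And>i j c. i < d \<Longrightarrow> j < l \<Longrightarrow>
      (\<integral>\<^sup>+\<omega>. ennreal (exp (c * W \<omega> i j)) \<partial>M) \<le> ennreal (exp (c\<^sup>2 / (2 * real l)))"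
    and entry_integrable: "\<And>i j. i < d \<Longrightarrow> j < l \<Longrightarrow> integrable M (\<lambda>\<omega>. W \<omega> i j)"
    and entry_mean: "\<And>i j. i < d \<Longrightarrow> j < l \<Longrightarrow> expectation (\<lambda>\<omega>. W \<omega> i j) = 0"
    and entry_sq_integrable: "\<And>i j. i < d \<Longrightarrow> j < l \<Longrightarrow> integrable M (\<lambda>\<omega>. (W \<omega> i j)\<^sup>2)"
    and entry_variance: "\<And>i j. i < d \<Longrightarrow> j < l \<Longrightarrow> expectation (\<lambda>\<omega>. (W \<omega> i j)\<^sup>2) = 1 / real l"
begin

definition proj :: "(nat \<Rightarrow> real) \<Rightarrow> nat \<Rightarrow> 'a \<Rightarrow> real" where
  "proj q j \<omega> = (\<Sum>i<d. q i * W \<omega> i j)"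

lemma entry_measurable: "i < d \<Longrightarrow> j < l \<Longrightarrow> (\<lambda>\<omega>. W \<omega> i j) \<in> borel_measurable M"
  using entry_integrable borel_measurable_integrable by blast

lemma proj_measurable: "j < l \<Longrightarrow> proj q j \<in> borel_measurable M"
  unfolding proj_def[abs_def] by (auto intro!: borel_measurable_sum borel_measurable_times entry_measurable)

text \<open>Functions of different columns read disjoint blocks of entries. A column appears as a
  restricted function because grouping independent variables into blocks yields that form.\<close>

lemma indep_column_functions:
  assumes "\<And>j. j < l \<Longrightarrow> F j \<in> borel_measurable (PiM ({..<d} \<times> {j}) (\<lambda>_. borel))"
  shows "indep_vars (\<lambda>_. borel)
    (\<lambda>j \<omega>. F j (restrict (\<lambda>p. case p of (i, j) \<Rightarrow> W \<omega> i j) ({..<d} \<times> {j}))) {..<l}"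
proof -
  have "indep_vars (\<lambda>j. PiM ({..<d} \<times> {j}) (\<lambda>_. borel))
    (\<lambda>j \<omega>. restrict (\<lambda>p. (case p of (i, j) \<Rightarrow> \<lambda>\<omega>. W \<omega> i j) \<omega>) ({..<d} \<times> {j})) {..<l}"
    by (rule indep_vars_restrict[OF indep]) (auto simp: disjoint_family_on_def)
  from indep_vars_compose2[OF this, of F "\<lambda>_. borel"] assms show ?thesis
    by (simp add: case_prod_unfold cong: restrict_cong)
qed

lemma indep_proj: "indep_vars (\<lambda>_. borel) (proj q) {..<l}"
proof -
  have "indep_vars (\<lambda>_. borel) (\<lambda>j \<omega>. (\<lambda>h. \<Sum>i<d. q i * h (i, j))
      (restrict (\<lambda>p. case p of (i, j) \<Rightarrow> W \<omega> i j) ({..<d} \<times> {j}))) {..<l}"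
    by (rule indep_column_functions)
      (auto intro!: borel_measurable_sum borel_measurable_times measurable_component_singleton)
  then show ?thesis by (simp add: proj_def[abs_def])
qed

lemma proj_mgf:
  assumes "j < l"
  shows "(\<integral>\<^sup>+\<omega>. ennreal (exp (c * proj q j \<omega>)) \<partial>M) \<le> ennreal (exp (c\<^sup>2 * ((\<Sum>i<d. (q i)\<^sup>2) / l) / 2))"
proof -
  let ?J = "{..<d} \<times> {j}"
  have ind: "indep_vars (\<lambda>_. borel) (\<lambda>(i, j) \<omega>. W \<omega> i j) ?J"
    using assms by (intro indep_vars_subset[OF indep]) auto
  have ind': "indep_vars (\<lambda>_. borel)
      (\<lambda>p \<omega>. ennreal (exp (c * q (fst p) * (case p of (i, j) \<Rightarrow> \<lambda>\<omega>. W \<omega> i j) \<omega>))) ?J"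
    by (rule indep_vars_compose2[OF ind]) measurable
  have exp_eq: "exp (c * proj q j \<omega>) = (\<Prod>p\<in>?J. exp (c * q (fst p) * W \<omega> (fst p) (snd p)))" for \<omega>
  proof -
    have "(\<Prod>p\<in>?J. exp (c * q (fst p) * W \<omega> (fst p) (snd p))) = exp (\<Sum>p\<in>?J. c * q (fst p) * W \<omega> (fst p) (snd p))"
      by (simp add: exp_sum)
    also have "(\<Sum>p\<in>?J. c * q (fst p) * W \<omega> (fst p) (snd p)) = (\<Sum>i<d. c * q i * W \<omega> i j)"
      using sum.cartesian_product[of "\<lambda>i j. c * q i * W \<omega> i j" "{j}" "{..<d}"] by (simp add: case_prod_unfold)
    finally show ?thesis by (simp add: proj_def sum_distrib_left mult.assoc)
  qed
  have "(\<integral>\<^sup>+\<omega>. ennreal (exp (c * proj q j \<omega>)) \<partial>M)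
      = (\<integral>\<^sup>+\<omega>. (\<Prod>p\<in>?J. ennreal (exp (c * q (fst p) * (case p of (i, j) \<Rightarrow> \<lambda>\<omega>. W \<omega> i j) \<omega>))) \<partial>M)"
    unfolding exp_eq by (simp add: prod_ennreal case_prod_unfold)
  also have "\<dots> = (\<Prod>p\<in>?J. \<integral>\<^sup>+\<omega>. ennreal (exp (c * q (fst p) * (case p of (i, j) \<Rightarrow> \<lambda>\<omega>. W \<omega> i j) \<omega>)) \<partial>M)"
    by (intro indep_vars_nn_integral ind') auto
  also have "\<dots> \<le> (\<Prod>p\<in>?J. ennreal (exp ((c * q (fst p))\<^sup>2 / (2 * real l))))"
    using assms by (intro prod_mono_ennreal) (auto intro!: entry_mgf)
  also have "\<dots> = ennreal (exp (\<Sum>p\<in>?J. (c * q (fst p))\<^sup>2 / (2 * real l)))"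
    by (simp add: prod_ennreal exp_sum)
  also have "(\<Sum>p\<in>?J. (c * q (fst p))\<^sup>2 / (2 * real l)) = (\<Sum>i<d. (c * q i)\<^sup>2 / (2 * real l))"
    using sum.cartesian_product[of "\<lambda>i j. (c * q i)\<^sup>2 / (2 * real l)" "{j}" "{..<d}"] by (simp add: case_prod_unfold)
  also have "\<dots> = c\<^sup>2 * ((\<Sum>i<d. (q i)\<^sup>2) / l) / 2"
    by (simp add: power_mult_distrib sum_distrib_left sum_divide_distrib mult.commute)
  finally show ?thesis .
qed

lemma proj_exp_square:
  assumes "j < l" "0 \<le> t" "t * (\<Sum>i<d. (q i)\<^sup>2) \<le> 1 / 8"
  shows "(\<integral>\<^sup>+\<omega>. ennreal (exp (t * (real l * (proj q j \<omega>)\<^sup>2))) \<partial>M)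
    \<le> ennreal (1 + t * (\<Sum>i<d. (q i)\<^sup>2) + 2 * (t * (\<Sum>i<d. (q i)\<^sup>2))\<^sup>2)"
  using subgaussian_exp_square_le[of "proj q j" "(\<Sum>i<d. (q i)\<^sup>2) / l" "t * l", OF proj_measurable proj_mgf] assms l_pos
  by (simp add: sum_nonneg mult.assoc)

lemma entry_product:
  assumes "i < d" "i' < d" "j < l"
  shows "integrable M (\<lambda>\<omega>. W \<omega> i j * W \<omega> i' j)"
    and "expectation (\<lambda>\<omega>. W \<omega> i j * W \<omega> i' j) = (if i = i' then 1 / l else 0)"
proof -
  have "integrable M (\<lambda>\<omega>. W \<omega> i j * W \<omega> i' j) \<and>
    expectation (\<lambda>\<omega>. W \<omega> i j * W \<omega> i' j) = (if i = i' then 1 / l else 0)"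
  proof (cases "i = i'")
    case True
    then show ?thesis
      using entry_sq_integrable[of i j] entry_variance[of i j] assms by (simp add: power2_eq_square)
  next
    case False
    have "indep_var borel (\<lambda>\<omega>. W \<omega> i j) borel (\<lambda>\<omega>. W \<omega> i' j)"
    proof -
      have "indep_var borel ((\<lambda>h. h (i, j)) \<circ> (\<lambda>\<omega>. restrict (\<lambda>p. (case p of (i, j) \<Rightarrow> \<lambda>\<omega>. W \<omega> i j) \<omega>) {(i, j)}))
        borel ((\<lambda>h. h (i', j)) \<circ> (\<lambda>\<omega>. restrict (\<lambda>p. (case p of (i, j) \<Rightarrow> \<lambda>\<omega>. W \<omega> i j) \<omega>) {(i', j)}))"
        using assms False
        by (intro indep_var_compose[OF indep_var_restrict[OF indep]] measurable_component_singleton) auto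
      then show ?thesis by (simp add: comp_def)
    qed
    from indep_var_lebesgue_integral[OF this] indep_var_integrable[OF this] show ?thesis
      using assms entry_integrable entry_mean False by simp
  qed
  then show "integrable M (\<lambda>\<omega>. W \<omega> i j * W \<omega> i' j)"
    and "expectation (\<lambda>\<omega>. W \<omega> i j * W \<omega> i' j) = (if i = i' then 1 / l else 0)" by auto
qed

text \<open>Distinct entries of a column are uncorrelated, so only the diagonal terms contribute. In
  particular <s_j, q> s_j has mean q / l, the drift of the cosh recursion.\<close>

lemma proj_product:
  assumes "j < l"
  shows "has_bochner_integral M (\<lambda>\<omega>. proj p j \<omega> * proj q j \<omega>) ((\<Sum>i<d. p i * q i) / l)"
proof -
  have eq: "(\<lambda>\<omega>. proj p j \<omega> * proj q j \<omega>) = (\<lambda>\<omega>. \<Sum>i<d. \<Sum>i'<d. p i * q i' * (W \<omega> i j * W \<omega> i' j))"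
    by (rule ext) (simp add: proj_def sum_product mult_ac)
  have "has_bochner_integral M (\<lambda>\<omega>. \<Sum>i<d. \<Sum>i'<d. p i * q i' * (W \<omega> i j * W \<omega> i' j))
      (\<Sum>i<d. \<Sum>i'<d. p i * q i' * (if i = i' then 1 / l else 0))"
    using assms entry_product
    by (intro has_bochner_integral_sum has_bochner_integral_mult_right) (auto simp: has_bochner_integral_iff)
  also have "(\<Sum>i<d. \<Sum>i'<d. p i * q i' * (if i = i' then 1 / l else 0)) = (\<Sum>i<d. p i * q i) / l"
    by (simp add: if_distrib sum_divide_distrib sum.delta cong: if_cong)
  finally show ?thesis unfolding eq .
qed

end

text \<open>Since the mean is 1, subtracting 1 + t X removes the constant and the linear part of the
  moment bound exactly and leaves 2 t^2.\<close>

lemma (in prob_space) exp_rest_expectation: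
  fixes X :: "'a \<Rightarrow> real"
  assumes mean: "has_bochner_integral M X 1"
    and mgf: "(\<integral>\<^sup>+\<omega>. ennreal (exp (t * X \<omega>)) \<partial>M) \<le> ennreal (1 + t + 2 * t\<^sup>2)" and t: "0 \<le> t"
  shows "integrable M (\<lambda>\<omega>. exp_rest (t * X \<omega>))"
    and "expectation (\<lambda>\<omega>. exp_rest (t * X \<omega>)) \<le> 2 * t\<^sup>2"
proof -
  have int: "integrable M X" and EX: "expectation X = 1"
    using mean by (auto simp: has_bochner_integral_iff)
  have [measurable]: "X \<in> borel_measurable M" using int by simp
  have "(\<integral>\<^sup>+\<omega>. ennreal (exp (t * X \<omega>)) \<partial>M) < \<infinity>"
    using mgf by (rule order_le_less_trans) simp
  then have int_exp: "integrable M (\<lambda>\<omega>. exp (t * X \<omega>))"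
    by (intro integrableI_nonneg) auto
  have "ennreal (expectation (\<lambda>\<omega>. exp (t * X \<omega>))) \<le> ennreal (1 + t + 2 * t\<^sup>2)"
    using mgf nn_integral_eq_integral[OF int_exp] by simp
  then have le: "expectation (\<lambda>\<omega>. exp (t * X \<omega>)) \<le> 1 + t + 2 * t\<^sup>2"
    using t by (subst (asm) ennreal_le_iff) auto
  show "integrable M (\<lambda>\<omega>. exp_rest (t * X \<omega>))"
    unfolding exp_rest_def using int int_exp by auto
  have "expectation (\<lambda>\<omega>. exp_rest (t * X \<omega>)) = expectation (\<lambda>\<omega>. exp (t * X \<omega>)) - 1 - t"
    unfolding exp_rest_def using int int_exp EX
    by (simp add: Bochner_Integration.integral_diff prob_space)
  with le show "expectation (\<lambda>\<omega>. exp_rest (t * X \<omega>)) \<le> 2 * t\<^sup>2" by simp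
qed

text \<open>The lower-tail moment follows from the upper one through
  \<open>exp_minus_le_exp_rest\<close>, since 1 - t X has mean exactly 1 - t.\<close>

lemma (in prob_space) exp_minus_nn_integral_le:
  fixes X :: "'a \<Rightarrow> real"
  assumes mean: "has_bochner_integral M X 1" and nonneg: "\<And>\<omega>. 0 \<le> X \<omega>"
    and mgf: "(\<integral>\<^sup>+\<omega>. ennreal (exp (t * X \<omega>)) \<partial>M) \<le> ennreal (1 + t + 2 * t\<^sup>2)" and t: "0 \<le> t"
  shows "(\<integral>\<^sup>+\<omega>. ennreal (exp (- (t * X \<omega>))) \<partial>M) \<le> ennreal (exp (- t + 2 * t\<^sup>2))"
proof -
  note rest = exp_rest_expectation[OF mean mgf t]
  have int: "integrable M X" and EX: "expectation X = 1"
    using mean by (auto simp: has_bochner_integral_iff)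
  have le: "exp (- (t * X \<omega>)) \<le> 1 - t * X \<omega> + exp_rest (t * X \<omega>)" for \<omega>
    using nonneg t by (intro exp_minus_le_exp_rest) simp
  have nn: "0 \<le> 1 - t * X \<omega> + exp_rest (t * X \<omega>)" for \<omega>
    using exp_ge_zero le by (rule order_trans)
  have "(\<integral>\<^sup>+\<omega>. ennreal (exp (- (t * X \<omega>))) \<partial>M) \<le> (\<integral>\<^sup>+\<omega>. ennreal (1 - t * X \<omega> + exp_rest (t * X \<omega>)) \<partial>M)"
    by (intro nn_integral_mono ennreal_leI le)
  also have "\<dots> = ennreal (expectation (\<lambda>\<omega>. 1 - t * X \<omega> + exp_rest (t * X \<omega>)))"
    using int rest(1) nn by (intro nn_integral_eq_integral) auto
  also have "expectation (\<lambda>\<omega>. 1 - t * X \<omega> + exp_rest (t * X \<omega>)) \<le> 1 + (- t + 2 * t\<^sup>2)"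
    using int rest EX by (simp add: prob_space)
  also have "\<dots> \<le> exp (- t + 2 * t\<^sup>2)" by (rule exp_ge_add_one_self)
  finally show ?thesis by (simp add: ennreal_leI)
qed

lemma convex_exp_sum_le:
  fixes p y :: "nat \<Rightarrow> real"
  assumes "(\<Sum>k<d. p k) = 1" "\<And>k. k < d \<Longrightarrow> 0 \<le> p k"
  shows "exp (\<Sum>k<d. p k * y k) \<le> (\<Sum>k<d. p k * exp (y k))"
proof -
  have "{..<d} \<noteq> {}" using assms(1) by fastforce
  from convex_on_sum[OF finite_lessThan this exp_convex assms(1), of y] assms(2)
  show ?thesis by simp
qed

context subgaussian_matrix
begin

lemma proj_unit_square:
  assumes "j < l" "(\<Sum>i<d. (u i)\<^sup>2) = 1"
  shows "has_bochner_integral M (\<lambda>\<omega>. real l * (proj u j \<omega>)\<^sup>2) 1"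
    and "0 \<le> t \<Longrightarrow> t \<le> 1 / 8 \<Longrightarrow>
      (\<integral>\<^sup>+\<omega>. ennreal (exp (t * (real l * (proj u j \<omega>)\<^sup>2))) \<partial>M) \<le> ennreal (1 + t + 2 * t\<^sup>2)"
proof -
  have "has_bochner_integral M (\<lambda>\<omega>. real l * (proj u j \<omega> * proj u j \<omega>)) (real l * ((\<Sum>i<d. u i * u i) / l))"
    by (intro has_bochner_integral_mult_right proj_product assms)
  then show "has_bochner_integral M (\<lambda>\<omega>. real l * (proj u j \<omega>)\<^sup>2) 1"
    using assms(2) l_pos by (simp add: power2_eq_square)
  show "(\<integral>\<^sup>+\<omega>. ennreal (exp (t * (real l * (proj u j \<omega>)\<^sup>2))) \<partial>M) \<le> ennreal (1 + t + 2 * t\<^sup>2)"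
    if "0 \<le> t" "t \<le> 1 / 8"
    using proj_exp_square[of j t u] assms that by simp
qed

text \<open>For H = B^T B this is the squared H-norm of column \<open>j\<close>, multiplied by l /
  tr H so that its mean is 1.\<close>

definition col_energy :: "(nat \<Rightarrow> nat \<Rightarrow> real) \<Rightarrow> nat \<Rightarrow> 'a \<Rightarrow> real" where
  "col_energy B j \<omega> = real l * (\<Sum>k<d. (proj (B k) j \<omega>)\<^sup>2) / (\<Sum>k<d. \<Sum>i<d. (B k i)\<^sup>2)"

lemma col_energy_mean:
  assumes "j < l" "0 < (\<Sum>k<d. \<Sum>i<d. (B k i)\<^sup>2)"
  shows "has_bochner_integral M (col_energy B j) 1"
proof -
  let ?Tr = "\<Sum>k<d. \<Sum>i<d. (B k i)\<^sup>2"
  have "has_bochner_integral M (\<lambda>\<omega>. real l * (\<Sum>k<d. proj (B k) j \<omega> * proj (B k) j \<omega>) / ?Tr)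
      (real l * (\<Sum>k<d. (\<Sum>i<d. B k i * B k i) / l) / ?Tr)"
    by (intro has_bochner_integral_divide_zero has_bochner_integral_mult_right has_bochner_integral_sum
        proj_product assms)
  moreover have "real l * (\<Sum>k<d. (\<Sum>i<d. B k i * B k i) / l) / ?Tr = 1"
    using assms l_pos by (simp add: power2_eq_square flip: sum_divide_distrib)
  ultimately show ?thesis unfolding col_energy_def[abs_def] power2_eq_square by simp
qed

text \<open>Projections on different rows of \<open>B\<close> are dependent, so their moments do not
  multiply. The energy is instead a convex combination of normalised squares, weighted by the shares
  of the rows in the trace, and Jensen's inequality bounds its moment by that of a single
  square.\<close>

lemma col_energy_mgf:
  assumes "j < l" "0 < (\<Sum>k<d. \<Sum>i<d. (B k i)\<^sup>2)" "0 \<le> t" "t \<le> 1 / 8"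
  shows "(\<integral>\<^sup>+\<omega>. ennreal (exp (t * col_energy B j \<omega>)) \<partial>M) \<le> ennreal (1 + t + 2 * t\<^sup>2)"
proof -
  define n where "n k = (\<Sum>i<d. (B k i)\<^sup>2)" for k
  define Tr where "Tr = (\<Sum>k<d. n k)"
  have Tr: "0 < Tr" using assms by (simp add: Tr_def n_def)
  have n0: "0 \<le> n k" for k by (simp add: n_def sum_nonneg)
  define y where "y k \<omega> = t / n k * (real l * (proj (B k) j \<omega>)\<^sup>2)" for k \<omega>
  have split: "t * col_energy B j \<omega> = (\<Sum>k<d. n k / Tr * y k \<omega>)" for \<omega>
  proof -
    have "n k / Tr * y k \<omega> = t * (real l * (proj (B k) j \<omega>)\<^sup>2) / Tr" for k
    proof (cases "n k = 0")
      case True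
      then have "B k i = 0" if "i < d" for i
        using that by (simp add: n_def sum_nonneg_eq_0_iff)
      then have "proj (B k) j \<omega> = 0" by (simp add: proj_def)
      then show ?thesis using True by (simp add: y_def)
    qed (simp add: y_def)
    then show ?thesis
      by (simp add: col_energy_def Tr_def n_def sum_distrib_left sum_divide_distrib)
  qed
  have y: "(\<lambda>\<omega>. y k \<omega>) \<in> borel_measurable M" for k
    unfolding y_def using assms(1) proj_measurable by auto
  have "(\<integral>\<^sup>+\<omega>. ennreal (exp (t * col_energy B j \<omega>)) \<partial>M)
      \<le> (\<integral>\<^sup>+\<omega>. (\<Sum>k<d. ennreal (n k / Tr) * ennreal (exp (y k \<omega>))) \<partial>M)"
  proof (rule nn_integral_mono)
    fix \<omega>
    have "exp (t * col_energy B j \<omega>) \<le> (\<Sum>k<d. n k / Tr * exp (y k \<omega>))"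
      unfolding split using Tr n0
      by (intro convex_exp_sum_le) (auto simp: Tr_def simp flip: sum_divide_distrib)
    then have "ennreal (exp (t * col_energy B j \<omega>)) \<le> ennreal (\<Sum>k<d. n k / Tr * exp (y k \<omega>))"
      by (rule ennreal_leI)
    also have "\<dots> = (\<Sum>k<d. ennreal (n k / Tr) * ennreal (exp (y k \<omega>)))"
      using Tr n0 by (subst sum_ennreal[symmetric]) (auto intro!: sum.cong simp: ennreal_mult simp del: times_divide_eq_left)
    finally show "ennreal (exp (t * col_energy B j \<omega>)) \<le> (\<Sum>k<d. ennreal (n k / Tr) * ennreal (exp (y k \<omega>)))" .
  qed
  also have "\<dots> = (\<Sum>k<d. ennreal (n k / Tr) * (\<integral>\<^sup>+\<omega>. ennreal (exp (y k \<omega>)) \<partial>M))"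
    using y by (subst nn_integral_sum) (auto intro!: sum.cong nn_integral_cmult)
  also have "\<dots> \<le> (\<Sum>k<d. ennreal (n k / Tr) * ennreal (1 + t + 2 * t\<^sup>2))"
  proof (intro sum_mono mult_left_mono)
    fix k
    have "(\<integral>\<^sup>+\<omega>. ennreal (exp (y k \<omega>)) \<partial>M) \<le> ennreal (1 + t / n k * n k + 2 * (t / n k * n k)\<^sup>2)"
      using proj_exp_square[of j "t / n k" "B k"] assms n0
      unfolding y_def n_def by (cases "n k = 0") (auto simp: n_def)
    also have "\<dots> \<le> ennreal (1 + t + 2 * t\<^sup>2)"
      using assms by (intro ennreal_leI) (cases "n k = 0"; simp)
    finally show "(\<integral>\<^sup>+\<omega>. ennreal (exp (y k \<omega>)) \<partial>M) \<le> ennreal (1 + t + 2 * t\<^sup>2)" .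
  qed simp
  also have "\<dots> = ennreal ((\<Sum>k<d. n k / Tr) * (1 + t + 2 * t\<^sup>2))"
    using Tr n0 assms by (simp add: ennreal_mult sum_nonneg flip: sum_ennreal sum_distrib_right)
  also have "(\<Sum>k<d. n k / Tr) = 1" using Tr by (simp add: Tr_def flip: sum_divide_distrib)
  finally show ?thesis by simp
qed

lemma indep_col_energy: "indep_vars (\<lambda>_. borel) (col_energy B) {..<l}"
proof -
  have "indep_vars (\<lambda>_. borel) (\<lambda>j \<omega>.
      (\<lambda>h. real l * (\<Sum>k<d. (\<Sum>i<d. B k i * h (i, j))\<^sup>2) / (\<Sum>k<d. \<Sum>i<d. (B k i)\<^sup>2))
      (restrict (\<lambda>p. case p of (i, j) \<Rightarrow> W \<omega> i j) ({..<d} \<times> {j}))) {..<l}"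
    by (rule indep_column_functions)
      (intro borel_measurable_sum borel_measurable_times borel_measurable_divide borel_measurable_power
         borel_measurable_const measurable_component_singleton; simp)
  then show ?thesis by (simp add: proj_def col_energy_def[abs_def])
qed

section \<open>Tail bounds for a single sketch\<close>

lemma prob_proj_small:
  assumes "(\<Sum>i<d. (u i)\<^sup>2) = 1"
  shows "prob {\<omega> \<in> space M. (\<Sum>j<l. (proj u j \<omega>)\<^sup>2) \<le> 1 / 2} \<le> exp (- (real l / 32))"
proof -
  \<comment> \<open>Chernoff bound for the lower tail at t = 1/8; the exponent is l (- 1/8 + 1/32 +
    1/16) = - l / 32.\<close>
  have "prob {\<omega> \<in> space M. - (real l / 16) \<le> (\<Sum>j<l. - (1 / 8 * (real l * (proj u j \<omega>)\<^sup>2)))}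
      \<le> exp (card {..<l} * (- (1 / 8) + 2 * (1 / 8)\<^sup>2) - - (real l / 16))"
    using assms
    by (intro chernoff_sum indep_vars_compose2[OF indep_proj] exp_minus_nn_integral_le proj_unit_square) auto
  moreover have "- (real l / 16) \<le> (\<Sum>j<l. - (1 / 8 * (real l * (proj u j \<omega>)\<^sup>2)))
      \<longleftrightarrow> (\<Sum>j<l. (proj u j \<omega>)\<^sup>2) \<le> 1 / 2" for \<omega>
  proof -
    have eq: "(\<Sum>j<l. - (1 / 8 * (real l * (proj u j \<omega>)\<^sup>2))) = - (real l / 8) * (\<Sum>j<l. (proj u j \<omega>)\<^sup>2)"
      by (simp add: sum_distrib_left sum_negf)
    show ?thesis using l_pos unfolding eq by (simp add: field_simps)
  qed
  ultimately show ?thesis by (simp add: power2_eq_square field_simps)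
qed

lemma prob_proj_sum_large:
  assumes "(\<Sum>i<d. (u i)\<^sup>2) = 1"
  shows "prob {\<omega> \<in> space M. sqrt (real l) / 4 \<le> (\<Sum>j<l. proj u j \<omega>)} \<le> exp (- (real l / 32))"
proof -
  \<comment> \<open>The sum over all columns has variance proxy 1, so the optimal exponential
    parameter coincides with the threshold.\<close>
  define c where "c = sqrt (real l) / 4"
  have c: "c\<^sup>2 = real l / 16" "0 < c" using l_pos by (auto simp: c_def power_divide)
  have "prob {\<omega> \<in> space M. c\<^sup>2 \<le> (\<Sum>j<l. c * proj u j \<omega>)}
      \<le> exp (card {..<l} * (c\<^sup>2 * (1 / l) / 2) - c\<^sup>2)"
    using proj_mgf[of _ c u] assms
    by (intro chernoff_sum indep_vars_compose2[OF indep_proj]) auto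
  moreover have "c\<^sup>2 \<le> (\<Sum>j<l. c * proj u j \<omega>) \<longleftrightarrow> c \<le> (\<Sum>j<l. proj u j \<omega>)" for \<omega>
    using c(2) by (simp add: power2_eq_square flip: sum_distrib_left)
  moreover have "card {..<l} * (c\<^sup>2 * (1 / l) / 2) - c\<^sup>2 = - (real l / 32)"
    using l_pos by (simp add: c(1) field_simps)
  ultimately show ?thesis unfolding c_def by simp
qed

lemma exp_five_thirtytwo: "1 + 1 / 8 + 2 * (1 / 8)\<^sup>2 \<le> exp (5 / 32 :: real)"
  using exp_ge_add_one_self[of "5 / 32 :: real"] by (simp add: power2_eq_square)

lemma prob_column_large:
  assumes "j < l"
  shows "prob {\<omega> \<in> space M. 5 * real d / 4 + real l \<le> real l * (\<Sum>i<d. (W \<omega> i j)\<^sup>2)} \<le> exp (- (real l / 8))"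
proof -
  have ind: "indep_vars (\<lambda>_. borel) (\<lambda>i \<omega>. (\<lambda>h. h (i, j))
      (restrict (\<lambda>p. (case p of (i, j) \<Rightarrow> \<lambda>\<omega>. W \<omega> i j) \<omega>) {(i, j)})) {..<d}"
    using assms by (intro indep_vars_compose2[OF indep_vars_restrict[OF indep]] measurable_component_singleton)
      (auto simp: disjoint_family_on_def)
  \<comment> \<open>Chernoff over the d entries at t = 1/8. The part 5 d / 4 of the threshold
    cancels the moments; the part l supplies the decay needed for a union bound over the
    columns.\<close>
  have "prob {\<omega> \<in> space M. (5 * real d / 4 + real l) / 8 \<le> (\<Sum>i<d. 1 / 8 * (real l * (W \<omega> i j)\<^sup>2))}
      \<le> exp (card {..<d} * (5 / 32) - (5 * real d / 4 + real l) / 8)"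
  proof (rule chernoff_sum)
    show "indep_vars (\<lambda>_. borel) (\<lambda>i \<omega>. 1 / 8 * (real l * (W \<omega> i j)\<^sup>2)) {..<d}"
      using indep_vars_compose2[OF ind, of "\<lambda>_ x. 1 / 8 * (real l * x\<^sup>2)" "\<lambda>_. borel"] by simp
    fix i assume i: "i \<in> {..<d}"
    let ?e = "\<lambda>i'. if i' = i then 1 else 0 :: real"
    have "proj ?e j \<omega> = W \<omega> i j" for \<omega>
      using i by (simp add: proj_def if_distrib[where f = "\<lambda>x. x * _"] cong: if_cong)
    moreover have "(\<Sum>i<d. (?e i)\<^sup>2) = 1"
      using i by (simp add: if_distrib[where f = "\<lambda>x. x\<^sup>2"] cong: if_cong)
    ultimately have "(\<integral>\<^sup>+\<omega>. ennreal (exp (1 / 8 * (real l * (W \<omega> i j)\<^sup>2))) \<partial>M) \<le> ennreal (1 + 1 / 8 + 2 * (1 / 8)\<^sup>2)"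
      using proj_unit_square(2)[OF assms, of ?e "1 / 8"] by simp
    also have "\<dots> \<le> ennreal (exp (5 / 32))" by (intro ennreal_leI exp_five_thirtytwo)
    finally show "(\<integral>\<^sup>+\<omega>. ennreal (exp (1 / 8 * (real l * (W \<omega> i j)\<^sup>2))) \<partial>M) \<le> ennreal (exp (5 / 32))" .
  qed simp
  moreover have "(\<Sum>i<d. 1 / 8 * (real l * (W \<omega> i j)\<^sup>2)) = real l * (\<Sum>i<d. (W \<omega> i j)\<^sup>2) / 8" for \<omega>
    by (simp add: sum_distrib_left sum_divide_distrib)
  moreover have "card {..<d} * (5 / 32) - (5 * real d / 4 + real l) / 8 = - (real l / 8)"
    by (simp add: field_simps)
  ultimately show ?thesis by simp
qed

lemma prob_energy_large:
  assumes "0 < (\<Sum>k<d. \<Sum>i<d. (B k i)\<^sup>2)"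
  shows "prob {\<omega> \<in> space M. 2 * (\<Sum>k<d. \<Sum>i<d. (B k i)\<^sup>2) \<le> (\<Sum>j<l. \<Sum>k<d. (proj (B k) j \<omega>)\<^sup>2)}
    \<le> exp (- (3 * real l / 32))"
proof -
  have e: "ennreal (1 + 1 / 8 + 2 * (1 / 8)\<^sup>2) \<le> ennreal (exp (5 / 32))"
    by (intro ennreal_leI exp_five_thirtytwo)
  have "prob {\<omega> \<in> space M. real l / 4 \<le> (\<Sum>j<l. 1 / 8 * col_energy B j \<omega>)}
      \<le> exp (card {..<l} * (5 / 32) - real l / 4)"
    using assms
    by (intro chernoff_sum indep_vars_compose2[OF indep_col_energy] order_trans[OF col_energy_mgf e]) auto
  moreover have "real l / 4 \<le> (\<Sum>j<l. 1 / 8 * col_energy B j \<omega>)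
      \<longleftrightarrow> 2 * (\<Sum>k<d. \<Sum>i<d. (B k i)\<^sup>2) \<le> (\<Sum>j<l. \<Sum>k<d. (proj (B k) j \<omega>)\<^sup>2)" for \<omega>
  proof -
    have eq: "(\<Sum>j<l. 1 / 8 * col_energy B j \<omega>) =
        real l * (\<Sum>j<l. \<Sum>k<d. (proj (B k) j \<omega>)\<^sup>2) / (8 * (\<Sum>k<d. \<Sum>i<d. (B k i)\<^sup>2))"
      unfolding col_energy_def by (simp add: sum_distrib_left sum_divide_distrib mult_ac)
    show ?thesis using l_pos assms unfolding eq by (simp add: field_simps)
  qed
  ultimately show ?thesis by (simp add: field_simps)
qed

text \<open>The scale \<open>r\<close> makes the norm of the new summand equal to t sqrt (P N),
  where P is the normalised squared projection and N the column energy, both of mean 1. They are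
  dependent, so sqrt (P N) \<le> (P + N) / 2 and convexity of \<open>exp_rest\<close> reduce the
  remainder to the average of two separate moments, each at most 2 t^2.\<close>

lemma cosh_step:
  fixes B :: "nat \<Rightarrow> nat \<Rightarrow> real" and u x :: "nat \<Rightarrow> real"
  defines "Tr \<equiv> (\<Sum>k<d. \<Sum>i<d. (B k i)\<^sup>2)"
  defines "G \<equiv> L2_set (\<lambda>k. \<Sum>i<d. B k i * u i) {..<d}"
  assumes j: "j < l" and u: "(\<Sum>i<d. (u i)\<^sup>2) = 1" and Tr: "0 < Tr"
    and t: "0 \<le> t" "t \<le> 1 / 8" and r: "r = t * real l / sqrt Tr"
  shows "(\<integral>\<^sup>+\<omega>. ennreal (cosh (r * L2_set (\<lambda>k. x k + proj (B k) j \<omega> * proj u j \<omega>) {..<d})) \<partial>M)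
    \<le> ennreal (cosh (r * L2_set x {..<d}) * (1 + (r * G / l + 2 * t\<^sup>2)))"
proof -
  have r0: "0 \<le> r" using t Tr by (simp add: r)
  have Ll: "0 < real l" using l_pos by simp
  define a where "a = r * L2_set x {..<d}"
  define s where "s = sinh a / a"
  define P where "P \<omega> = real l * (proj u j \<omega>)\<^sup>2" for \<omega>
  define y where "y \<omega> k = r * (proj (B k) j \<omega> * proj u j \<omega>)" for \<omega> k
  have a0: "0 \<le> a" using r0 by (simp add: a_def L2_set_nonneg)
  have aL2: "L2_set (\<lambda>k. r * x k) {..<d} = a" using r0 by (simp add: a_def L2_set_scale)
  have y_le: "exp_rest (L2_set (y \<omega>) {..<d}) \<le> (exp_rest (t * P \<omega>) + exp_rest (t * col_energy B j \<omega>)) / 2" for \<omega>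
  proof -
    have N0: "0 \<le> col_energy B j \<omega>" "0 \<le> P \<omega>"
      using Tr by (auto simp: col_energy_def Tr_def P_def intro!: divide_nonneg_pos mult_nonneg_nonneg sum_nonneg)
    have "L2_set (y \<omega>) {..<d} = r * \<bar>proj u j \<omega>\<bar> * sqrt (\<Sum>k<d. (proj (B k) j \<omega>)\<^sup>2)"
    proof -
      have "y \<omega> = (\<lambda>k. (r * proj u j \<omega>) * proj (B k) j \<omega>)" by (rule ext) (simp add: y_def)
      then show ?thesis using r0 by (simp add: L2_set_scale abs_mult) (simp add: L2_set_def)
    qed
    also have "\<dots> = t * (sqrt (P \<omega>) * sqrt (col_energy B j \<omega>))"
      using Ll unfolding r P_def col_energy_def Tr_def[symmetric]
      by (simp add: real_sqrt_mult real_sqrt_divide)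
    also have "\<dots> \<le> t * ((P \<omega> + col_energy B j \<omega>) / 2)"
      using t N0 by (intro mult_left_mono)
        (use arith_geo_mean_sqrt[of "P \<omega>" "col_energy B j \<omega>"] in \<open>auto simp: real_sqrt_mult\<close>)
    also have "\<dots> = (t * P \<omega> + t * col_energy B j \<omega>) / 2" by (simp add: algebra_simps)
    finally have "exp_rest (L2_set (y \<omega>) {..<d}) \<le> exp_rest ((t * P \<omega> + t * col_energy B j \<omega>) / 2)"
      by (intro exp_rest_mono L2_set_nonneg)
    also note exp_rest_mean
    finally show ?thesis .
  qed
  define R where "R \<omega> = cosh a + s * (\<Sum>k<d. (r * x k) * (r * (proj (B k) j \<omega> * proj u j \<omega>)))
    + cosh a * ((exp_rest (t * P \<omega>) + exp_rest (t * col_energy B j \<omega>)) / 2)" for \<omega>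
  have le: "cosh (r * L2_set (\<lambda>k. x k + proj (B k) j \<omega> * proj u j \<omega>) {..<d}) \<le> R \<omega>" for \<omega>
  proof -
    have "r * L2_set (\<lambda>k. x k + proj (B k) j \<omega> * proj u j \<omega>) {..<d}
        = L2_set (\<lambda>k. r * x k + y \<omega> k) {..<d}"
      using r0 L2_set_scale[of r "\<lambda>k. x k + proj (B k) j \<omega> * proj u j \<omega>"] by (simp add: y_def distrib_left)
    also have "cosh \<dots> \<le> cosh a + s * (\<Sum>k<d. (r * x k) * y \<omega> k) + cosh a * exp_rest (L2_set (y \<omega>) {..<d})"
      using cosh_L2_set_add_le[of "\<lambda>k. r * x k" "y \<omega>" "{..<d}"] unfolding aL2 s_def .
    also have "\<dots> \<le> R \<omega>"
      unfolding R_def y_def[symmetric] using y_le[of \<omega>] by (intro add_left_mono mult_left_mono) auto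
    finally show ?thesis .
  qed
  have P: "has_bochner_integral M P 1"
    using proj_unit_square(1)[OF j u] unfolding P_def[abs_def] .
  have Pm: "(\<integral>\<^sup>+\<omega>. ennreal (exp (t * P \<omega>)) \<partial>M) \<le> ennreal (1 + t + 2 * t\<^sup>2)"
    using proj_unit_square(2)[OF j u t] unfolding P_def .
  note restP = exp_rest_expectation[OF P Pm t(1)]
  note restN = exp_rest_expectation[OF col_energy_mean[OF j] col_energy_mgf[OF j _ t] t(1), OF Tr[unfolded Tr_def] Tr[unfolded Tr_def]]
  define c where "c = (\<Sum>k<d. (r * x k) * (r * ((\<Sum>i<d. B k i * u i) / l)))"
  have lin: "has_bochner_integral M (\<lambda>\<omega>. \<Sum>k<d. (r * x k) * (r * (proj (B k) j \<omega> * proj u j \<omega>))) c"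
    unfolding c_def by (intro has_bochner_integral_sum has_bochner_integral_mult_right proj_product j)
  \<comment> \<open>Cauchy-Schwarz bounds the drift, and sinh \<le> cosh turns it into a multiple of
    cosh a, so that all terms share this factor.\<close>
  have c_le: "s * c \<le> cosh a * (r * G / l)"
  proof -
    have "c = (r / l) * (\<Sum>k<d. (r * x k) * (\<Sum>i<d. B k i * u i))"
      by (simp add: c_def sum_distrib_left sum_divide_distrib mult_ac)
    also have "(\<Sum>k<d. (r * x k) * (\<Sum>i<d. B k i * u i)) \<le> a * G"
    proof -
      have "(\<Sum>k<d. (r * x k) * (\<Sum>i<d. B k i * u i)) \<le> (\<Sum>k<d. \<bar>r * x k\<bar> * \<bar>\<Sum>i<d. B k i * u i\<bar>)"
        by (intro sum_mono) (simp flip: abs_mult)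
      also have "\<dots> \<le> a * G" unfolding aL2[symmetric] G_def by (rule L2_set_mult_ineq)
      finally show ?thesis .
    qed
    finally have "c \<le> (r / l) * (a * G)" using r0 by (simp add: mult_left_mono divide_right_mono)
    moreover have "0 \<le> s" using a0 by (simp add: s_def)
    ultimately have "s * c \<le> s * ((r / l) * (a * G))" by (rule mult_left_mono)
    also have "\<dots> = (s * a) * (r * G / l)" by simp
    also have "\<dots> \<le> cosh a * (r * G / l)"
    proof (rule mult_right_mono)
      show "s * a \<le> cosh a" using sinh_le_cosh_real[of a] by (simp add: s_def)
      show "0 \<le> r * G / l" using r0 by (simp add: G_def L2_set_nonneg)
    qed
    finally show ?thesis .
  qed
  have intR: "integrable M R"
    unfolding R_def using lin restP(1) restN(1) by (auto simp: has_bochner_integral_iff)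
  have "expectation R = cosh a + s * c + cosh a * ((expectation (\<lambda>\<omega>. exp_rest (t * P \<omega>))
      + expectation (\<lambda>\<omega>. exp_rest (t * col_energy B j \<omega>))) / 2)"
    unfolding R_def using lin restP(1) restN(1) by (simp add: has_bochner_integral_iff prob_space)
  also have "\<dots> \<le> cosh a + cosh a * (r * G / l) + cosh a * (2 * t\<^sup>2)"
    using c_le restP(2) restN(2) by (intro add_mono mult_left_mono) auto
  finally have ER: "expectation R \<le> cosh a * (1 + (r * G / l + 2 * t\<^sup>2))" by (simp add: algebra_simps)
  have "(\<integral>\<^sup>+\<omega>. ennreal (cosh (r * L2_set (\<lambda>k. x k + proj (B k) j \<omega> * proj u j \<omega>) {..<d})) \<partial>M)
      \<le> (\<integral>\<^sup>+\<omega>. ennreal (R \<omega>) \<partial>M)"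
    by (intro nn_integral_mono ennreal_leI le)
  also have "\<dots> = ennreal (expectation R)"
  proof (rule nn_integral_eq_integral[OF intR], rule AE_I2)
    fix \<omega> show "0 \<le> R \<omega>" using le[of \<omega>] by (rule order_trans[rotated]) simp
  qed
  also have "\<dots> \<le> ennreal (cosh a * (1 + (r * G / l + 2 * t\<^sup>2)))" by (intro ennreal_leI ER)
  finally show ?thesis unfolding a_def .
qed

text \<open>Column n is independent of the earlier ones, so their sum can be frozen while
  \<open>cosh_step\<close> integrates over column n. The induction runs over prefixes of the
  columns, with \<open>r\<close> fixed by the full \<open>l\<close>.\<close>

lemma cosh_sum_le:
  fixes B :: "nat \<Rightarrow> nat \<Rightarrow> real" and u :: "nat \<Rightarrow> real"
  defines "Tr \<equiv> (\<Sum>k<d. \<Sum>i<d. (B k i)\<^sup>2)"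
  defines "G \<equiv> L2_set (\<lambda>k. \<Sum>i<d. B k i * u i) {..<d}"
  assumes u: "(\<Sum>i<d. (u i)\<^sup>2) = 1" and Tr: "0 < Tr"
    and t: "0 \<le> t" "t \<le> 1 / 8" and r: "r = t * real l / sqrt Tr" and n: "n \<le> l"
  shows "(\<integral>\<^sup>+\<omega>. ennreal (cosh (r * L2_set (\<lambda>k. \<Sum>j<n. proj (B k) j \<omega> * proj u j \<omega>) {..<d})) \<partial>M)
    \<le> ennreal ((1 + (r * G / l + 2 * t\<^sup>2)) ^ n)"
  using n
proof (induction n)
  case 0
  show ?case by (simp add: L2_set_def emeasure_space_1)
next
  case (Suc n)
  define C where "C = 1 + (r * G / l + 2 * t\<^sup>2)"
  have C: "0 \<le> C" using t Tr by (simp add: C_def r G_def L2_set_nonneg)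
  define V where "V = (\<lambda>p \<omega>. W \<omega> (fst p) (snd p))"
  have indV: "indep_vars (\<lambda>_. borel) V ({..<d} \<times> {..<l})"
    using indep by (simp add: V_def case_prod_unfold)
  let ?A = "{..<d} \<times> {..<n}" and ?B = "{..<d} \<times> {n}"
  let ?X = "\<lambda>\<omega>. restrict (\<lambda>p. V p \<omega>) ?A" and ?Y = "\<lambda>\<omega>. restrict (\<lambda>p. V p \<omega>) ?B"
  have ind: "indep_var (PiM ?A (\<lambda>_. borel)) ?X (PiM ?B (\<lambda>_. borel)) ?Y"
    using Suc.prems by (intro indep_var_restrict[OF indV]) auto
  define h where "h = (\<lambda>(a, b). ennreal (cosh (r * sqrt (\<Sum>k<d.
    ((\<Sum>j<n. (\<Sum>i<d. B k i * a (i, j)) * (\<Sum>i<d. u i * a (i, j)))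
      + (\<Sum>i<d. B k i * b (i, n)) * (\<Sum>i<d. u i * b (i, n)))\<^sup>2))))"
  have h: "h \<in> borel_measurable (PiM ?A (\<lambda>_. borel) \<Otimes>\<^sub>M PiM ?B (\<lambda>_. borel))"
  proof -
    have [measurable]: "(\<lambda>p. fst p (i, j)) \<in> borel_measurable (PiM ?A (\<lambda>_. borel) \<Otimes>\<^sub>M PiM ?B (\<lambda>_. borel))"
      if "i \<in> {..<d}" "j \<in> {..<n}" for i j
      using that by (intro measurable_compose[OF measurable_fst measurable_component_singleton]) auto
    have [measurable]: "(\<lambda>p. snd p (i, n)) \<in> borel_measurable (PiM ?A (\<lambda>_. borel) \<Otimes>\<^sub>M PiM ?B (\<lambda>_. borel))"
      if "i \<in> {..<d}" for i
      using that by (intro measurable_compose[OF measurable_snd measurable_component_singleton]) auto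
    have [measurable]: "(cosh :: real \<Rightarrow> real) \<in> borel_measurable borel"
      by (intro borel_measurable_continuous_onI continuous_intros)
    show ?thesis unfolding h_def case_prod_unfold by measurable
  qed
  have hXY: "h (?X \<omega>, ?Y \<omega>') = ennreal (cosh (r * L2_set (\<lambda>k. (\<Sum>j<n. proj (B k) j \<omega> * proj u j \<omega>)
      + proj (B k) n \<omega>' * proj u n \<omega>') {..<d}))" for \<omega> \<omega>'
    by (simp add: h_def V_def proj_def L2_set_def)
  have "(\<integral>\<^sup>+\<omega>. ennreal (cosh (r * L2_set (\<lambda>k. \<Sum>j<Suc n. proj (B k) j \<omega> * proj u j \<omega>) {..<d})) \<partial>M)
      = (\<integral>\<^sup>+\<omega>. h (?X \<omega>, ?Y \<omega>) \<partial>M)"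
    unfolding hXY by simp
  also have "\<dots> = (\<integral>\<^sup>+\<omega>. \<integral>\<^sup>+\<omega>'. h (?X \<omega>, ?Y \<omega>') \<partial>M \<partial>M)"
    by (rule nn_integral_indep_var[OF ind h])
  also have "\<dots> \<le> (\<integral>\<^sup>+\<omega>. ennreal (cosh (r * L2_set (\<lambda>k. \<Sum>j<n. proj (B k) j \<omega> * proj u j \<omega>) {..<d})) * ennreal C \<partial>M)"
  proof (rule nn_integral_mono)
    fix \<omega>
    show "(\<integral>\<^sup>+\<omega>'. h (?X \<omega>, ?Y \<omega>') \<partial>M)
      \<le> ennreal (cosh (r * L2_set (\<lambda>k. \<Sum>j<n. proj (B k) j \<omega> * proj u j \<omega>) {..<d})) * ennreal C"
      unfolding hXY C_def G_def
      using cosh_step[of n u B t r "\<lambda>k. \<Sum>j<n. proj (B k) j \<omega> * proj u j \<omega>"] Suc.prems u Tr t r C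
      by (simp add: Tr_def ennreal_mult'' C_def G_def)
  qed
  also have "\<dots> = (\<integral>\<^sup>+\<omega>. ennreal (cosh (r * L2_set (\<lambda>k. \<Sum>j<n. proj (B k) j \<omega> * proj u j \<omega>) {..<d})) \<partial>M) * ennreal C"
  proof (rule nn_integral_multc)
    have [measurable]: "proj q j \<in> borel_measurable M" if "j \<in> {..<n}" for q j
      using that Suc.prems by (intro proj_measurable) auto
    have [measurable]: "(cosh :: real \<Rightarrow> real) \<in> borel_measurable borel"
      by (intro borel_measurable_continuous_onI continuous_intros)
    show "(\<lambda>\<omega>. ennreal (cosh (r * L2_set (\<lambda>k. \<Sum>j<n. proj (B k) j \<omega> * proj u j \<omega>) {..<d}))) \<in> borel_measurable M"
      unfolding L2_set_def by measurable
  qed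
  also have "\<dots> \<le> ennreal (C ^ n) * ennreal C"
    using Suc unfolding C_def by (intro mult_right_mono) auto
  also have "\<dots> = ennreal (C ^ Suc n)" using C by (simp add: ennreal_mult'' mult.commute)
  finally show ?case unfolding C_def .
qed

text \<open>Markov's inequality for cosh, using cosh y \<ge> exp y / 2. The drift r G cancels
  against the threshold, and the exponent is l (2 t^2 - t / sqrt (2 k)).\<close>

lemma prob_sketch_product_large:
  fixes B :: "nat \<Rightarrow> nat \<Rightarrow> real" and u :: "nat \<Rightarrow> real"
  defines "Tr \<equiv> (\<Sum>k<d. \<Sum>i<d. (B k i)\<^sup>2)"
  defines "G \<equiv> L2_set (\<lambda>k. \<Sum>i<d. B k i * u i) {..<d}"
  assumes u: "(\<Sum>i<d. (u i)\<^sup>2) = 1" and Tr: "0 < Tr" and k: "2 \<le> k"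
  shows "prob {\<omega> \<in> space M. G + sqrt (Tr / (2 * k)) \<le> L2_set (\<lambda>m. \<Sum>j<l. proj (B m) j \<omega> * proj u j \<omega>) {..<d}}
    \<le> 2 * exp (- (real l / (16 * k)))"
proof -
  \<comment> \<open>The minimiser of 2 t^2 - t / sqrt (2 k), with value - 1 / (16 k); k \<ge> 2
    keeps it at most 1/8.\<close>
  define t where "t = 1 / (4 * sqrt (2 * k))"
  have sk: "2 \<le> sqrt (2 * k)" using k by (intro real_le_rsqrt) simp
  then have t: "0 < t" "t \<le> 1 / 8" using k by (auto simp: t_def divide_simps)
  have t2: "t\<^sup>2 = 1 / (32 * k)" using k by (simp add: t_def power_divide power_mult_distrib)
  define r where "r = t * real l / sqrt Tr"
  have r0: "0 < r" using t Tr l_pos by (simp add: r_def)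
  have rw: "r * sqrt (Tr / (2 * k)) = real l / (8 * k)"
  proof -
    have "r * sqrt (Tr / (2 * k)) = real l / (4 * (sqrt (2 * k) * sqrt (2 * k)))"
      using Tr by (simp add: r_def t_def real_sqrt_divide)
    also have "sqrt (2 * k) * sqrt (2 * k) = 2 * k" using k by simp
    finally show ?thesis by simp
  qed
  let ?Z = "\<lambda>\<omega>. L2_set (\<lambda>m. \<Sum>j<l. proj (B m) j \<omega> * proj u j \<omega>) {..<d}"
  define q where "q = r * G / l + 2 * t\<^sup>2"
  have q0: "0 \<le> q" using r0 by (simp add: q_def G_def L2_set_nonneg)
  have [measurable]: "proj q j \<in> borel_measurable M" if "j \<in> {..<l}" for q j
    using that by (intro proj_measurable) auto
  have [measurable]: "?Z \<in> borel_measurable M" unfolding L2_set_def by measurable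
  have [measurable]: "(cosh :: real \<Rightarrow> real) \<in> borel_measurable borel"
    by (intro borel_measurable_continuous_onI continuous_intros)
  have "(\<integral>\<^sup>+\<omega>. ennreal (cosh (r * ?Z \<omega>)) \<partial>M) \<le> ennreal ((1 + q) ^ l)"
    unfolding q_def G_def using cosh_sum_le[of u B t r l] u Tr t r_def by (simp add: Tr_def)
  also have "\<dots> \<le> ennreal (exp (real l * q))"
    unfolding exp_of_nat_mult using q0 by (intro ennreal_leI power_mono exp_ge_add_one_self) simp
  finally have mgf: "(\<integral>\<^sup>+\<omega>. ennreal (cosh (r * ?Z \<omega>)) \<partial>M) \<le> ennreal (exp (real l * q))" .
  let ?b = "r * (G + sqrt (Tr / (2 * k)))"
  have b: "?b = r * G + real l / (8 * k)" using rw by (simp add: distrib_left)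
  have "prob {\<omega> \<in> space M. G + sqrt (Tr / (2 * k)) \<le> ?Z \<omega>} \<le> prob {\<omega> \<in> space M. exp ?b / 2 \<le> cosh (r * ?Z \<omega>)}"
  proof (rule finite_measure_mono)
    show "{\<omega> \<in> space M. G + sqrt (Tr / (2 * k)) \<le> ?Z \<omega>} \<subseteq> {\<omega> \<in> space M. exp ?b / 2 \<le> cosh (r * ?Z \<omega>)}"
    proof safe
      fix \<omega> assume "G + sqrt (Tr / (2 * k)) \<le> ?Z \<omega>"
      then have "exp ?b \<le> exp (r * ?Z \<omega>)" using r0 by (simp add: mult_left_mono)
      also have "\<dots> \<le> 2 * cosh (r * ?Z \<omega>)" by (simp add: cosh_field_def)
      finally show "exp ?b / 2 \<le> cosh (r * ?Z \<omega>)" by simp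
    qed
  qed measurable
  also have "\<dots> \<le> exp (real l * q) / (exp ?b / 2)"
    by (intro prob_ge_le_nn_integral mgf) auto
  also have "\<dots> = 2 * exp (real l * q - ?b)" by (simp add: exp_diff)
  also have "real l * q - ?b = - (real l / (16 * k))"
    using l_pos k unfolding b q_def t2 by (simp add: field_simps)
  finally show ?thesis .
qed

end

section \<open>Good sketches\<close>

text \<open>With H = B^T B the third condition reads |S S^T g|_H \<le> |g|_H + |g| sqrt (tr H / (2
  k)). The fifth bounds the sum of the squared H-norms of the columns by 2 tr H; it limits how
  difference errors propagate through S.\<close>

definition good_sketch ::
    "nat \<Rightarrow> nat \<Rightarrow> (nat \<Rightarrow> nat \<Rightarrow> real) \<Rightarrow> real \<Rightarrow> (nat \<Rightarrow> real) \<Rightarrow> (nat \<Rightarrow> nat \<Rightarrow> real) \<Rightarrow> bool" where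
  "good_sketch d l B k g S \<longleftrightarrow>
     (\<Sum>i<d. (g i)\<^sup>2) / 2 \<le> (\<Sum>j<l. (\<Sum>i<d. g i * S i j)\<^sup>2) \<and>
     (\<Sum>j<l. \<Sum>i<d. g i * S i j)\<^sup>2 \<le> real l / 16 * (\<Sum>i<d. (g i)\<^sup>2) \<and>
     L2_set (\<lambda>m. \<Sum>j<l. (\<Sum>i<d. B m i * S i j) * (\<Sum>i<d. g i * S i j)) {..<d}
       \<le> L2_set (\<lambda>m. \<Sum>i<d. B m i * g i) {..<d}
          + L2_set g {..<d} * sqrt ((\<Sum>m<d. \<Sum>i<d. (B m i)\<^sup>2) / (2 * k)) \<and>
     (\<forall>j<l. real l * (\<Sum>i<d. (S i j)\<^sup>2) \<le> 5 * real d / 4 + real l) \<and>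
     (\<Sum>j<l. \<Sum>m<d. (\<Sum>i<d. B m i * S i j)\<^sup>2) \<le> 2 * (\<Sum>m<d. \<Sum>i<d. (B m i)\<^sup>2)"

text \<open>The conditions involving \<open>g\<close> are homogeneous in it, so \<open>g\<close> is
  replaced by the unit vector \<open>u\<close>. A union bound over the failure events remains;
  \<open>E2\<close> and \<open>E3\<close> treat the two signs of the sum.\<close>

lemma (in subgaussian_matrix) prob_not_good_sketch_le:
  assumes g: "0 < (\<Sum>i<d. (g i)\<^sup>2)" and Tr: "0 < (\<Sum>m<d. \<Sum>i<d. (B m i)\<^sup>2)" and k: "2 \<le> k"
  shows "prob {\<omega> \<in> space M. \<not> good_sketch d l B k g (W \<omega>)}
    \<le> 3 * exp (- (real l / 32)) + 2 * exp (- (real l / (16 * k))) + real l * exp (- (real l / 8))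
      + exp (- (3 * real l / 32))"
proof -
  define n where "n = L2_set g {..<d}"
  have n2: "n\<^sup>2 = (\<Sum>i<d. (g i)\<^sup>2)" by (simp add: n_def L2_set_sq)
  have n: "0 < n" using g n2 by (metis L2_set_nonneg less_eq_real_def n_def zero_eq_power2 less_irrefl)
  define u where "u i = g i / n" for i
  have gu: "g i = n * u i" for i using n by (simp add: u_def)
  have u: "(\<Sum>i<d. (u i)\<^sup>2) = 1"
    using n by (simp add: u_def power_divide n2[symmetric] flip: sum_divide_distrib)
  have u': "(\<Sum>i<d. (- u i)\<^sup>2) = 1" using u by simp
  have yu: "(\<Sum>i<d. g i * W \<omega> i j) = n * proj u j \<omega>" for j \<omega>
    by (simp add: proj_def gu sum_distrib_left mult.assoc)
  have pm: "proj (\<lambda>i. - u i) j \<omega> = - proj u j \<omega>" for j \<omega> by (simp add: proj_def sum_negf)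
  let ?Tr = "\<Sum>m<d. \<Sum>i<d. (B m i)\<^sup>2"
  let ?G = "L2_set (\<lambda>m. \<Sum>i<d. B m i * u i) {..<d}"
  define E1 where "E1 = {\<omega> \<in> space M. (\<Sum>j<l. (proj u j \<omega>)\<^sup>2) \<le> 1 / 2}"
  define E2 where "E2 = {\<omega> \<in> space M. sqrt (real l) / 4 \<le> (\<Sum>j<l. proj u j \<omega>)}"
  define E3 where "E3 = {\<omega> \<in> space M. sqrt (real l) / 4 \<le> (\<Sum>j<l. proj (\<lambda>i. - u i) j \<omega>)}"
  define E4 where "E4 = {\<omega> \<in> space M. ?G + sqrt (?Tr / (2 * k))
    \<le> L2_set (\<lambda>m. \<Sum>j<l. proj (B m) j \<omega> * proj u j \<omega>) {..<d}}"
  define E5 where "E5 j = {\<omega> \<in> space M. 5 * real d / 4 + real l \<le> real l * (\<Sum>i<d. (W \<omega> i j)\<^sup>2)}" for j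
  define E6 where "E6 = {\<omega> \<in> space M. 2 * ?Tr \<le> (\<Sum>j<l. \<Sum>k<d. (proj (B k) j \<omega>)\<^sup>2)}"
  have [measurable]: "proj q j \<in> borel_measurable M" if "j \<in> {..<l}" for q j
    using that by (intro proj_measurable) auto
  have [measurable]: "(\<lambda>\<omega>. W \<omega> i j) \<in> borel_measurable M" if "i \<in> {..<d}" "j < l" for i j
    using that by (intro entry_measurable) auto
  have sets: "E1 \<in> events" "E2 \<in> events" "E3 \<in> events" "E4 \<in> events" "E6 \<in> events"
    unfolding E1_def E2_def E3_def E4_def E6_def L2_set_def by measurable
  have sets5: "E5 j \<in> events" if "j < l" for j using that unfolding E5_def by measurable
  have sub: "{\<omega> \<in> space M. \<not> good_sketch d l B k g (W \<omega>)} \<subseteq> E1 \<union> (E2 \<union> (E3 \<union> (E4 \<union> ((\<Union>j<l. E5 j) \<union> E6))))"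
  proof
    fix \<omega> assume w: "\<omega> \<in> {\<omega> \<in> space M. \<not> good_sketch d l B k g (W \<omega>)}"
    show "\<omega> \<in> E1 \<union> (E2 \<union> (E3 \<union> (E4 \<union> ((\<Union>j<l. E5 j) \<union> E6))))"
    proof (rule ccontr)
      assume not: "\<omega> \<notin> E1 \<union> (E2 \<union> (E3 \<union> (E4 \<union> ((\<Union>j<l. E5 j) \<union> E6))))"
      have n1: "1 / 2 < (\<Sum>j<l. (proj u j \<omega>)\<^sup>2)"
        and n23: "\<bar>\<Sum>j<l. proj u j \<omega>\<bar> < sqrt (real l) / 4"
        and n4: "L2_set (\<lambda>m. \<Sum>j<l. proj (B m) j \<omega> * proj u j \<omega>) {..<d} < ?G + sqrt (?Tr / (2 * k))"
        and n5: "\<forall>j<l. real l * (\<Sum>i<d. (W \<omega> i j)\<^sup>2) < 5 * real d / 4 + real l"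
        and n6: "(\<Sum>j<l. \<Sum>k<d. (proj (B k) j \<omega>)\<^sup>2) < 2 * ?Tr"
        using w not by (auto simp: E1_def E2_def E3_def E4_def E5_def E6_def not_le pm sum_negf abs_less_iff)
      have g1: "n\<^sup>2 / 2 \<le> (\<Sum>j<l. (n * proj u j \<omega>)\<^sup>2)"
        using n1 n by (simp add: power_mult_distrib flip: sum_distrib_left)
      have "(\<Sum>j<l. proj u j \<omega>)\<^sup>2 \<le> (sqrt (real l) / 4)\<^sup>2"
        using n23 by (intro power2_le_iff_abs_le[THEN iffD2]) auto
      then have "n\<^sup>2 * (\<Sum>j<l. proj u j \<omega>)\<^sup>2 \<le> n\<^sup>2 * (real l / 16)"
        by (intro mult_left_mono) (simp_all add: power_divide)
      then have g2: "(\<Sum>j<l. n * proj u j \<omega>)\<^sup>2 \<le> real l / 16 * n\<^sup>2"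
        by (simp add: power_mult_distrib mult.commute flip: sum_distrib_left)
      have e1: "(\<lambda>m. \<Sum>j<l. proj (B m) j \<omega> * (n * proj u j \<omega>)) = (\<lambda>m. n * (\<Sum>j<l. proj (B m) j \<omega> * proj u j \<omega>))"
        by (simp add: sum_distrib_left mult_ac)
      have e2: "(\<lambda>m. \<Sum>i<d. B m i * g i) = (\<lambda>m. n * (\<Sum>i<d. B m i * u i))"
        by (simp add: gu sum_distrib_left mult_ac)
      have g3: "L2_set (\<lambda>m. \<Sum>j<l. proj (B m) j \<omega> * (n * proj u j \<omega>)) {..<d}
          \<le> L2_set (\<lambda>m. \<Sum>i<d. B m i * g i) {..<d} + n * sqrt (?Tr / (2 * k))"
        unfolding e1 e2 L2_set_scale using n mult_left_mono[OF less_imp_le[OF n4], of n]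
        by (simp add: distrib_left)
      have "good_sketch d l B k g (W \<omega>)"
        unfolding good_sketch_def yu n2[symmetric] n_def[symmetric]
        using g1 g2 g3 n5 n6 by (auto simp: proj_def less_imp_le)
      with w show False by simp
    qed
  qed
  have "prob {\<omega> \<in> space M. \<not> good_sketch d l B k g (W \<omega>)} \<le> prob (E1 \<union> (E2 \<union> (E3 \<union> (E4 \<union> ((\<Union>j<l. E5 j) \<union> E6)))))"
    using sets sets5 by (intro finite_measure_mono sub) auto
  also have "\<dots> \<le> prob E1 + (prob E2 + (prob E3 + (prob E4 + (prob (\<Union>j<l. E5 j) + prob E6))))"
    using sets sets5 by (intro order_trans[OF measure_Un_le] add_left_mono) auto
  also have "prob (\<Union>j<l. E5 j) \<le> (\<Sum>j<l. prob (E5 j))"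
    using sets5 by (intro finite_measure_subadditive_finite) auto
  also have "\<dots> \<le> (\<Sum>j<l. exp (- (real l / 8)))"
    unfolding E5_def by (intro sum_mono prob_column_large) auto
  finally have "prob {\<omega> \<in> space M. \<not> good_sketch d l B k g (W \<omega>)} \<le> prob E1 + (prob E2 + (prob E3 + (prob E4 + (real l * exp (- (real l / 8)) + prob E6))))"
    by simp
  moreover have "prob E1 \<le> exp (- (real l / 32))" unfolding E1_def by (rule prob_proj_small[OF u])
  moreover have "prob E2 \<le> exp (- (real l / 32))" unfolding E2_def by (rule prob_proj_sum_large[OF u])
  moreover have "prob E3 \<le> exp (- (real l / 32))" unfolding E3_def by (rule prob_proj_sum_large[OF u'])
  moreover have "prob E4 \<le> 2 * exp (- (real l / (16 * k)))"
    unfolding E4_def by (rule prob_sketch_product_large[OF u Tr k])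
  moreover have "prob E6 \<le> exp (- (3 * real l / 32))" unfolding E6_def by (rule prob_energy_large[OF Tr])
  ultimately show ?thesis by linarith
qed

text \<open>With x = 64 y, exp (6 y) \<ge> (1 + y)^6 \<ge> 4 y * 2^4. It absorbs the factor l of the
  union bound over columns: l exp (- l / 8) \<le> exp (- l / 32).\<close>

lemma le_exp_three_thirtyseconds:
  fixes x :: real
  assumes "64 \<le> x"
  shows "x \<le> exp (3 * x / 32)"
proof -
  define y where "y = x / 64"
  have y: "1 \<le> y" "x = 64 * y" using assms by (auto simp: y_def)
  have "4 * y \<le> (1 + y)\<^sup>2" using zero_le_power2[of "1 - y"] by (simp add: power2_eq_square algebra_simps)
  moreover have "(2::real) ^ 4 \<le> (1 + y) ^ 4" using y by (intro power_mono) auto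
  ultimately have "4 * y * 2 ^ 4 \<le> (1 + y)\<^sup>2 * (1 + y) ^ 4"
    using y by (intro mult_mono) auto
  also have "\<dots> = (1 + y) ^ 6" by (simp flip: power_add)
  also have "\<dots> \<le> exp y ^ 6" using y by (intro power_mono exp_ge_add_one_self) auto
  also have "\<dots> = exp (3 * x / 32)" using y by (simp flip: exp_of_nat_mult)
  finally show ?thesis using y by simp
qed

lemma (in subgaussian_matrix) prob_not_good_sketch:
  assumes g: "0 < (\<Sum>i<d. (g i)\<^sup>2)" and Tr: "0 < (\<Sum>m<d. \<Sum>i<d. (B m i)\<^sup>2)" and k: "4 \<le> k"
    and T: "1 \<le> T" and \<delta>: "0 < \<delta>" "\<delta> < 1" and l: "16 * k * ln (4 * T / \<delta>) \<le> real l"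
  shows "prob {\<omega> \<in> space M. \<not> good_sketch d l B k g (W \<omega>)} \<le> \<delta> / T"
proof -
  define s where "s = ln (4 * T / \<delta>)"
  \<comment> \<open>The event on |S S^T g|_H costs 2 q. All others cost at most exp (- l / 32) \<le>
    q^2 in one of five terms, because k \<ge> 4 gives l \<ge> 64 ln (1 / q); these five fit into
    another 2 q since q \<le> 1/4.\<close>
  define q where "q = \<delta> / (4 * T)"
  have "4 * \<delta> \<le> 4 * T" using T \<delta> by simp
  then have T4: "4 \<le> 4 * T / \<delta>" using \<delta> by (simp add: field_simps)
  have q: "0 < q" "q \<le> 1 / 4" "\<delta> / T = 4 * q" using T4 T \<delta> by (auto simp: q_def field_simps)
  have es: "exp (- s) = q" using T4 T \<delta> by (simp add: s_def q_def exp_minus)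
  have "exp 1 \<le> 4 * T / \<delta>" using T4 exp_le by linarith
  then have s1: "1 \<le> s" using T4 by (simp add: s_def ln_ge_iff)
  have ks: "16 * k * s \<le> real l" using l by (simp add: s_def)
  have "16 * 4 * s \<le> 16 * k * s" using k s1 by (intro mult_right_mono) auto
  then have l64: "64 * s \<le> real l" using ks by linarith
  have q2: "exp (- (2 * s)) = q\<^sup>2" using es by (simp add: exp_double[symmetric] flip: es exp_double)
  have a1: "exp (- (real l / 32)) \<le> q\<^sup>2" unfolding q2[symmetric] using l64 by simp
  have a2: "exp (- (real l / (16 * k))) \<le> q" unfolding es[symmetric] using ks k by (simp add: field_simps)
  have a3: "exp (- (3 * real l / 32)) \<le> q\<^sup>2" unfolding q2[symmetric] using l64 s1 by simp
  have "real l * exp (- (real l / 8)) \<le> exp (3 * real l / 32) * exp (- (real l / 8))"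
    using l64 s1 by (intro mult_right_mono le_exp_three_thirtyseconds) auto
  also have "\<dots> = exp (- (real l / 32))" by (simp flip: exp_add)
  finally have a4: "real l * exp (- (real l / 8)) \<le> q\<^sup>2" using a1 by linarith
  have "prob {\<omega> \<in> space M. \<not> good_sketch d l B k g (W \<omega>)} \<le> 5 * q\<^sup>2 + 2 * q"
    using prob_not_good_sketch_le[OF g Tr, of k] k a1 a2 a3 a4 by linarith
  also have "5 * q\<^sup>2 \<le> 2 * q" using q by (simp add: power2_eq_square)
  finally show ?thesis using q by simp
qed

text \<open>x^2 / 2 - ln (cosh x) has derivative x - tanh x, which is nonnegative for x \<ge> 0.
  This is the subgaussian bound for a Rademacher entry.\<close>

lemma cosh_le_exp_square: "cosh (x :: real) \<le> exp (x\<^sup>2 / 2)"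
proof -
  have 1: "sinh y \<le> y * cosh y" if "0 \<le> y" for y :: real
  proof -
    have "\<exists>D. DERIV (\<lambda>x. x * cosh x - sinh x) z :> D \<and> 0 \<le> D" if "0 \<le> z" "z \<le> y" for z :: real
      using that by (intro exI[of _ "z * sinh z"]) (auto intro!: derivative_eq_intros)
    from DERIV_nonneg_imp_nondecreasing[OF \<open>0 \<le> y\<close> this] show ?thesis by simp
  qed
  have 2: "\<exists>D. DERIV (\<lambda>x. x\<^sup>2 / 2 - ln (cosh x)) z :> D \<and> 0 \<le> D" if "0 \<le> z" for z :: real
  proof (intro exI conjI)
    show "DERIV (\<lambda>x. x\<^sup>2 / 2 - ln (cosh x)) z :> z - sinh z / cosh z"
      by (auto intro!: derivative_eq_intros)
    show "0 \<le> z - sinh z / cosh z" using 1[OF that] by (simp add: divide_le_eq)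
  qed
  have "ln (cosh \<bar>x\<bar>) \<le> \<bar>x\<bar>\<^sup>2 / 2"
    using DERIV_nonneg_imp_nondecreasing[of 0 "\<bar>x\<bar>" "\<lambda>x. x\<^sup>2 / 2 - ln (cosh x)"] 2 by simp
  then have "ln (cosh x) \<le> x\<^sup>2 / 2" by simp
  then have "exp (ln (cosh x)) \<le> exp (x\<^sup>2 / 2)" by (simp only: exp_le_cancel_iff)
  then show ?thesis by (simp only: exp_ln cosh_real_pos)
qed

section \<open>Gaussian and Rademacher sketches as subgaussian matrices\<close>

lemma indep_entries_slice:
  assumes "prob_space M" "indep_entries M d l T S" "t < T"
  shows "prob_space.indep_vars M (\<lambda>_. borel) (\<lambda>(i, j) \<omega>. S t \<omega> i j) ({..<d} \<times> {..<l})"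
proof -
  interpret prob_space M by fact
  have "indep_vars (\<lambda>p. borel) (\<lambda>p \<omega>. (\<lambda>h. h (t, p)) (restrict (\<lambda>q. (case q of (t, i, j) \<Rightarrow> \<lambda>\<omega>. S t \<omega> i j) \<omega>) {(t, p)})) ({..<d} \<times> {..<l})"
    using assms(3)
    by (intro indep_vars_compose2[OF indep_vars_restrict[OF assms(2)[unfolded indep_entries_def]]]
        measurable_component_singleton) (auto simp: disjoint_family_on_def)
  then show ?thesis by (simp add: case_prod_unfold)
qed

lemma gaussian_subgaussian_matrix:
  assumes "prob_space M" "gaussian_sketches M d l T S" "t < T" "0 < l"
  shows "subgaussian_matrix M d l (S t)"
proof -
  interpret prob_space M by fact
  define \<sigma> where "\<sigma> = 1 / sqrt (real l)"
  have \<sigma>: "0 < \<sigma>" "\<sigma>\<^sup>2 = 1 / real l" using assms(4) by (auto simp: \<sigma>_def power_divide)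
  have D: "distributed M lborel (\<lambda>\<omega>. S t \<omega> i j) (\<lambda>x. ennreal (normal_density 0 \<sigma> x))" if "i < d" "j < l" for i j
    using assms(2,3) that by (simp add: gaussian_sketches_def \<sigma>_def)
  show ?thesis
  proof
    show "indep_vars (\<lambda>_. borel) (\<lambda>(i, j) \<omega>. S t \<omega> i j) ({..<d} \<times> {..<l})"
      using assms indep_entries_slice unfolding gaussian_sketches_def by blast
    fix i j assume ij: "i < d" "j < l"
    show "(\<integral>\<^sup>+\<omega>. ennreal (exp (c * S t \<omega> i j)) \<partial>M) \<le> ennreal (exp (c\<^sup>2 / (2 * real l)))" for c
    proof -
      have "(\<integral>\<^sup>+\<omega>. ennreal (exp (c * S t \<omega> i j)) \<partial>M)
          = (\<integral>\<^sup>+x. ennreal (normal_density 0 \<sigma> x) * ennreal (exp (c * x)) \<partial>lborel)"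
        by (rule distributed_nn_integral[OF D[OF ij], symmetric]) simp
      also have "\<dots> = ennreal (exp (c\<^sup>2 * \<sigma>\<^sup>2 / 2))"
        using normal_density_mgf[OF \<sigma>(1), of c] by (simp add: ennreal_mult'')
      finally show ?thesis by (simp add: \<sigma>(2) mult.commute)
    qed
    show "integrable M (\<lambda>\<omega>. S t \<omega> i j)"
      using distributed_integrable[OF D[OF ij], of "\<lambda>x. x"] integrable_normal_moment[OF \<sigma>(1), of 0 1] by simp
    show "integrable M (\<lambda>\<omega>. (S t \<omega> i j)\<^sup>2)"
      using distributed_integrable[OF D[OF ij], of "\<lambda>x. x\<^sup>2"] integrable_normal_moment[OF \<sigma>(1), of 0 2] by simp
    show E: "expectation (\<lambda>\<omega>. S t \<omega> i j) = 0"
      by (rule normal_distributed_expectation[OF \<sigma>(1) D[OF ij]])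
    show "expectation (\<lambda>\<omega>. (S t \<omega> i j)\<^sup>2) = 1 / real l"
      using normal_distributed_variance[OF \<sigma>(1) D[OF ij]] E \<sigma>(2) by simp
  qed (use assms in simp)
qed

lemma rademacher_subgaussian_matrix:
  assumes "prob_space M" "rademacher_sketches M d l T S" "t < T" "0 < l"
  shows "subgaussian_matrix M d l (S t)"
proof -
  interpret prob_space M by fact
  define a where "a = 1 / sqrt (real l)"
  have a: "0 < a" "a\<^sup>2 = 1 / real l" using assms(4) by (auto simp: a_def power_divide)
  have ind: "indep_vars (\<lambda>_. borel) (\<lambda>(i, j) \<omega>. S t \<omega> i j) ({..<d} \<times> {..<l})"
    using assms indep_entries_slice unfolding rademacher_sketches_def by blast
  show ?thesis
  proof
    fix i j assume ij: "i < d" "j < l"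
    define X where "X \<omega> = S t \<omega> i j" for \<omega>
    have [measurable]: "X \<in> borel_measurable M"
      using ind ij unfolding X_def[abs_def] indep_vars_def by auto
    define P N where "P = {\<omega> \<in> space M. X \<omega> = a}" and "N = {\<omega> \<in> space M. X \<omega> = - a}"
    have [measurable]: "P \<in> events" "N \<in> events" unfolding P_def N_def by measurable
    have PN: "prob P = 1 / 2" "prob N = 1 / 2"
      using assms(2,3) ij unfolding rademacher_sketches_def P_def N_def X_def a_def by auto
    have disj: "P \<inter> N = {}" using a by (auto simp: P_def N_def)
    \<comment> \<open>The two atoms carry all the mass, so the expectation of any function of the
      entry is the average of its values at \<open>a\<close> and \<open>- a\<close>.\<close>
    have "prob (P \<union> N) = 1" using disj PN by (simp add: finite_measure_Union)
    then have "AE \<omega> in M. \<omega> \<in> P \<union> N" by (rule AE_prob_1)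
    then have ae: "AE \<omega> in M. F (X \<omega>) = F a * indicator P \<omega> + F (- a) * indicator N \<omega>" for F :: "real \<Rightarrow> real"
      by eventually_elim (use disj in \<open>auto simp: P_def N_def indicator_def\<close>)
    have bi: "has_bochner_integral M (\<lambda>\<omega>. F (X \<omega>)) ((F a + F (- a)) / 2)"
      if [measurable]: "F \<in> borel_measurable borel" for F :: "real \<Rightarrow> real"
    proof -
      have "has_bochner_integral M (\<lambda>\<omega>. F a * indicator P \<omega> + F (- a) * indicator N \<omega>) (F a * prob P + F (- a) * prob N)"
        by (intro has_bochner_integral_add has_bochner_integral_mult_right has_bochner_integral_real_indicator)
          (auto simp: less_top[symmetric])
      moreover have "has_bochner_integral M (\<lambda>\<omega>. F (X \<omega>)) z \<longleftrightarrow>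
          has_bochner_integral M (\<lambda>\<omega>. F a * indicator P \<omega> + F (- a) * indicator N \<omega>) z" for z
        using ae[of F] by (intro has_bochner_integral_cong_AE) auto
      ultimately show ?thesis using PN by (simp add: add_divide_distrib)
    qed
    show "(\<integral>\<^sup>+\<omega>. ennreal (exp (c * S t \<omega> i j)) \<partial>M) \<le> ennreal (exp (c\<^sup>2 / (2 * real l)))" for c
    proof -
      have "(\<integral>\<^sup>+\<omega>. ennreal (exp (c * X \<omega>)) \<partial>M) = ennreal ((exp (c * a) + exp (c * - a)) / 2)"
        using bi[of "\<lambda>x. exp (c * x)"] by (auto simp: has_bochner_integral_iff nn_integral_eq_integral)
      also have "\<dots> = ennreal (cosh (c * a))" by (simp add: cosh_field_def)
      also have "\<dots> \<le> ennreal (exp ((c * a)\<^sup>2 / 2))" by (intro ennreal_leI cosh_le_exp_square)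
      finally show ?thesis by (simp add: X_def power_mult_distrib a(2) mult.commute)
    qed
    show "integrable M (\<lambda>\<omega>. S t \<omega> i j)" "expectation (\<lambda>\<omega>. S t \<omega> i j) = 0"
      using bi[of "\<lambda>x. x"] by (auto simp: has_bochner_integral_iff X_def)
    show "integrable M (\<lambda>\<omega>. (S t \<omega> i j)\<^sup>2)" "expectation (\<lambda>\<omega>. (S t \<omega> i j)\<^sup>2) = 1 / real l"
      using bi[of "\<lambda>x. x\<^sup>2"] by (auto simp: has_bochner_integral_iff X_def a(2))
  qed (use assms ind in simp_all)
qed

section \<open>One step of the method\<close>

lemma sum_sq_centered:
  fixes x :: "nat \<Rightarrow> real"
  assumes "0 < l"
  shows "(\<Sum>j<l. (x j - (\<Sum>i<l. x i) / l)\<^sup>2) = (\<Sum>j<l. (x j)\<^sup>2) - (\<Sum>j<l. x j)\<^sup>2 / l"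
proof -
  define m where "m = (\<Sum>i<l. x i) / l"
  have "(\<Sum>j<l. (x j - m)\<^sup>2) = (\<Sum>j<l. (x j)\<^sup>2) - 2 * m * (\<Sum>j<l. x j) + l * m\<^sup>2"
    by (simp add: power2_diff sum.distrib sum_subtractf sum_distrib_left algebra_simps)
  also have "\<dots> = (\<Sum>j<l. (x j)\<^sup>2) - (\<Sum>j<l. x j)\<^sup>2 / l"
    using assms by (simp add: m_def power2_eq_square field_simps)
  finally show ?thesis by (simp add: m_def)
qed

lemma L2_set_uminus: "L2_set (\<lambda>i. - x i) A = L2_set x A" for x :: "'a \<Rightarrow> real"
  by (simp add: L2_set_def)

text \<open>
  \<open>y\<close> are the true directional derivatives and \<open>e\<close> their finite-difference errors. Since \<open>y\<close> is
  nearly centred, dividing by the standard deviation amounts to dividing by the norm.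
\<close>

lemma normalised_differences:
  fixes y e :: "nat \<Rightarrow> real" and n :: real and l :: nat
  defines "v \<equiv> (\<lambda>j. y j + e j)"
  defines "D \<equiv> L2_set (\<lambda>j. v j - (\<Sum>i<l. v i) / l) {..<l}"
  assumes l: "0 < l" and n: "0 < n"
    and y: "n\<^sup>2 / 2 \<le> (\<Sum>j<l. (y j)\<^sup>2)" "(\<Sum>j<l. y j)\<^sup>2 \<le> real l / 16 * n\<^sup>2"
    and e: "L2_set e {..<l} \<le> n / 12"
  shows "11 / 20 * n \<le> D" and "n / 2 * D \<le> (\<Sum>j<l. y j * v j)"
proof -
  define U where "U = L2_set y {..<l}"
  define E where "E = L2_set e {..<l}"
  have U0: "0 \<le> U" and E0: "0 \<le> E" by (simp_all add: U_def E_def L2_set_nonneg)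
  let ?c = "\<lambda>x j. x j - (\<Sum>i<l. x i) / real l"
  \<comment> \<open>1/2 - 1/16 = 7/16 exceeds 0.66^2. Subtracting an error of n / 12 from 0.66 n
    leaves more than 11/20 n.\<close>
  have "(33 / 50 * n)\<^sup>2 \<le> n\<^sup>2 / 2 - n\<^sup>2 / 16"
    by (simp add: power2_eq_square field_simps)
  also have "\<dots> \<le> (\<Sum>j<l. (?c y j)\<^sup>2)"
    unfolding sum_sq_centered[OF l] using y l by (intro diff_mono) (auto simp: field_simps)
  finally have cy: "33 / 50 * n \<le> L2_set (?c y) {..<l}"
    unfolding L2_set_def using n by (intro real_le_rsqrt)
  \<comment> \<open>Centring is an orthogonal projection and cannot enlarge the errors.\<close>
  have "(\<Sum>j<l. (?c e j)\<^sup>2) \<le> (\<Sum>j<l. (e j)\<^sup>2)"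
    unfolding sum_sq_centered[OF l] by simp
  then have ce: "L2_set (?c e) {..<l} \<le> E" unfolding E_def L2_set_def by (rule real_sqrt_le_mono)
  have "?c y = (\<lambda>j. ?c v j + - ?c e j)" by (rule ext) (simp add: v_def sum.distrib add_divide_distrib)
  then have "L2_set (?c y) {..<l} \<le> D + L2_set (?c e) {..<l}"
    using L2_set_triangle_ineq[of "?c v" "\<lambda>j. - ?c e j" "{..<l}"] unfolding D_def L2_set_uminus by simp
  with cy ce e show "11 / 20 * n \<le> D" using n unfolding E_def by linarith
  have "D \<le> L2_set v {..<l}"
    unfolding D_def L2_set_def sum_sq_centered[OF l] by (intro real_sqrt_le_mono) simp
  also have "\<dots> \<le> U + E" unfolding v_def U_def E_def by (rule L2_set_triangle_ineq)
  finally have DUE: "D \<le> U + E" .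
  have U2: "U\<^sup>2 = (\<Sum>j<l. (y j)\<^sup>2)" by (simp add: U_def L2_set_sq)
  have "(7 / 10 * n)\<^sup>2 \<le> U\<^sup>2" 
  proof -
    have "(7 / 10 * n)\<^sup>2 = 49 / 100 * n\<^sup>2" by (simp add: power2_eq_square)
    then show ?thesis using y(1) zero_le_power2[of n] unfolding U2 by linarith
  qed
  then have U7: "7 / 10 * n \<le> U" using U0 by (rule power2_le_imp_le)
  have "- (U * E) \<le> (\<Sum>j<l. y j * e j)"
    using dot_le_L2[of l y e] unfolding dot_def U_def E_def by (simp add: abs_le_iff)
  then have yv: "U * U - U * E \<le> (\<Sum>j<l. y j * v j)"
    using U2 by (simp add: v_def distrib_left sum.distrib power2_eq_square)
  have "n / 2 * D \<le> n / 2 * (U + E)" using DUE n by (intro mult_left_mono) auto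
  also have "\<dots> \<le> U * U - U * E"
  proof -
    have "U * E \<le> U * (n / 12)" using e U0 unfolding E_def by (rule mult_left_mono)
    then have 1: "U * E \<le> (U * n) / 12" by simp
    have "n * E \<le> n * (n / 12)" using e n unfolding E_def by (intro mult_left_mono) auto
    then have 2: "n * E \<le> (n * n) / 12" by simp
    have "7 / 10 * n * U \<le> U * U" using U7 U0 by (rule mult_right_mono)
    then have 3: "7 / 10 * (U * n) \<le> U * U" by (simp add: mult_ac)
    have "7 / 10 * n * n \<le> U * n" using U7 n by (intro mult_right_mono) auto
    then have 4: "7 / 10 * (n * n) \<le> U * n" by (simp add: mult_ac)
    have 5: "0 \<le> U * n" using U0 n by simp
    have 6: "n / 2 * (U + E) = (U * n) / 2 + (n * E) / 2" by (simp add: algebra_simps)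
    have "un / 2 + ne / 2 \<le> uu - ue"
      \<comment> \<open>Naming the products as independent variables leaves a purely linear
        inequality.\<close>
      if "ue \<le> un / 12" "ne \<le> nn / 12" "7 / 10 * un \<le> uu" "7 / 10 * nn \<le> un" "0 \<le> un" for un ne uu ue nn :: real
      using that by linarith
    from this[OF 1 2 3 4 5] show ?thesis unfolding 6 .
  qed
  finally show "n / 2 * D \<le> (\<Sum>j<l. y j * v j)" using yv by linarith
qed

lemma L2_set_sum_mult_le:
  fixes z :: "nat \<Rightarrow> nat \<Rightarrow> real" and e :: "nat \<Rightarrow> real"
  shows "L2_set (\<lambda>m. \<Sum>j<l. z m j * e j) {..<d} \<le> sqrt (\<Sum>m<d. \<Sum>j<l. (z m j)\<^sup>2) * L2_set e {..<l}"
proof -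
  have "\<bar>\<Sum>j<l. z m j * e j\<bar> \<le> L2_set (z m) {..<l} * L2_set e {..<l}" for m
    using dot_le_L2[of l "z m" e] by (simp add: dot_def)
  then have "(\<Sum>j<l. z m j * e j)\<^sup>2 \<le> (L2_set (z m) {..<l} * L2_set e {..<l})\<^sup>2" for m
    by (intro power2_le_iff_abs_le[THEN iffD2] mult_nonneg_nonneg L2_set_nonneg) 
  then have "(\<Sum>m<d. (\<Sum>j<l. z m j * e j)\<^sup>2) \<le> (\<Sum>m<d. (\<Sum>j<l. (z m j)\<^sup>2) * (L2_set e {..<l})\<^sup>2)"
    by (intro sum_mono) (simp add: power_mult_distrib L2_set_sq)
  also have "\<dots> = (\<Sum>m<d. \<Sum>j<l. (z m j)\<^sup>2) * (L2_set e {..<l})\<^sup>2" by (simp add: sum_distrib_right)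
  finally have "L2_set (\<lambda>m. \<Sum>j<l. z m j * e j) {..<d} \<le> sqrt ((\<Sum>m<d. \<Sum>j<l. (z m j)\<^sup>2) * (L2_set e {..<l})\<^sup>2)"
    unfolding L2_set_def[of "\<lambda>m. \<Sum>j<l. z m j * e j"] by (rule real_sqrt_le_mono)
  then show ?thesis by (simp add: real_sqrt_mult L2_set_nonneg)
qed

text \<open>The three terms bound, per unit of |g|, the drift |g|_H, the fluctuation of S S^T g and
  the difference errors. With a^2 = 5 h / 4 and b^2 = Tr / (4 k) their sum is at most 9/10 a + 19/10
  b, and Cauchy-Schwarz applies. The target 11/5 = 4 * 11/20 fits the lower bound 11/20 n on the
  deviation \<open>D\<close>.\<close>

lemma zeta2_norm_bound:
  fixes h Tr k :: real
  assumes "0 \<le> h" "0 \<le> Tr" "0 < k"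
  shows "sqrt h + sqrt (Tr / (2 * k)) + sqrt (Tr / (18 * k)) \<le> 11 / 5 * sqrt (5 * h / 4 + Tr / (4 * k))"
proof -
  define a where "a = sqrt (5 * h / 4)"
  define b where "b = sqrt (Tr / (4 * k))"
  have a: "0 \<le> a" "a\<^sup>2 = 5 * h / 4" and b: "0 \<le> b" "b\<^sup>2 = Tr / (4 * k)"
    using assms by (auto simp: a_def b_def)
  have 1: "sqrt h \<le> 9 / 10 * a"
    using assms a by (intro real_le_lsqrt) (auto simp: power_mult_distrib power2_eq_square)
  have 2: "sqrt (Tr / (2 * k)) \<le> 71 / 50 * b"
  proof (intro real_le_lsqrt)
    have "Tr / (2 * k) = 2 * b\<^sup>2" using assms unfolding b(2) by simp
    also have "\<dots> \<le> (71 / 50 * b)\<^sup>2" by (simp add: power2_eq_square)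
    finally show "Tr / (2 * k) \<le> (71 / 50 * b)\<^sup>2" .
  qed (use assms b in auto)
  have 3: "sqrt (Tr / (18 * k)) \<le> 12 / 25 * b"
  proof (intro real_le_lsqrt)
    have "Tr / (18 * k) = 2 / 9 * b\<^sup>2" using assms unfolding b(2) by simp
    also have "\<dots> \<le> (12 / 25 * b)\<^sup>2" by (simp add: power2_eq_square)
    finally show "Tr / (18 * k) \<le> (12 / 25 * b)\<^sup>2" .
  qed (use assms b in auto)
  have "9 / 10 * a + 19 / 10 * b \<le> sqrt ((11 / 5)\<^sup>2 * (a\<^sup>2 + b\<^sup>2))"
  proof (rule real_le_rsqrt)
    have comb: "81 / 100 * p + 342 / 100 * r + 361 / 100 * q \<le> 121 / 25 * p + 121 / 25 * q"
      if "342 * r \<le> 361 * p + 81 * q" "0 \<le> p" "0 \<le> q" for p q r :: real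
      using that by linarith
    have "0 \<le> (19 * a - 9 * b)\<^sup>2" by simp
    then have "342 * (a * b) \<le> 361 * a\<^sup>2 + 81 * b\<^sup>2" by (simp add: power2_eq_square algebra_simps)
    note comb[OF this zero_le_power2 zero_le_power2]
    moreover have "(9 / 10 * a + 19 / 10 * b)\<^sup>2 = 81 / 100 * a\<^sup>2 + 342 / 100 * (a * b) + 361 / 100 * b\<^sup>2"
      unfolding power2_sum power_mult_distrib power_divide by simp
    moreover have "(11 / 5)\<^sup>2 * (a\<^sup>2 + b\<^sup>2) = 121 / 25 * a\<^sup>2 + 121 / 25 * b\<^sup>2"
      unfolding power_divide distrib_left by simp
    ultimately show "(9 / 10 * a + 19 / 10 * b)\<^sup>2 \<le> (11 / 5)\<^sup>2 * (a\<^sup>2 + b\<^sup>2)"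
      by (simp only:)
  qed
  also have "\<dots> = 11 / 5 * sqrt (5 * h / 4 + Tr / (4 * k))" by (simp add: real_sqrt_mult a(2) b(2))
  finally show ?thesis using 1 2 3 by linarith
qed

lemma column_in_Rn: "column d S j \<in> Rn d"
  by (simp add: column_def Rn_def)

lemma dot_column: "dot d q (column d S j) = (\<Sum>i<d. q i * S i j)"
  by (simp add: dot_def column_def)

lemma dot_scale: "dot d q (\<lambda>i. c * x i) = c * dot d q x"
  by (simp add: dot_def sum_distrib_left mult_ac)

lemma weighted_norm_scale: "weighted_norm d H (\<lambda>i. c * x i) = \<bar>c\<bar> * weighted_norm d H x"
proof -
  have "mat_vec d H (\<lambda>i. c * x i) = (\<lambda>i. c * mat_vec d H x i)"
    by (rule ext) (simp add: mat_vec_def sum_distrib_left mult_ac)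
  then have "dot d (\<lambda>i. c * x i) (mat_vec d H (\<lambda>i. c * x i)) = c\<^sup>2 * dot d x (mat_vec d H x)"
    by (simp add: dot_def sum_distrib_left power2_eq_square mult_ac)
  then show ?thesis by (simp add: weighted_norm_def real_sqrt_mult)
qed

text \<open>A good column satisfies |s|_H^2 \<le> h K / l with h K = sqrt \<zeta>1, which bounds the
  Taylor remainder. The factor 1 / l makes the vector of all l errors of order 1 / sqrt l.\<close>

lemma finite_difference_error:
  assumes psd: "pos_semidef d H" and smooth: "L0_L1_smooth d H L0 L1 f grad"
    and L: "0 \<le> L0" "0 \<le> L1" and x: "x \<in> Rn d" and j: "j < l" and T: "0 < T" and k: "0 < k"
    and lk: "16 * k \<le> real l"
    and par: "zo_parameters d H L0 L1 k l T \<epsilon> \<alpha> \<eta>"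
    and col: "real l * (\<Sum>i<d. (S i j)\<^sup>2) \<le> 5 * real d / 4 + real l"
  shows "\<bar>(f (probe d \<alpha> S x j) - f x) / \<alpha> - dot d (grad x) (column d S j)\<bar>
    \<le> (L0 + L1 * L2_set (grad x) {..<d}) / 2 * (\<alpha> * sqrt (zeta1 d H k l) / l)"
proof -
  define h where "h = spectral_norm d H"
  define s where "s = column d S j"
  define K where "K = 5 * real l / 4 + real d * real l / (4 * k)"
  have h: "0 \<le> h" by (simp add: h_def spectral_norm_nonneg)
  have l: "1 \<le> real l" using j by simp
  have \<alpha>: "0 < \<alpha>" using par by (simp add: zo_parameters_def)
  have z1: "zeta1 d H k l = (h * K)\<^sup>2" by (simp add: zeta1_def h_def K_def power_mult_distrib)
  \<comment> \<open>This uses l \<ge> 16 k: the length threshold 5 d / 4 + l of a good column stays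
    below \<open>K\<close>, the bracket in \<open>zeta1\<close>.\<close>
  have "5 / 4 * real d \<le> real d * real l / (4 * k)"
  proof -
    have "5 / 4 * (4 * k) \<le> real l" using lk k by simp
    then have "real d * (5 / 4 * (4 * k)) \<le> real d * real l" by (intro mult_left_mono) auto
    then show ?thesis using k by (simp add: field_simps)
  qed
  then have K: "5 * real d / 4 + real l \<le> K" using l by (simp add: K_def)
  then have K1: "1 \<le> K" using l by linarith
  have norm_s: "(L2_set s {..<d})\<^sup>2 = (\<Sum>i<d. (S i j)\<^sup>2)"
    unfolding L2_set_sq s_def column_def by (intro sum.cong) auto
  have "real l * (\<Sum>i<d. (S i j)\<^sup>2) \<le> K" using col K by linarith
  then have "(L2_set s {..<d})\<^sup>2 \<le> K / l" unfolding norm_s using l by (simp add: field_simps)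
  then have "h * (L2_set s {..<d})\<^sup>2 \<le> h * (K / l)" using h by (intro mult_left_mono)
  then have ws: "(weighted_norm d H s)\<^sup>2 \<le> h * K / l"
    using weighted_norm_le[OF psd, of s] by (simp add: s_def column_in_Rn h_def)
  have ws0: "0 \<le> weighted_norm d H s"
    using psd column_in_Rn[of d S j] by (simp add: weighted_norm_def s_def pos_semidef_def)
  define p where "p = probe d \<alpha> S x j"
  have diff: "p - x = (\<lambda>i. \<alpha> * s i)" by (rule ext) (simp add: p_def probe_def s_def)
  have p: "p \<in> Rn d" using x column_in_Rn[of d S j] by (simp add: p_def probe_def Rn_def)
  have wp: "weighted_norm d H (p - x) = \<alpha> * weighted_norm d H s"
    unfolding diff weighted_norm_scale using \<alpha> by simp
  \<comment> \<open>The probe stays in the region of validity of the smoothness bound: h |s|_H^2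
    \<le> h^2 K / l \<le> \<zeta>1, and the choice of \<alpha> makes \<alpha>^2 L1^2 \<zeta>1 at
    most 1 / (2 T).\<close>
  have "(L1 * sqrt h * (\<alpha> * weighted_norm d H s))\<^sup>2 = \<alpha>\<^sup>2 * L1\<^sup>2 * (h * (weighted_norm d H s)\<^sup>2)"
    using h by (simp add: power_mult_distrib)
  also have "\<dots> \<le> \<alpha>\<^sup>2 * L1\<^sup>2 * zeta1 d H k l"
  proof (rule mult_left_mono)
    have "h * (weighted_norm d H s)\<^sup>2 \<le> h * (h * K / l)" using ws h by (rule mult_left_mono)
    also have "\<dots> = h\<^sup>2 * (K / l)" by (simp add: power2_eq_square)
    also have "\<dots> \<le> h\<^sup>2 * K\<^sup>2"
    proof (rule mult_left_mono)
      have "K / l \<le> K" using K1 l by (simp add: field_simps)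
      also have "\<dots> \<le> K\<^sup>2" using K1 by (simp add: power2_eq_square)
      finally show "K / l \<le> K\<^sup>2" .
    qed simp
    finally show "h * (weighted_norm d H s)\<^sup>2 \<le> zeta1 d H k l" by (simp add: z1 power_mult_distrib)
  qed simp
  also have "\<dots> \<le> 1"
  proof -
    have c0: "0 \<le> \<alpha>\<^sup>2 * L1\<^sup>2 * zeta1 d H k l" by (simp add: z1)
    then have "\<alpha>\<^sup>2 * L1\<^sup>2 * zeta1 d H k l * 1 \<le> \<alpha>\<^sup>2 * L1\<^sup>2 * zeta1 d H k l * (2 * real T)"
      using T by (intro mult_left_mono) auto
    also have "\<dots> \<le> 1" using par by (simp add: zo_parameters_def mult_ac)
    finally show ?thesis by simp
  qed
  finally have trust: "L1 * sqrt h * weighted_norm d H (p - x) \<le> 1"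
    unfolding wp by (simp add: power_le_one_iff abs_square_le_1)
  have "\<bar>f p - f x - dot d (grad x) (p - x)\<bar>
      \<le> (L0 + L1 * L2_set (grad x) {..<d}) / 2 * (weighted_norm d H (p - x))\<^sup>2"
    using smooth x p trust unfolding L0_L1_smooth_def h_def by blast
  also have "\<dots> \<le> (L0 + L1 * L2_set (grad x) {..<d}) / 2 * (\<alpha>\<^sup>2 * (h * K / l))"
    unfolding wp power_mult_distrib using ws L
    by (intro mult_left_mono) (auto simp: L2_set_nonneg)
  also have "h * K = sqrt (zeta1 d H k l)" using h K1 by (simp add: z1)
  finally have main: "\<bar>f p - f x - dot d (grad x) (p - x)\<bar>
      \<le> (L0 + L1 * L2_set (grad x) {..<d}) / 2 * (\<alpha>\<^sup>2 * (sqrt (zeta1 d H k l) / l))" .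
  have "(f p - f x) / \<alpha> - dot d (grad x) s = (f p - f x - dot d (grad x) (p - x)) / \<alpha>"
    unfolding diff dot_scale using \<alpha> by (simp add: diff_divide_distrib)
  then have "\<bar>(f p - f x) / \<alpha> - dot d (grad x) s\<bar> = \<bar>f p - f x - dot d (grad x) (p - x)\<bar> / \<alpha>"
    using \<alpha> by (simp add: abs_divide)
  also have "\<dots> \<le> (L0 + L1 * L2_set (grad x) {..<d}) / 2 * (\<alpha>\<^sup>2 * (sqrt (zeta1 d H k l) / l)) / \<alpha>"
    using main \<alpha> by (intro divide_right_mono) auto
  also have "\<dots> = (L0 + L1 * L2_set (grad x) {..<d}) / 2 * (\<alpha> * sqrt (zeta1 d H k l) / l)"
    using \<alpha> by (simp add: power2_eq_square)
  finally show ?thesis unfolding p_def s_def .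
qed

text \<open>With z = \<alpha> sqrt \<zeta>1 the two bounds on \<alpha> say (L0 z)^2 \<le> 3/8
  \<epsilon>^2 and (L1 z)^2 \<le> 1/2. Because \<epsilon> \<le> n, both parts become relative to the
  gradient norm n.\<close>

lemma smoothness_error_constant:
  assumes par: "zo_parameters d H L0 L1 k l T \<epsilon> \<alpha> \<eta>" and L: "0 \<le> L0" "0 \<le> L1" and T: "0 < T"
    and n: "0 < \<epsilon>" "\<epsilon> \<le> n"
  shows "(L0 + L1 * n) / 2 * (\<alpha> * sqrt (zeta1 d H k l)) \<le> 2 / 3 * n"
proof -
  define z where "z = \<alpha> * sqrt (zeta1 d H k l)"
  have z1: "0 \<le> zeta1 d H k l" by (simp add: zeta1_def)
  have z2: "z\<^sup>2 = \<alpha>\<^sup>2 * zeta1 d H k l" using z1 by (simp add: z_def power_mult_distrib)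
  have a: "(L0 * z)\<^sup>2 \<le> 3 / 8 * n\<^sup>2"
  proof -
    have "8 * (L0 * z)\<^sup>2 \<le> 3 * \<epsilon>\<^sup>2" using par by (simp add: zo_parameters_def power_mult_distrib z2 mult_ac)
    moreover have "\<epsilon>\<^sup>2 \<le> n\<^sup>2" using n by (intro power_mono) auto
    ultimately show ?thesis by linarith
  qed
  have b: "(L1 * n * z)\<^sup>2 \<le> 1 / 2 * n\<^sup>2"
  proof -
    have "L1\<^sup>2 * z\<^sup>2 * 2 * 1 \<le> L1\<^sup>2 * z\<^sup>2 * 2 * real T" using T by (intro mult_left_mono) auto
    also have "\<dots> \<le> 1" using par by (simp add: zo_parameters_def z2 mult_ac)
    finally have "n\<^sup>2 * (L1\<^sup>2 * z\<^sup>2) \<le> n\<^sup>2 * (1 / 2)" by (intro mult_left_mono) auto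
    then show ?thesis by (simp add: power_mult_distrib mult_ac)
  qed
  \<comment> \<open>Young's inequality with weights 8/7 and 7/8; the result 15/7 * 3/8 + 15/8 * 1/2
    is below 16/9.\<close>
  have "(L0 * z + L1 * n * z)\<^sup>2 \<le> 15 / 7 * (L0 * z)\<^sup>2 + 15 / 8 * (L1 * n * z)\<^sup>2"
    using zero_le_power2[of "8 * (L0 * z) - 7 * (L1 * n * z)"] by (simp add: power2_eq_square algebra_simps)
  also have "\<dots> \<le> 16 / 9 * n\<^sup>2"
  proof -
    have "15 / 7 * p + 15 / 8 * q \<le> 16 / 9 * r" if "p \<le> 3 / 8 * r" "q \<le> 1 / 2 * r" "0 \<le> r" for p q r :: real
      using that by linarith
    from this[OF a b zero_le_power2] show ?thesis .
  qed
  also have "\<dots> = (4 / 3 * n)\<^sup>2" by (simp add: power_mult_distrib power_divide)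
  finally have "L0 * z + L1 * n * z \<le> 4 / 3 * n" by (rule power2_le_imp_le) (use n in simp)
  then show ?thesis by (simp add: z_def[symmetric] algebra_simps)
qed

text \<open>The standard deviation ignores the common shift f x and is homogeneous. Written through
  difference quotients, it cancels the factors \<alpha> and 1 / sqrt (l - 1) of the step
  size.\<close>

lemma std_estimate_eq:
  assumes "0 < \<alpha>" "1 < l"
  shows "std_estimate d l \<alpha> f S x =
    \<alpha> / sqrt (real l - 1) * L2_set (\<lambda>j. (f (probe d \<alpha> S x j) - f x) / \<alpha>
      - (\<Sum>i<l. (f (probe d \<alpha> S x i) - f x) / \<alpha>) / l) {..<l}"
proof -
  define v where "v j = (f (probe d \<alpha> S x j) - f x) / \<alpha>" for j
  have fv: "f (probe d \<alpha> S x j) = f x + \<alpha> * v j" for j using assms by (simp add: v_def)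
  have "f (probe d \<alpha> S x j) - 1 / real l * (\<Sum>i<l. f (probe d \<alpha> S x i)) = \<alpha> * (v j - (\<Sum>i<l. v i) / l)" for j
  proof -
    have "(\<Sum>i<l. f (probe d \<alpha> S x i)) = l * f x + \<alpha> * (\<Sum>i<l. v i)"
      by (simp add: fv sum.distrib sum_distrib_left)
    then show ?thesis using assms by (simp add: fv[of j] field_simps)
  qed
  then have "std_estimate d l \<alpha> f S x = sqrt (1 / (real l - 1) * (\<alpha>\<^sup>2 * (\<Sum>j<l. (v j - (\<Sum>i<l. v i) / l)\<^sup>2)))"
    by (simp add: std_estimate_def power_mult_distrib sum_distrib_left)
  also have "\<dots> = \<alpha> / sqrt (real l - 1) * L2_set (\<lambda>j. v j - (\<Sum>i<l. v i) / l) {..<l}"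
    using assms by (simp add: real_sqrt_mult real_sqrt_divide L2_set_def)
  finally show ?thesis unfolding v_def .
qed

lemma grad_estimate_in_Rn: "grad_estimate d l \<alpha> f S x \<in> Rn d"
  by (simp add: grad_estimate_def Rn_def column_def)

lemma dot_grad_estimate:
  "dot d q (grad_estimate d l \<alpha> f S x) = (\<Sum>j<l. dot d q (column d S j) * ((f (probe d \<alpha> S x j) - f x) / \<alpha>))"
  unfolding dot_def grad_estimate_def sum_distrib_left sum_distrib_right
  by (subst sum.swap) (simp add: mult_ac)

text \<open>The step is - (r / D) w with w = S S^T g + S e, and \<open>D\<close> cancels twice: <g,
  w> \<ge> n D / 2 gives a first-order decrease r n / 2, and |w|_H \<le> 4 sqrt \<zeta>2 D gives
  H-length at most 4 r sqrt \<zeta>2. The smoothness remainder costs 8 L0 / T + 3/8 r n, which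
  leaves r n / 8.\<close>

lemma zo_step_descent:
  assumes psd: "pos_semidef d H" and B: "\<And>i j. i < d \<Longrightarrow> j < d \<Longrightarrow> H i j = (\<Sum>k<d. B k i * B k j)"
    and Tr: "0 < mat_trace d H"
    and smooth: "L0_L1_smooth d H L0 L1 f grad" and L: "0 \<le> L0" "0 \<le> L1"
    and x: "x \<in> Rn d" and T: "0 < T" and k: "4 \<le> k" and lk: "16 * k \<le> real l"
    and par: "zo_parameters d H L0 L1 k l T \<epsilon> \<alpha> \<eta>" and \<epsilon>: "0 < \<epsilon>" "\<epsilon> \<le> L2_set (grad x) {..<d}"
    and good: "good_sketch d l B k (grad x) S"
  defines "r \<equiv> 1 / sqrt (zeta2 d H k * real T)"
  shows "f (\<lambda>i. x i - \<eta> * grad_estimate d l \<alpha> f S x i / std_estimate d l \<alpha> f S x)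
    \<le> f x - r * L2_set (grad x) {..<d} / 8 + 8 * L0 / T"
proof -
  define g where "g = grad x"
  define n where "n = L2_set g {..<d}"
  define z where "z = zeta2 d H k"
  define h where "h = spectral_norm d H"
  define y where "y j = dot d g (column d S j)" for j
  define v where "v j = (f (probe d \<alpha> S x j) - f x) / \<alpha>" for j
  define e where "e j = v j - y j" for j
  define D where "D = L2_set (\<lambda>j. v j - (\<Sum>i<l. v i) / l) {..<l}"
  define w where "w = grad_estimate d l \<alpha> f S x"
  define Z where "Z m j = dot d (B m) (column d S j)" for m j
  have n: "0 < n" "\<epsilon> \<le> n" using \<epsilon> by (simp_all add: n_def g_def)
  have l64: "64 \<le> real l" using k lk by linarith
  then have l0: "0 < l" "1 < l" by simp_all
  have \<alpha>: "0 < \<alpha>" using par by (simp add: zo_parameters_def)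
  have h0: "0 \<le> h" by (simp add: h_def spectral_norm_nonneg)
  have z_eq: "z = 5 * h / 4 + mat_trace d H / (4 * k)" by (simp add: z_def zeta2_def h_def)
  have z0: "0 < z" using Tr k h0 unfolding z_eq by (intro add_nonneg_pos) auto
  have hz: "h \<le> z"
  proof -
    have "0 \<le> mat_trace d H / (4 * k)" using Tr k by simp
    then show ?thesis using h0 unfolding z_eq by linarith
  qed
  have r0: "0 < r" using z0 T by (simp add: r_def z_def[symmetric])
  have r2: "r\<^sup>2 * z = 1 / T" using z0 T by (simp add: r_def z_def[symmetric] power_divide)
  have n2: "n\<^sup>2 = (\<Sum>i<d. (g i)\<^sup>2)" by (simp add: n_def L2_set_sq)
  have trB: "(\<Sum>m<d. \<Sum>i<d. (B m i)\<^sup>2) = mat_trace d H" using mat_trace_factor[OF B] by simp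
  have wnB: "weighted_norm d H q = L2_set (\<lambda>m. dot d (B m) q) {..<d}" for q
    by (rule weighted_norm_factor[OF B])
  have good1: "n\<^sup>2 / 2 \<le> (\<Sum>j<l. (y j)\<^sup>2)"
    and good2: "(\<Sum>j<l. y j)\<^sup>2 \<le> real l / 16 * n\<^sup>2"
    and good3: "L2_set (\<lambda>m. \<Sum>j<l. Z m j * y j) {..<d} \<le> weighted_norm d H g + n * sqrt (mat_trace d H / (2 * k))"
    and good4: "\<And>j. j < l \<Longrightarrow> real l * (\<Sum>i<d. (S i j)\<^sup>2) \<le> 5 * real d / 4 + real l"
    and good5: "(\<Sum>j<l. \<Sum>m<d. (Z m j)\<^sup>2) \<le> 2 * mat_trace d H"
    using good unfolding good_sketch_def trB wnB g_def[symmetric] n2[symmetric] n_def[symmetric]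
      dot_column[symmetric] y_def Z_def by (auto simp: dot_def)

  have gH: "weighted_norm d H g \<le> n * sqrt h"
  proof -
    \<comment> \<open>\<open>L0_L1_smooth\<close> does not place \<open>grad x\<close> in
      \<open>Rn d\<close>, so components from d on are cut off before
      \<open>weighted_norm_le\<close> is applied.\<close>
    let ?g = "\<lambda>i. if i < d then g i else 0"
    have "?g \<in> Rn d" by (simp add: Rn_def)
    moreover have "L2_set ?g {..<d} = n" unfolding n_def by (rule L2_set_cong) auto
    moreover have "weighted_norm d H ?g = weighted_norm d H g"
      unfolding wnB dot_def by (intro L2_set_cong) auto
    ultimately have "(weighted_norm d H g)\<^sup>2 \<le> h * n\<^sup>2"
      using weighted_norm_le[OF psd, of ?g] by (simp add: h_def)
    also have "\<dots> = (n * sqrt h)\<^sup>2" using h0 by (simp add: power_mult_distrib)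
    finally show ?thesis by (rule power2_le_imp_le) (use n h0 in simp)
  qed

  have e_le: "L2_set e {..<l} \<le> 2 / 3 * n / sqrt l"
  proof -
    define c where "c = (L0 + L1 * n) / 2 * (\<alpha> * sqrt (zeta1 d H k l))"
    have c: "0 \<le> c" "c \<le> 2 / 3 * n"
      using smoothness_error_constant[OF par L T \<epsilon>(1) n(2)] L n \<alpha> by (auto simp: c_def zeta1_def)
    have "\<bar>e j\<bar> \<le> 2 / 3 * n / l" if "j < l" for j
    proof -
      have "\<bar>e j\<bar> \<le> c / l"
        using finite_difference_error[of d H L0 L1 f grad x j l T k \<epsilon> \<alpha> \<eta> S, OF psd smooth L x that T _ lk par good4[OF that]] k
        by (simp add: e_def v_def y_def c_def g_def n_def)
      also have "\<dots> \<le> 2 / 3 * n / l" using c l0 by (intro divide_right_mono) auto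
      finally show ?thesis .
    qed
    then have "(e j)\<^sup>2 \<le> (2 / 3 * n / l)\<^sup>2" if "j < l" for j
      using that n by (intro power2_le_iff_abs_le[THEN iffD2]) auto
    then have "(\<Sum>j<l. (e j)\<^sup>2) \<le> (\<Sum>j<l. (2 / 3 * n / l)\<^sup>2)" by (intro sum_mono) auto
    also have "\<dots> = (2 / 3 * n / sqrt l)\<^sup>2"
      using l0 by (simp add: power_divide power2_eq_square)
    finally have "L2_set e {..<l} \<le> sqrt ((2 / 3 * n / sqrt l)\<^sup>2)"
      unfolding L2_set_def by (rule real_sqrt_le_mono)
    then show ?thesis using n by simp
  qed
  have s8: "8 \<le> sqrt l" using l64 by (intro real_le_rsqrt) simp
  have e12: "L2_set e {..<l} \<le> n / 12"
  proof -
    have "2 / 3 * n / sqrt l \<le> 2 / 3 * n / 8" using s8 n l0 by (intro divide_left_mono) auto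
    with e_le show ?thesis by simp
  qed
  have ve: "y j + e j = v j" for j by (simp add: e_def)
  have v_eq: "v = (\<lambda>j. y j + e j)" by (rule ext) (simp add: e_def)
  have Dlow: "11 / 20 * n \<le> D" and yvD: "n / 2 * D \<le> (\<Sum>j<l. y j * v j)"
    using normalised_differences[OF l0(1) n(1) good1 good2 e12] unfolding ve D_def by auto
  have D0: "0 < D" using Dlow n by linarith

  have wH: "weighted_norm d H w \<le> 4 * sqrt z * D"
  proof -
    have Zv: "dot d (B m) w = (\<Sum>j<l. Z m j * y j) + (\<Sum>j<l. Z m j * e j)" for m
      unfolding w_def dot_grad_estimate Z_def[symmetric] v_def[symmetric] v_eq
      by (simp add: distrib_left sum.distrib)
    have "weighted_norm d H w \<le> L2_set (\<lambda>m. \<Sum>j<l. Z m j * y j) {..<d} + L2_set (\<lambda>m. \<Sum>j<l. Z m j * e j) {..<d}"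
      unfolding wnB Zv by (rule L2_set_triangle_ineq)
    moreover have "L2_set (\<lambda>m. \<Sum>j<l. Z m j * e j) {..<d} \<le> n * sqrt (mat_trace d H / (18 * k))"
    proof -
      have "L2_set (\<lambda>m. \<Sum>j<l. Z m j * e j) {..<d} \<le> sqrt (\<Sum>m<d. \<Sum>j<l. (Z m j)\<^sup>2) * L2_set e {..<l}"
        by (rule L2_set_sum_mult_le)
      also have "\<dots> \<le> sqrt (2 * mat_trace d H) * (2 / 3 * n / sqrt l)"
        using good5 e_le Tr by (intro mult_mono real_sqrt_le_mono) (auto simp: L2_set_nonneg sum.swap[of _ "{..<l}"])
      also have "\<dots> = n * sqrt (2 * mat_trace d H * (2 / 3)\<^sup>2 / l)"
        by (simp add: real_sqrt_mult real_sqrt_divide)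
      also have "\<dots> \<le> n * sqrt (mat_trace d H / (18 * k))"
      proof (intro mult_left_mono real_sqrt_le_mono)
        \<comment> \<open>The origin of 18 in \<open>zeta2_norm_bound\<close>: 2 * 4/9 / 16 =
          1/18.\<close>
        have "2 * mat_trace d H * (2 / 3)\<^sup>2 / l \<le> 2 * mat_trace d H * (2 / 3)\<^sup>2 / (16 * k)"
          using lk k Tr by (intro divide_left_mono) auto
        also have "\<dots> = mat_trace d H / (18 * k)" by (simp add: power2_eq_square)
        finally show "2 * mat_trace d H * (2 / 3)\<^sup>2 / l \<le> mat_trace d H / (18 * k)" .
      qed (use n in simp)
      finally show ?thesis .
    qed
    ultimately have "weighted_norm d H w \<le> n * sqrt h + n * sqrt (mat_trace d H / (2 * k)) + n * sqrt (mat_trace d H / (18 * k))"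
      using good3 gH by linarith
    also have "\<dots> = n * (sqrt h + sqrt (mat_trace d H / (2 * k)) + sqrt (mat_trace d H / (18 * k)))"
      by (simp add: distrib_left)
    also have "\<dots> \<le> n * (11 / 5 * sqrt z)"
      unfolding z_eq using n h0 Tr k by (intro mult_left_mono zeta2_norm_bound) auto
    also have "\<dots> = 4 * sqrt z * (11 / 20 * n)" by simp
    also have "\<dots> \<le> 4 * sqrt z * D" using Dlow z0 by (intro mult_left_mono) auto
    finally show ?thesis .
  qed

  have lsqrt: "0 < sqrt (real l - 1)" using l64 by simp
  have \<eta>: "\<eta> * sqrt (real l - 1) = \<alpha> * r"
    using par lsqrt by (simp add: zo_parameters_def r_def real_sqrt_mult)
  have std: "std_estimate d l \<alpha> f S x = \<alpha> / sqrt (real l - 1) * D"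
    unfolding D_def v_def by (rule std_estimate_eq[OF \<alpha> l0(2)])
  have ratio: "\<eta> / std_estimate d l \<alpha> f S x = r / D"
  proof -
    have "\<eta> / std_estimate d l \<alpha> f S x = \<eta> * sqrt (real l - 1) / (\<alpha> * D)"
      unfolding std using lsqrt by simp
    also have "\<dots> = r / D" unfolding \<eta> using \<alpha> by simp
    finally show ?thesis .
  qed
  define x' where "x' = (\<lambda>i. x i - \<eta> * grad_estimate d l \<alpha> f S x i / std_estimate d l \<alpha> f S x)"
  have diff: "x' - x = (\<lambda>i. (- (r / D)) * w i)"
    by (rule ext) (simp add: x'_def w_def ratio[symmetric])
  have x': "x' \<in> Rn d" using x grad_estimate_in_Rn[of d l \<alpha> f S x] by (simp add: x'_def Rn_def)
  have step: "weighted_norm d H (x' - x) \<le> 4 * r * sqrt z"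
  proof -
    have "weighted_norm d H (x' - x) = r / D * weighted_norm d H w"
      unfolding diff weighted_norm_scale using r0 D0 by simp
    also have "\<dots> \<le> r / D * (4 * sqrt z * D)" using wH r0 D0 by (intro mult_left_mono) auto
    finally show ?thesis using D0 by (simp add: mult_ac)
  qed
  have step0: "0 \<le> weighted_norm d H (x' - x)" unfolding wnB by (rule L2_set_nonneg)
  \<comment> \<open>The step-size restriction amounts to L1 r \<zeta>2 \<le> 3/64. It keeps the step
    where smoothness applies and bounds the L1 part of the remainder by 3/8 r n.\<close>
  have rL: "64 * (L1 * r * z) \<le> 3"
  proof -
    have "\<alpha> * (64 * (L1 * r * z)) = (\<eta> * sqrt (real l - 1)) * (64 * L1 * z)" unfolding \<eta> by simp
    also have "\<dots> = \<eta> * (64 * L1 * z * sqrt (real l - 1))" by simp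
    also have "\<dots> \<le> 3 * \<alpha>" using par unfolding zo_parameters_def z_def by blast
    finally show ?thesis using \<alpha> by simp
  qed
  have trust: "L1 * sqrt h * weighted_norm d H (x' - x) \<le> 1"
  proof -
    have "L1 * sqrt h * weighted_norm d H (x' - x) \<le> L1 * sqrt z * (4 * r * sqrt z)"
      using step step0 hz h0 z0 L r0 by (intro mult_mono) auto
    also have "\<dots> = 4 * (L1 * r * z)" using z0 by simp
    finally show ?thesis using rL by linarith
  qed
  have "\<bar>f x' - f x - dot d g (x' - x)\<bar> \<le> (L0 + L1 * n) / 2 * (weighted_norm d H (x' - x))\<^sup>2"
    using smooth x x' trust unfolding L0_L1_smooth_def h_def g_def n_def by blast
  also have "\<dots> \<le> (L0 + L1 * n) / 2 * (4 * r * sqrt z)\<^sup>2"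
    using step step0 L n by (intro mult_left_mono power_mono) auto
  also have "\<dots> = 8 * L0 * (r\<^sup>2 * z) + 8 * r * n * (L1 * r * z)"
    using z0 by (simp add: power_mult_distrib power2_eq_square[of r] algebra_simps)
  also have "\<dots> \<le> 8 * L0 / T + 3 / 8 * (r * n)"
  proof -
    have "8 * r * n * (L1 * r * z) \<le> 8 * r * n * (3 / 64)"
      using rL r0 n by (intro mult_left_mono) auto
    then show ?thesis unfolding r2 by (simp add: mult_ac)
  qed
  finally have upper: "f x' \<le> f x + dot d g (x' - x) + 8 * L0 / T + 3 / 8 * (r * n)" by linarith
  have "dot d g (x' - x) = - (r / D * (\<Sum>j<l. y j * v j))"
    unfolding diff dot_scale w_def dot_grad_estimate y_def[symmetric] v_def[symmetric] by simp
  also have "\<dots> \<le> - (r / D * (n / 2 * D))"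
    using yvD r0 D0 by (intro le_imp_neg_le mult_left_mono) auto
  also have "\<dots> = - (r * n / 2)" using D0 by simp
  finally have "f x' \<le> f x - r * n / 8 + 8 * L0 / T" using upper by simp
  then show ?thesis unfolding x'_def n_def g_def .
qed

lemma zo_iterate_in_Rn:
  assumes "x0 \<in> Rn d"
  shows "zo_iterate d l \<alpha> \<eta> f S x0 t \<in> Rn d"
proof (induction t)
  case (Suc t)
  then show ?case
    using grad_estimate_in_Rn[of d l \<alpha> f "S t" "zo_iterate d l \<alpha> \<eta> f S x0 t"]
    by (simp add: Rn_def Let_def)
qed (use assms in simp)

text \<open>
  The threshold \<open>80 * (\<Delta> + 8 * L0)\<^sup>2 + 1\<close> comes from telescoping the one-step descent; the summand
  \<open>1\<close> only keeps the constant positive.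
\<close>

lemma zo_exists_small_gradient:
  fixes S :: "nat \<Rightarrow> nat \<Rightarrow> nat \<Rightarrow> real"
  assumes psd: "pos_semidef d H" and B: "\<And>i j. i < d \<Longrightarrow> j < d \<Longrightarrow> H i j = (\<Sum>k<d. B k i * B k j)"
    and Tr: "0 < mat_trace d H"
    and smooth: "L0_L1_smooth d H L0 L1 f grad" and L: "0 \<le> L0" "0 \<le> L1"
    and bdd: "bdd_below (f ` Rn d)"
    and x0: "x0 \<in> Rn d" and T: "0 < T" and k: "4 \<le> k" and lk: "16 * k \<le> real l"
    and par: "zo_parameters d H L0 L1 k l T \<epsilon> \<alpha> \<eta>" and \<epsilon>: "0 < \<epsilon>"
    and large: "(80 * (f x0 - (INF x\<in>Rn d. f x) + 8 * L0)\<^sup>2 + 1) * iteration_order d H k \<epsilon> \<le> real T"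
  defines "x \<equiv> zo_iterate d l \<alpha> \<eta> f S x0"
  assumes good: "\<And>t. t < T \<Longrightarrow> \<epsilon> < L2_set (grad (x t)) {..<d} \<Longrightarrow> good_sketch d l B k (grad (x t)) (S t)"
  shows "\<exists>t<T. L2_set (grad (x t)) {..<d} \<le> \<epsilon>"
proof (rule ccontr)
  assume "\<not> ?thesis"
  then have big: "\<epsilon> < L2_set (grad (x t)) {..<d}" if "t < T" for t using that by (simp add: not_le)
  have xt: "x t \<in> Rn d" for t unfolding x_def by (rule zo_iterate_in_Rn[OF x0])
  define z where "z = zeta2 d H k"
  define r where "r = 1 / sqrt (z * real T)"
  define \<Delta> where "\<Delta> = f x0 - (INF x\<in>Rn d. f x)"
  have h0: "0 \<le> spectral_norm d H" by (rule spectral_norm_nonneg)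
  have z0: "0 < z" using Tr k h0 unfolding z_def zeta2_def by (intro add_nonneg_pos) auto
  have r0: "0 < r" using z0 T by (simp add: r_def)
  have step: "f (x (Suc t)) \<le> f (x t) - r * \<epsilon> / 8 + 8 * L0 / T" if "t < T" for t
  proof -
    have "f (x (Suc t)) \<le> f (x t) - r * L2_set (grad (x t)) {..<d} / 8 + 8 * L0 / T"
      using zo_step_descent[OF psd B Tr smooth L xt T k lk par \<epsilon> less_imp_le[OF big[OF that]] good[OF that big[OF that]]]
      unfolding x_def by (simp add: Let_def z_def r_def)
    moreover have "r * \<epsilon> \<le> r * L2_set (grad (x t)) {..<d}"
      using big[OF that] r0 by (intro mult_left_mono) auto
    ultimately show ?thesis by linarith
  qed
  define c where "c = 8 * L0 / T - r * \<epsilon> / 8"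
  have "f (x t) \<le> f x0 + t * c" if "t \<le> T" for t
    using that
  proof (induction t)
    case (Suc t)
    have "f (x (Suc t)) \<le> f (x t) + c" using step[of t] Suc.prems by (simp add: c_def)
    moreover have "real (Suc t) * c = t * c + c" by (simp add: algebra_simps)
    ultimately show ?case using Suc by simp
  qed (simp add: x_def)
  from this[of T] have "f (x T) \<le> f x0 + 8 * L0 - T * r * \<epsilon> / 8"
    using T by (simp add: c_def algebra_simps)
  moreover have "(INF x\<in>Rn d. f x) \<le> f (x T)"
    unfolding x_def by (intro cINF_lower bdd zo_iterate_in_Rn x0)
  ultimately have le: "T * r * \<epsilon> \<le> 8 * (\<Delta> + 8 * L0)" by (simp add: \<Delta>_def)
  \<comment> \<open>T r grows like sqrt T, so squaring turns the telescoped inequality into an upper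
    bound on T. Together with z / \<epsilon>^2 \<le> 5/4 * \<open>iteration_order\<close> it
    produces 64 * 5/4 = 80.\<close>
  have rT: "(T * r)\<^sup>2 = T / z" using z0 T by (simp add: r_def power_mult_distrib power_divide power2_eq_square)
  have "(T * r * \<epsilon>)\<^sup>2 \<le> (8 * (\<Delta> + 8 * L0))\<^sup>2" using le r0 \<epsilon> by (intro power_mono) auto
  then have "T / z * \<epsilon>\<^sup>2 \<le> 64 * (\<Delta> + 8 * L0)\<^sup>2" unfolding power_mult_distrib[of _ \<epsilon>] rT power_mult_distrib[of 8] by simp
  then have "real T \<le> 64 * (\<Delta> + 8 * L0)\<^sup>2 * (z / \<epsilon>\<^sup>2)" using z0 \<epsilon> by (simp add: field_simps)
  also have "\<dots> \<le> 64 * (\<Delta> + 8 * L0)\<^sup>2 * (5 / 4 * iteration_order d H k \<epsilon>)"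
  proof (rule mult_left_mono)
    have "z \<le> 5 / 4 * (spectral_norm d H + mat_trace d H / k)"
      using Tr k by (simp add: z_def zeta2_def field_simps)
    then have "z / \<epsilon>\<^sup>2 \<le> 5 / 4 * (spectral_norm d H + mat_trace d H / k) / \<epsilon>\<^sup>2" by (rule divide_right_mono) simp
    then show "z / \<epsilon>\<^sup>2 \<le> 5 / 4 * iteration_order d H k \<epsilon>"
      by (simp add: iteration_order_def add_divide_distrib)
  qed simp
  also have "\<dots> < (80 * (\<Delta> + 8 * L0)\<^sup>2 + 1) * iteration_order d H k \<epsilon>"
  proof -
    have "0 < iteration_order d H k \<epsilon>"
      unfolding iteration_order_def using h0 Tr k \<epsilon> by (intro add_nonneg_pos) auto
    then show ?thesis by (simp add: algebra_simps)
  qed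
  finally show False using large by (simp add: \<Delta>_def)
qed

section \<open>Measurability of the iterates\<close>

lemma has_gradient_tendsto:
  assumes "has_gradient d f g x" "x \<in> Rn d"
  shows "(f \<longlongrightarrow> f x) (at x within Rn d)"
proof -
  let ?F = "at x within Rn d"
  let ?q = "\<lambda>y. (f y - f x - dot d g (y - x)) / L2_set (y - x) {..<d}"
  have q: "(?q \<longlongrightarrow> 0) ?F" using assms by (simp add: has_gradient_def)
  have coord: "((\<lambda>y. y i) \<longlongrightarrow> x i) ?F" for i
    using continuous_on_product_coordinates[of i]
    by (auto simp: continuous_on_def intro: tendsto_within_subset)
  have "((\<lambda>y. L2_set (y - x) {..<d}) \<longlongrightarrow> L2_set (x - x) {..<d}) ?F"
    unfolding L2_set_def minus_apply by (intro tendsto_intros coord)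
  then have norm: "((\<lambda>y. L2_set (y - x) {..<d}) \<longlongrightarrow> 0) ?F" by (simp add: L2_set_def)
  have "((\<lambda>y. dot d g (y - x)) \<longlongrightarrow> dot d g (x - x)) ?F"
    unfolding dot_def minus_apply by (intro tendsto_intros coord)
  then have lin: "((\<lambda>y. dot d g (y - x)) \<longlongrightarrow> 0) ?F" by (simp add: dot_def)
  have "((\<lambda>y. ?q y * L2_set (y - x) {..<d} + dot d g (y - x) + f x) \<longlongrightarrow> 0 * 0 + 0 + f x) ?F"
    by (intro tendsto_intros q norm lin)
  moreover have "\<forall>\<^sub>F y in ?F. ?q y * L2_set (y - x) {..<d} + dot d g (y - x) + f x = f y"
    unfolding eventually_at_filter
  proof (intro always_eventually allI impI)
    fix y assume y: "y \<noteq> x" "y \<in> Rn d"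
    have "L2_set (y - x) {..<d} \<noteq> 0"
    proof
      assume "L2_set (y - x) {..<d} = 0"
      then have "\<forall>i<d. y i = x i" by (simp add: L2_set_eq_0_iff)
      moreover have "\<forall>i\<ge>d. y i = x i" using y(2) assms(2) by (simp add: Rn_def)
      ultimately have "y = x" by (intro ext) (metis leI)
      with y(1) show False by simp
    qed
    then show "?q y * L2_set (y - x) {..<d} + dot d g (y - x) + f x = f y" by simp
  qed
  ultimately show ?thesis by (auto intro: Lim_transform_eventually)
qed

text \<open>Each gradient component is the limit of forward differences along a coordinate axis.
  This makes \<open>grad\<close> measurable although it need not be continuous.\<close>

lemma has_gradient_partial:
  assumes "has_gradient d f g x" "x \<in> Rn d" "i < d"
  shows "(\<lambda>n. (f (\<lambda>m. x m + (if m = i then 1 / real (Suc n) else 0)) - f x) / (1 / real (Suc n))) \<longlonglongrightarrow> g i"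
proof -
  define h where "h n = 1 / real (Suc n)" for n
  define p where "p c = (\<lambda>m. x m + (if m = i then c else 0 :: real))" for c
  have h: "0 < h n" for n by (simp add: h_def)
  have h_lim: "h \<longlonglongrightarrow> 0"
    unfolding h_def by (rule LIMSEQ_inverse_real_of_nat[unfolded inverse_eq_divide])
  have "continuous_on UNIV p"
    unfolding p_def
  proof (rule continuous_on_coordinatewise_then_product)
    show "continuous_on UNIV (\<lambda>c. x m + (if m = i then c else 0))" for m
      by (cases "m = i") (auto intro!: continuous_intros)
  qed
  then have "(\<lambda>n. p (h n)) \<longlonglongrightarrow> p 0"
    by (rule continuous_on_tendsto_compose) (use h_lim in auto)
  then have lim: "filterlim (\<lambda>n. p (h n)) (at x within Rn d) sequentially"
    unfolding filterlim_at
  proof (intro conjI)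
    show "\<forall>\<^sub>F n in sequentially. p (h n) \<in> Rn d \<and> p (h n) \<noteq> x"
    proof (intro always_eventually allI conjI)
      fix n
      show "p (h n) \<in> Rn d" using assms(2,3) by (simp add: p_def Rn_def)
      have "p (h n) i \<noteq> x i" using h[of n] by (simp add: p_def)
      then show "p (h n) \<noteq> x" by auto
    qed
  qed (simp add: p_def)
  have "(\<lambda>n. (f (p (h n)) - f x - dot d g (p (h n) - x)) / L2_set (p (h n) - x) {..<d}) \<longlonglongrightarrow> 0"
    using filterlim_compose[OF assms(1)[unfolded has_gradient_def, THEN conjunct2] lim] .
  moreover have diff: "p (h n) - x = (\<lambda>m. if m = i then h n else 0)" for n
    by (rule ext) (simp add: p_def)
  moreover have "dot d g (\<lambda>m. if m = i then h n else 0) = g i * h n" for n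
    using assms(3) by (simp add: dot_def if_distrib[where f = "\<lambda>x. _ * x"] cong: if_cong)
  moreover have "L2_set (\<lambda>m. if m = i then h n else 0) {..<d} = h n" for n
    using assms(3) h[of n] by (simp add: L2_set_def if_distrib[where f = "\<lambda>x. x\<^sup>2"] cong: if_cong)
  ultimately have "(\<lambda>n. (f (p (h n)) - f x - g i * h n) / h n + g i) \<longlonglongrightarrow> 0 + g i"
    by (intro tendsto_add tendsto_const) simp
  moreover have "(f (p (h n)) - f x - g i * h n) / h n + g i = (f (p (h n)) - f x) / h n" for n
    using h[of n] by (simp add: diff_divide_distrib)
  ultimately have "(\<lambda>n. (f (p (h n)) - f x) / h n) \<longlonglongrightarrow> g i" by simp
  then show ?thesis unfolding p_def h_def .
qed

lemma differentiable_measurable_compose: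
  assumes diff: "\<forall>x\<in>Rn d. has_gradient d f (grad x) x"
    and X: "\<And>i. (\<lambda>\<omega>. X \<omega> i) \<in> borel_measurable N" "\<And>\<omega>. \<omega> \<in> space N \<Longrightarrow> X \<omega> \<in> Rn d"
  shows "(\<lambda>\<omega>. f (X \<omega>)) \<in> borel_measurable N"
proof -
  have "continuous_on (Rn d) f"
    unfolding continuous_on_def using diff has_gradient_tendsto by blast
  then have "f \<in> borel_measurable (restrict_space borel (Rn d))"
    by (rule borel_measurable_continuous_on_restrict)
  moreover have "X \<in> measurable N (restrict_space borel (Rn d))"
    using X by (intro measurable_restrict_space2 measurable_coordinatewise_then_product) auto
  ultimately show ?thesis by (rule measurable_compose[rotated])
qed

lemma gradient_measurable_compose:
  assumes diff: "\<forall>x\<in>Rn d. has_gradient d f (grad x) x"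
    and X: "\<And>i. (\<lambda>\<omega>. X \<omega> i) \<in> borel_measurable N" "\<And>\<omega>. \<omega> \<in> space N \<Longrightarrow> X \<omega> \<in> Rn d"
    and i: "i < d"
  shows "(\<lambda>\<omega>. grad (X \<omega>) i) \<in> borel_measurable N"
proof (rule borel_measurable_LIMSEQ_real)
  fix \<omega> assume "\<omega> \<in> space N"
  then show "(\<lambda>n. (f (\<lambda>m. X \<omega> m + (if m = i then 1 / real (Suc n) else 0)) - f (X \<omega>)) / (1 / real (Suc n)))
      \<longlonglongrightarrow> grad (X \<omega>) i"
    using diff X(2) i by (intro has_gradient_partial) auto
next
  fix n
  have "(\<lambda>\<omega>. f (\<lambda>m. X \<omega> m + (if m = i then 1 / real (Suc n) else 0))) \<in> borel_measurable N"
    using X i by (intro differentiable_measurable_compose[OF diff]) (auto simp: Rn_def)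
  then show "(\<lambda>\<omega>. (f (\<lambda>m. X \<omega> m + (if m = i then 1 / real (Suc n) else 0)) - f (X \<omega>)) / (1 / real (Suc n)))
      \<in> borel_measurable N"
    using differentiable_measurable_compose[OF diff X] by simp
qed

lemma column_measurable:
  assumes "\<And>i. i < d \<Longrightarrow> (\<lambda>\<omega>. W \<omega> i j) \<in> borel_measurable N"
  shows "(\<lambda>\<omega>. column d (W \<omega>) j i) \<in> borel_measurable N"
  using assms by (cases "i < d") (auto simp: column_def)

text \<open>Stated for an arbitrary space \<open>N\<close> because it is applied both to the sample
  space and to a product space that holds the entries of past and current sketches.\<close>

lemma zo_iterate_measurable:
  fixes S :: "nat \<Rightarrow> 'a \<Rightarrow> nat \<Rightarrow> nat \<Rightarrow> real"
  assumes diff: "\<forall>x\<in>Rn d. has_gradient d f (grad x) x" and x0: "x0 \<in> Rn d"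
    and S: "\<And>s i j. s < t \<Longrightarrow> i < d \<Longrightarrow> j < l \<Longrightarrow> (\<lambda>\<omega>. S s \<omega> i j) \<in> borel_measurable N"
  shows "(\<lambda>\<omega>. zo_iterate d l \<alpha> \<eta> f (\<lambda>s. S s \<omega>) x0 t m) \<in> borel_measurable N"
  using S
proof (induction t arbitrary: m)
  case (Suc t)
  define X where "X \<omega> = zo_iterate d l \<alpha> \<eta> f (\<lambda>s. S s \<omega>) x0 t" for \<omega>
  have X[measurable]: "\<And>i. (\<lambda>\<omega>. X \<omega> i) \<in> borel_measurable N" unfolding X_def using Suc by auto
  have XR: "X \<omega> \<in> Rn d" for \<omega> unfolding X_def by (rule zo_iterate_in_Rn[OF x0])
  have fX[measurable]: "(\<lambda>\<omega>. f (X \<omega>)) \<in> borel_measurable N"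
    by (rule differentiable_measurable_compose[OF diff X XR])
  have col: "(\<lambda>\<omega>. column d (S t \<omega>) j i) \<in> borel_measurable N" if "j < l" for i j
    using Suc.prems that by (intro column_measurable) auto
  have fp[measurable]: "(\<lambda>\<omega>. f (probe d \<alpha> (S t \<omega>) (X \<omega>) j)) \<in> borel_measurable N" if "j \<in> {..<l}" for j
  proof (rule differentiable_measurable_compose[OF diff])
    show "(\<lambda>\<omega>. probe d \<alpha> (S t \<omega>) (X \<omega>) j i) \<in> borel_measurable N" for i
      unfolding probe_def using col that by (auto intro!: borel_measurable_add borel_measurable_times X)
    show "probe d \<alpha> (S t \<omega>) (X \<omega>) j \<in> Rn d" for \<omega>
      using XR[of \<omega>] by (simp add: probe_def Rn_def column_def)
  qed
  have [measurable]: "(\<lambda>\<omega>. grad_estimate d l \<alpha> f (S t \<omega>) (X \<omega>) m) \<in> borel_measurable N"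
    unfolding grad_estimate_def
    by (intro borel_measurable_sum borel_measurable_times borel_measurable_divide borel_measurable_diff
        fp fX col borel_measurable_const) auto
  have [measurable]: "(\<lambda>\<omega>. std_estimate d l \<alpha> f (S t \<omega>) (X \<omega>)) \<in> borel_measurable N"
    unfolding std_estimate_def by measurable
  show ?case unfolding zo_iterate.simps Let_def X_def[symmetric] by measurable
qed simp

lemma column_cong: "(\<And>i. i < d \<Longrightarrow> S i j = S' i j) \<Longrightarrow> column d S j = column d S' j"
  by (rule ext) (simp add: column_def)

text \<open>An iterate factors through the family of earlier entries, the form in which independence
  of past and present is available.\<close>

lemma zo_iterate_cong:
  assumes "\<And>s i j. s < t \<Longrightarrow> i < d \<Longrightarrow> j < l \<Longrightarrow> S s i j = S' s i j"
  shows "zo_iterate d l \<alpha> \<eta> f S x0 t = zo_iterate d l \<alpha> \<eta> f S' x0 t"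
  using assms
proof (induction t)
  case (Suc t)
  have col: "column d (S t) j = column d (S' t) j" if "j < l" for j
    using Suc.prems that by (intro column_cong) auto
  have "grad_estimate d l \<alpha> f (S t) x = grad_estimate d l \<alpha> f (S' t) x" for x
    unfolding grad_estimate_def probe_def by (intro ext sum.cong) (auto simp: col)
  moreover have "std_estimate d l \<alpha> f (S t) x = std_estimate d l \<alpha> f (S' t) x" for x
    by (simp add: std_estimate_def probe_def col cong: sum.cong_simp)
  ultimately show ?case using Suc by (simp add: Let_def)
qed simp

lemma good_sketch_cong:
  assumes "\<And>i j. i < d \<Longrightarrow> j < l \<Longrightarrow> S i j = S' i j"
  shows "good_sketch d l B k g S \<longleftrightarrow> good_sketch d l B k g S'"
  unfolding good_sketch_def by (simp add: assms cong: sum.cong_simp)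

lemma good_sketch_measurable:
  assumes g: "\<And>i. i < d \<Longrightarrow> (\<lambda>\<omega>. g \<omega> i) \<in> borel_measurable N"
    and W: "\<And>i j. i < d \<Longrightarrow> j < l \<Longrightarrow> (\<lambda>\<omega>. W \<omega> i j) \<in> borel_measurable N"
  shows "Measurable.pred N (\<lambda>\<omega>. good_sketch d l B k (g \<omega>) (W \<omega>))"
proof -
  have [measurable]: "(\<lambda>\<omega>. g \<omega> i) \<in> borel_measurable N" if "i \<in> {..<d}" for i using g that by auto
  have [measurable]: "(\<lambda>\<omega>. W \<omega> i j) \<in> borel_measurable N" if "i \<in> {..<d}" "j \<in> {..<l}" for i j using W that by auto
  have all: "(\<forall>j<l. P j) \<longleftrightarrow> (\<forall>j\<in>{..<l}. P j)" for P by auto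
  show ?thesis unfolding good_sketch_def L2_set_def all by measurable
qed

section \<open>The probability of a small gradient\<close>

text \<open>A bound that holds with \<open>X\<close> frozen at every value survives averaging over
  \<open>X\<close>, by Fubini applied to the indicator of the event.\<close>

lemma (in prob_space) prob_indep_slices_le:
  assumes ind: "indep_var N X L Y" and Q: "Measurable.pred (N \<Otimes>\<^sub>M L) (\<lambda>p. Q (fst p) (snd p))"
    and c: "0 \<le> c" and le: "\<And>\<omega>. \<omega> \<in> space M \<Longrightarrow> prob {\<omega>' \<in> space M. Q (X \<omega>) (Y \<omega>')} \<le> c"
  shows "prob {\<omega> \<in> space M. Q (X \<omega>) (Y \<omega>)} \<le> c"
proof -
  have X: "X \<in> measurable M N" and Y: "Y \<in> measurable M L"
    using ind by (auto dest: indep_var_rv1 indep_var_rv2)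
  define h where "h = (\<lambda>p. indicator {p \<in> space (N \<Otimes>\<^sub>M L). Q (fst p) (snd p)} p :: ennreal)"
  have h: "h \<in> borel_measurable (N \<Otimes>\<^sub>M L)" unfolding h_def using Q by (auto simp: pred_def)
  have hXY: "h (X \<omega>, Y \<omega>') = indicator {\<omega>' \<in> space M. Q (X \<omega>) (Y \<omega>')} \<omega>'"
    if "\<omega> \<in> space M" "\<omega>' \<in> space M" for \<omega> \<omega>'
    using measurable_space[OF X that(1)] measurable_space[OF Y that(2)] that
    by (auto simp: h_def space_pair_measure indicator_def)
  have diag: "{\<omega> \<in> space M. Q (X \<omega>) (Y \<omega>)} \<in> events"
    using measurable_compose[OF measurable_Pair[OF X Y] Q[unfolded pred_def[symmetric]]]
    by (simp add: pred_def)
  have slice: "{\<omega>' \<in> space M. Q (X \<omega>) (Y \<omega>')} \<in> events" if "\<omega> \<in> space M" for \<omega>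
    using measurable_compose[OF measurable_Pair[OF measurable_const[OF measurable_space[OF X that]] Y] Q]
    by (simp add: pred_def)
  have "emeasure M {\<omega> \<in> space M. Q (X \<omega>) (Y \<omega>)} = (\<integral>\<^sup>+\<omega>. indicator {\<omega> \<in> space M. Q (X \<omega>) (Y \<omega>)} \<omega> \<partial>M)"
    using diag by simp
  also have "\<dots> = (\<integral>\<^sup>+\<omega>. h (X \<omega>, Y \<omega>) \<partial>M)"
    by (intro nn_integral_cong) (auto simp: hXY indicator_def)
  also have "\<dots> = (\<integral>\<^sup>+\<omega>. \<integral>\<^sup>+\<omega>'. h (X \<omega>, Y \<omega>') \<partial>M \<partial>M)"
    by (rule nn_integral_indep_var[OF ind h])
  also have "\<dots> \<le> (\<integral>\<^sup>+\<omega>. ennreal c \<partial>M)"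
  proof (rule nn_integral_mono)
    fix \<omega> assume w: "\<omega> \<in> space M"
    have "(\<integral>\<^sup>+\<omega>'. h (X \<omega>, Y \<omega>') \<partial>M) = (\<integral>\<^sup>+\<omega>'. indicator {\<omega>' \<in> space M. Q (X \<omega>) (Y \<omega>')} \<omega>' \<partial>M)"
      using w by (intro nn_integral_cong hXY)
    also have "\<dots> = ennreal (prob {\<omega>' \<in> space M. Q (X \<omega>) (Y \<omega>')})"
      using slice[OF w] by (simp add: emeasure_eq_measure)
    also have "\<dots> \<le> ennreal c" by (intro ennreal_leI le w)
    finally show "(\<integral>\<^sup>+\<omega>'. h (X \<omega>, Y \<omega>') \<partial>M) \<le> ennreal c" .
  qed
  also have "\<dots> = ennreal c" by (simp add: emeasure_space_1)
  finally show ?thesis using c by (simp add: emeasure_eq_measure)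
qed

text \<open>Entries before iteration \<open>t\<close> and entries at \<open>t\<close> form disjoint
  blocks, and the first determines the gradient. Where its norm exceeds \<epsilon> it is nonzero and
  the bound for a fixed vector applies; elsewhere the event is empty.\<close>

lemma prob_bad_iteration:
  fixes S :: "nat \<Rightarrow> 'w \<Rightarrow> nat \<Rightarrow> nat \<Rightarrow> real" and \<alpha> \<eta> :: real
  assumes M: "prob_space M" and S: "gaussian_sketches M d l T S \<or> rademacher_sketches M d l T S"
    and diff: "\<forall>x\<in>Rn d. has_gradient d f (grad x) x" and x0: "x0 \<in> Rn d"
    and Tr: "0 < (\<Sum>m<d. \<Sum>i<d. (B m i)\<^sup>2)" and k: "4 \<le> k" and \<epsilon>: "0 < \<epsilon>"
    and \<delta>: "0 < \<delta>" "\<delta> < 1" and l: "0 < l" "16 * k * ln (4 * real T / \<delta>) \<le> real l" and t: "t < T"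
  defines "x \<equiv> \<lambda>\<omega>. zo_iterate d l \<alpha> \<eta> f (\<lambda>s. S s \<omega>) x0 t"
  shows "measure M {\<omega> \<in> space M. \<epsilon> < L2_set (grad (x \<omega>)) {..<d} \<and> \<not> good_sketch d l B k (grad (x \<omega>)) (S t \<omega>)}
    \<le> \<delta> / T"
proof -
  interpret prob_space M by (rule M)
  interpret sketch: subgaussian_matrix M d l "S t"
    using S gaussian_subgaussian_matrix[OF M _ t l(1)] rademacher_subgaussian_matrix[OF M _ t l(1)] by blast
  define V where "V = (\<lambda>(s, i, j) \<omega>. S s \<omega> i j)"
  have indV: "indep_vars (\<lambda>_. borel) V ({..<T} \<times> {..<d} \<times> {..<l})"
    using S unfolding gaussian_sketches_def rademacher_sketches_def indep_entries_def V_def by blast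
  let ?A = "{..<t} \<times> {..<d} \<times> {..<l}" and ?B = "{t} \<times> {..<d} \<times> {..<l}"
  let ?X = "\<lambda>\<omega>. restrict (\<lambda>p. V p \<omega>) ?A" and ?Y = "\<lambda>\<omega>. restrict (\<lambda>p. V p \<omega>) ?B"
  let ?N = "PiM ?A (\<lambda>_. borel :: real measure)" and ?L = "PiM ?B (\<lambda>_. borel :: real measure)"
  have ind: "indep_var ?N ?X ?L ?Y"
    using t by (intro indep_var_restrict[OF indV]) auto
  define it where "it a = zo_iterate d l \<alpha> \<eta> f (\<lambda>s i j. a (s, i, j)) x0 t" for a
  have itX: "it (?X \<omega>) = x \<omega>" for \<omega>
    unfolding it_def x_def by (rule zo_iterate_cong) (simp add: V_def)
  define Q where "Q a b \<longleftrightarrow> \<epsilon> < L2_set (grad (it a)) {..<d} \<and> \<not> good_sketch d l B k (grad (it a)) (\<lambda>i j. b (t, i, j))" for a b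
  have QXY: "Q (?X \<omega>) (?Y \<omega>') \<longleftrightarrow> \<epsilon> < L2_set (grad (x \<omega>)) {..<d} \<and> \<not> good_sketch d l B k (grad (x \<omega>)) (S t \<omega>')" for \<omega> \<omega>'
  proof -
    have "good_sketch d l B k g (\<lambda>i j. ?Y \<omega>' (t, i, j)) \<longleftrightarrow> good_sketch d l B k g (S t \<omega>')" for g
      by (rule good_sketch_cong) (simp add: V_def)
    then show ?thesis unfolding Q_def itX by simp
  qed
  have itm: "(\<lambda>p. it (fst p) m) \<in> borel_measurable (?N \<Otimes>\<^sub>M ?L)" for m
    unfolding it_def
    by (rule zo_iterate_measurable[where S = "\<lambda>s p i j. fst p (s, i, j)", OF diff x0])
      (auto intro!: measurable_compose[OF measurable_fst measurable_component_singleton])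
  have gm: "(\<lambda>p. grad (it (fst p)) i) \<in> borel_measurable (?N \<Otimes>\<^sub>M ?L)" if "i < d" for i
    by (rule gradient_measurable_compose[OF diff itm _ that]) (simp add: it_def zo_iterate_in_Rn[OF x0])
  have Q: "Measurable.pred (?N \<Otimes>\<^sub>M ?L) (\<lambda>p. Q (fst p) (snd p))"
  proof -
    have [measurable]: "Measurable.pred (?N \<Otimes>\<^sub>M ?L) (\<lambda>p. good_sketch d l B k (grad (it (fst p))) (\<lambda>i j. snd p (t, i, j)))"
      using gm by (intro good_sketch_measurable)
        (auto intro!: measurable_compose[OF measurable_snd measurable_component_singleton])
    have [measurable]: "(\<lambda>p. grad (it (fst p)) i) \<in> borel_measurable (?N \<Otimes>\<^sub>M ?L)" if "i \<in> {..<d}" for i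
      using gm that by simp
    show ?thesis unfolding Q_def L2_set_def by measurable
  qed
  have "prob {\<omega> \<in> space M. Q (?X \<omega>) (?Y \<omega>)} \<le> \<delta> / T"
  proof (rule prob_indep_slices_le[OF ind Q])
    show "0 \<le> \<delta> / T" using \<delta> by simp
    fix \<omega>
    show "prob {\<omega>' \<in> space M. Q (?X \<omega>) (?Y \<omega>')} \<le> \<delta> / T"
    proof (cases "\<epsilon> < L2_set (grad (x \<omega>)) {..<d}")
      case True
      then have "0 < (L2_set (grad (x \<omega>)) {..<d})\<^sup>2" using \<epsilon> by (intro zero_less_power) linarith
      then have "0 < (\<Sum>i<d. (grad (x \<omega>) i)\<^sup>2)" by (simp add: L2_set_sq)
      then show ?thesis
        using sketch.prob_not_good_sketch[OF _ Tr k _ \<delta> l(2), of "grad (x \<omega>)"] t True unfolding QXY by simp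
    qed (use \<delta> in \<open>simp add: QXY\<close>)
  qed
  then show ?thesis unfolding QXY .
qed

text \<open>The degenerate case H = 0: the H-norm vanishes, smoothness makes f affine, and an affine
  function bounded below has zero gradient. It is treated apart because \<zeta>2 is then 0 and the
  energy bounds divide by the trace.\<close>

lemma zero_trace_gradient:
  assumes psd: "pos_semidef d H" and Tr: "mat_trace d H = 0"
    and smooth: "L0_L1_smooth d H L0 L1 f grad" and bdd: "bdd_below (f ` Rn d)" and x: "x \<in> Rn d"
  shows "L2_set (grad x) {..<d} = 0"
proof -
  obtain B where B: "\<And>i j. i < d \<Longrightarrow> j < d \<Longrightarrow> H i j = (\<Sum>k<d. B k i * B k j)"
    using pos_semidef_factor[OF psd] by blast
  have "(\<Sum>k<d. \<Sum>i<d. (B k i)\<^sup>2) = 0" using mat_trace_factor[OF B] Tr by simp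
  then have "B k i = 0" if "k < d" "i < d" for k i
    using that by (simp add: sum_nonneg_eq_0_iff sum_nonneg)
  then have w0: "weighted_norm d H y = 0" for y
    using weighted_norm_factor[OF B, where x = y] by (simp add: L2_set_def dot_def)
  define g where "g i = (if i < d then grad x i else 0)" for i
  have affine: "f y = f x + dot d (grad x) (y - x)" if "y \<in> Rn d" for y
    using smooth x that unfolding L0_L1_smooth_def w0 by force
  obtain m where m: "\<And>y. y \<in> Rn d \<Longrightarrow> m \<le> f y" using bdd by (auto simp: bdd_below_def)
  define n where "n = (L2_set (grad x) {..<d})\<^sup>2"
  have n_eq: "n = (\<Sum>i<d. grad x i * grad x i)"
    unfolding n_def L2_set_sq by (simp add: power2_eq_square)
  have low: "m \<le> f x - c * n" for c
  proof -
    have y: "(\<lambda>i. x i - c * g i) \<in> Rn d" using x by (simp add: Rn_def g_def)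
    have "dot d (grad x) ((\<lambda>i. x i - c * g i) - x) = - (c * n)"
      by (simp add: dot_def g_def n_eq sum_distrib_left sum_negf mult_ac)
    then show ?thesis using m[OF y] affine[OF y] by simp
  qed
  have "n = 0"
  proof (rule ccontr)
    assume "n \<noteq> 0"
    \<comment> \<open>This choice gives m \<le> m - 1.\<close>
    then show False using low[of "(f x - m + 1) / n"] by simp
  qed
  then show ?thesis by (simp add: n_def)
qed

lemma le_sketch_size: "16 * k * ln (4 * real T / \<delta>) \<le> real (sketch_size k T \<delta>)"
  unfolding sketch_size_def by linarith

lemma one_le_ln_four:
  assumes "0 < \<delta>" "\<delta> < 1" "0 < T"
  shows "1 \<le> ln (4 * real T / \<delta>)"
proof -
  have "4 * \<delta> \<le> 4 * real T" using assms by simp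
  then have T4: "4 \<le> 4 * real T / \<delta>" using assms by (simp add: field_simps)
  then have "exp 1 \<le> 4 * real T / \<delta>" using exp_le by linarith
  then show ?thesis using T4 by (simp add: ln_ge_iff)
qed

lemma prob_small_gradient:
  fixes S :: "nat \<Rightarrow> 'w \<Rightarrow> nat \<Rightarrow> nat \<Rightarrow> real"
  assumes psd: "pos_semidef d H" and L: "0 \<le> L0" "0 \<le> L1"
    and diff: "\<forall>x\<in>Rn d. has_gradient d f (grad x) x" and smooth: "L0_L1_smooth d H L0 L1 f grad"
    and bdd: "bdd_below (f ` Rn d)" and x0: "x0 \<in> Rn d" and k: "4 \<le> k" and \<delta>: "0 < \<delta>" "\<delta> < 1"
    and \<epsilon>: "0 < \<epsilon>" and T: "0 < T" and l_def: "l = sketch_size k T \<delta>"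
    and M: "prob_space M" and S: "gaussian_sketches M d l T S \<or> rademacher_sketches M d l T S"
    and par: "zo_parameters d H L0 L1 k l T \<epsilon> \<alpha> \<eta>"
    and large: "(80 * (f x0 - (INF x\<in>Rn d. f x) + 8 * L0)\<^sup>2 + 1) * iteration_order d H k \<epsilon> \<le> real T"
  shows "1 - \<delta> \<le> measure M {\<omega> \<in> space M.
    (MIN t\<in>{..<T}. L2_set (grad (zo_iterate d l \<alpha> \<eta> f (\<lambda>s. S s \<omega>) x0 t)) {..<d}) \<le> \<epsilon>}"
proof -
  interpret prob_space M by (rule M)
  define x where "x t \<omega> = zo_iterate d l \<alpha> \<eta> f (\<lambda>s. S s \<omega>) x0 t" for t \<omega>
  have xR: "x t \<omega> \<in> Rn d" for t \<omega> unfolding x_def by (rule zo_iterate_in_Rn[OF x0])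
  define E where "E = {\<omega> \<in> space M. \<exists>t<T. L2_set (grad (x t \<omega>)) {..<d} \<le> \<epsilon>}"
  have min_iff: "(MIN t\<in>{..<T}. L2_set (grad (x t \<omega>)) {..<d}) \<le> \<epsilon> \<longleftrightarrow> (\<exists>t<T. L2_set (grad (x t \<omega>)) {..<d} \<le> \<epsilon>)" for \<omega>
    using T by (subst Min_le_iff) auto
  have "1 - \<delta> \<le> prob E"
  proof (cases "mat_trace d H = 0")
    case True
    then have "E = space M"
      using zero_trace_gradient[OF psd True smooth bdd xR] \<epsilon> T unfolding E_def by auto
    then show ?thesis using \<delta> by (simp add: prob_space)
  next
    case False
    then have Tr: "0 < mat_trace d H" using mat_trace_nonneg[OF psd] by simp
    obtain B where B: "\<And>i j. i < d \<Longrightarrow> j < d \<Longrightarrow> H i j = (\<Sum>k<d. B k i * B k j)"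
      using pos_semidef_factor[OF psd] by blast
    have TrB: "0 < (\<Sum>m<d. \<Sum>i<d. (B m i)\<^sup>2)" using Tr mat_trace_factor[OF B] by simp
    have ll: "16 * k * ln (4 * real T / \<delta>) \<le> real l" unfolding l_def by (rule le_sketch_size)
    have "16 * k * 1 \<le> 16 * k * ln (4 * real T / \<delta>)"
      using k one_le_ln_four[OF \<delta> T] by (intro mult_left_mono) auto
    then have lk: "16 * k \<le> real l" using ll by linarith
    then have "0 < real l" using k by linarith
    then have l0: "0 < l" by simp
    define bad where "bad t = {\<omega> \<in> space M. \<epsilon> < L2_set (grad (x t \<omega>)) {..<d}
      \<and> \<not> good_sketch d l B k (grad (x t \<omega>)) (S t \<omega>)}" for t
    have Sm: "(\<lambda>\<omega>. S s \<omega> i j) \<in> borel_measurable M" if "s < T" "i < d" "j < l" for s i j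
    proof -
      have "indep_vars (\<lambda>_. borel) (\<lambda>(s, i, j) \<omega>. S s \<omega> i j) ({..<T} \<times> {..<d} \<times> {..<l})"
        using S unfolding gaussian_sketches_def rademacher_sketches_def indep_entries_def by blast
      then have "\<forall>p\<in>{..<T} \<times> {..<d} \<times> {..<l}. (case p of (s, i, j) \<Rightarrow> \<lambda>\<omega>. S s \<omega> i j) \<in> borel_measurable M"
        unfolding indep_vars_def by blast
      from bspec[OF this, of "(s, i, j)"] that show ?thesis by simp
    qed
    have xm: "(\<lambda>\<omega>. x t \<omega> i) \<in> borel_measurable M" if "t \<le> T" for t i
      unfolding x_def using Sm that by (intro zo_iterate_measurable[OF diff x0]) auto
    have gm: "(\<lambda>\<omega>. grad (x t \<omega>) i) \<in> borel_measurable M" if "t \<le> T" "i < d" for t i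
      by (rule gradient_measurable_compose[OF diff xm[OF that(1)] xR that(2)])
    have [measurable]: "(\<lambda>\<omega>. L2_set (grad (x t \<omega>)) {..<d}) \<in> borel_measurable M" if "t \<in> {..<T}" for t
      using gm that unfolding L2_set_def by (auto intro!: borel_measurable_sqrt[THEN measurable_compose[rotated]] borel_measurable_sum borel_measurable_power)
    have [measurable]: "Measurable.pred M (\<lambda>\<omega>. good_sketch d l B k (grad (x t \<omega>)) (S t \<omega>))" if "t \<in> {..<T}" for t
      using gm Sm that by (intro good_sketch_measurable) auto
    have bad_ev: "bad t \<in> events" if "t \<in> {..<T}" for t
      using that unfolding bad_def by measurable
    have ex_eq: "(\<exists>t<T. P t) \<longleftrightarrow> (\<exists>t\<in>{..<T}. P t)" for P by auto
    \<comment> \<open>Required for monotonicity below: \<open>measure\<close> is 0 on sets that are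
      not measurable.\<close>
    have E_ev: "E \<in> events" unfolding E_def ex_eq by measurable
    have "prob (\<Union>t<T. bad t) \<le> (\<Sum>t<T. prob (bad t))"
      using bad_ev by (intro finite_measure_subadditive_finite) auto
    also have "\<dots> \<le> (\<Sum>t<T. \<delta> / T)"
      unfolding bad_def x_def
      by (intro sum_mono prob_bad_iteration[OF M S diff x0 TrB k \<epsilon> \<delta> l0 ll]) auto
    also have "\<dots> = \<delta>" using T by simp
    finally have "prob (\<Union>t<T. bad t) \<le> \<delta>" .
    moreover have "prob (space M - (\<Union>t<T. bad t)) = 1 - prob (\<Union>t<T. bad t)"
      using bad_ev by (intro prob_compl) auto
    moreover have "space M - (\<Union>t<T. bad t) \<subseteq> E"
    proof
      fix \<omega> assume w: "\<omega> \<in> space M - (\<Union>t<T. bad t)"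
      have "\<exists>t<T. L2_set (grad (zo_iterate d l \<alpha> \<eta> f (\<lambda>s. S s \<omega>) x0 t)) {..<d} \<le> \<epsilon>"
        using w by (intro zo_exists_small_gradient[OF psd B Tr smooth L bdd x0 T k lk par \<epsilon> large])
          (auto simp: bad_def x_def)
      with w show "\<omega> \<in> E" by (simp add: E_def x_def)
    qed
    then have "prob (space M - (\<Union>t<T. bad t)) \<le> prob E"
      using E_ev by (rule finite_measure_mono)
    ultimately show ?thesis by linarith
  qed
  moreover have "E = {\<omega> \<in> space M. (MIN t\<in>{..<T}. L2_set (grad (x t \<omega>)) {..<d}) \<le> \<epsilon>}"
    unfolding E_def min_iff ..
  ultimately show ?thesis by (simp add: x_def)
qed

section \<open>Query complexity\<close>

lemma length_zo_queries: "length (zo_queries d l \<alpha> \<eta> f S x0 T) = T * (l + 1)"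
  by (simp add: zo_queries_def length_concat comp_def Let_def sum_list_triv algebra_simps)

text \<open>Once 4 A c \<epsilon> \<le> 1, the bound on T gives 4 T \<le> 1 / \<epsilon>^3, so 4 T /
  \<delta> is at most (1 / (\<epsilon> \<delta>))^3 and its logarithm at most 3 ln (1 / (\<epsilon>
  \<delta>)). With l + 1 \<le> 18 k ln (4 T / \<delta>) this yields 54 = 18 * 3. Dependence on d, H
  and k is confined to the threshold for \<epsilon>.\<close>

lemma eventually_query_bound:
  fixes A :: real
  assumes A: "0 < A" and psd: "pos_semidef d H" and k: "4 \<le> k"
  shows "\<forall>\<^sub>F \<epsilon> in at_right 0. \<forall>\<delta> T l \<alpha> \<eta> f S x0.
         0 < \<delta> \<and> \<delta> < 1 \<and> 0 < T \<and> l = sketch_size k T \<delta> \<and>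
         real T \<le> A * iteration_order d H k \<epsilon>
         \<longrightarrow>
         real (length (zo_queries d l \<alpha> \<eta> f S x0 T)) \<le> 54 * A * query_order d H k \<epsilon> \<delta>"
proof -
  define c where "c = spectral_norm d H + mat_trace d H / k"
  have c0: "0 \<le> c"
    unfolding c_def using spectral_norm_nonneg mat_trace_nonneg[OF psd] k by simp
  \<comment> \<open>The summand 1 covers c = 0.\<close>
  define \<epsilon>0 where "\<epsilon>0 = 1 / (4 * A * c + 1)"
  have \<epsilon>0: "0 < \<epsilon>0" unfolding \<epsilon>0_def using A c0 by (intro divide_pos_pos add_nonneg_pos) auto
  show ?thesis
    unfolding eventually_at_right[OF \<epsilon>0]
  proof (intro exI[of _ \<epsilon>0] conjI \<epsilon>0 allI impI)
    fix \<epsilon> \<delta> :: real and T l :: nat and \<alpha> \<eta> :: real and f S x0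
    assume \<epsilon>': "0 < \<epsilon>" "\<epsilon> < \<epsilon>0"
      and as: "0 < \<delta> \<and> \<delta> < 1 \<and> 0 < T \<and> l = sketch_size k T \<delta> \<and> real T \<le> A * iteration_order d H k \<epsilon>"
    have \<delta>: "0 < \<delta>" "\<delta> < 1" and T: "0 < T" and l: "l = sketch_size k T \<delta>"
      and Tle: "real T \<le> A * iteration_order d H k \<epsilon>" using as by auto
    have io: "iteration_order d H k \<epsilon> = c / \<epsilon>\<^sup>2"
      by (simp add: iteration_order_def c_def add_divide_distrib)
    have qo: "query_order d H k \<epsilon> \<delta> = k * (c / \<epsilon>\<^sup>2) * ln (1 / (\<epsilon> * \<delta>))"
      using k by (simp add: query_order_def c_def add_divide_distrib distrib_left)
    have "\<epsilon> * (4 * A * c + 1) < 1"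
      using \<epsilon>'(2) A c0 unfolding \<epsilon>0_def by (subst (asm) pos_less_divide_eq) (auto intro: add_nonneg_pos)
    then have e4: "4 * A * c * \<epsilon> \<le> 1" using \<epsilon>' by (simp add: algebra_simps)
    define s where "s = ln (4 * real T / \<delta>)"
    have s1: "1 \<le> s" unfolding s_def by (rule one_le_ln_four[OF \<delta> T])
    have "4 * real T / \<delta> \<le> (1 / (\<epsilon> * \<delta>)) ^ 3"
    proof -
      have "4 * real T \<le> 4 * A * c / \<epsilon>\<^sup>2" using Tle by (simp add: io)
      also have "\<dots> = (4 * A * c * \<epsilon>) / \<epsilon> ^ 3" using \<epsilon>' by (simp add: power2_eq_square power3_eq_cube)
      also have "\<dots> \<le> 1 / \<epsilon> ^ 3" using e4 \<epsilon>' by (intro divide_right_mono) auto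
      finally have "4 * real T / \<delta> \<le> 1 / \<epsilon> ^ 3 / \<delta>" using \<delta> by (intro divide_right_mono) auto
      also have "\<dots> \<le> 1 / \<epsilon> ^ 3 / \<delta> ^ 3"
        using \<delta> \<epsilon>' power_decreasing[of 1 3 \<delta>] by (intro divide_left_mono) auto
      finally show ?thesis by (simp add: power_divide power_mult_distrib)
    qed
    then have "s \<le> ln ((1 / (\<epsilon> * \<delta>)) ^ 3)"
      unfolding s_def using T \<delta> \<epsilon>' by (subst ln_le_cancel_iff) auto
    also have "\<dots> = 3 * ln (1 / (\<epsilon> * \<delta>))" using \<delta> \<epsilon>' by (simp add: ln_realpow)
    finally have s3: "s \<le> 3 * ln (1 / (\<epsilon> * \<delta>))" .
    have "real l \<le> 16 * k * s + 1"
    proof -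
      have "0 \<le> 16 * k * s" using k s1 by simp
      then show ?thesis unfolding l sketch_size_def s_def[symmetric] by linarith
    qed
    moreover have "1 * 1 \<le> k * s" using k s1 by (intro mult_mono) auto
    ultimately have l18: "real l + 1 \<le> 18 * (k * s)" by simp
    have "real (length (zo_queries d l \<alpha> \<eta> f S x0 T)) = real T * (real l + 1)"
      by (simp add: length_zo_queries algebra_simps)
    also have "\<dots> \<le> (A * (c / \<epsilon>\<^sup>2)) * (18 * (k * (3 * ln (1 / (\<epsilon> * \<delta>)))))"
    proof (rule mult_mono)
      show "real T \<le> A * (c / \<epsilon>\<^sup>2)" using Tle by (simp add: io)
      have "k * s \<le> k * (3 * ln (1 / (\<epsilon> * \<delta>)))" using s3 k by (intro mult_left_mono) auto
      then show "real l + 1 \<le> 18 * (k * (3 * ln (1 / (\<epsilon> * \<delta>))))" using l18 by linarith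
    qed (use A c0 in auto)
    also have "\<dots> = 54 * A * query_order d H k \<epsilon> \<delta>" by (simp add: qo)
    finally show "real (length (zo_queries d l \<alpha> \<eta> f S x0 T)) \<le> 54 * A * query_order d H k \<epsilon> \<delta>" .
  qed
qed

theorem corollary2:
  shows
  "(\<exists>C :: real \<Rightarrow> real \<Rightarrow> real \<Rightarrow> real.
      (\<forall>L0 L1 \<Delta>. 0 < C L0 L1 \<Delta>) \<and>
      (\<forall>d H f grad L0 L1 x0 k \<delta> \<epsilon> T l \<alpha> \<eta> (M :: 'w measure) S.
         1 \<le> d \<and> pos_semidef d H \<and> 0 \<le> L0 \<and> 0 \<le> L1 \<and>
         (\<forall>x\<in>Rn d. has_gradient d f (grad x) x) \<and>
         L0_L1_smooth d H L0 L1 f grad \<and>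
         bdd_below (f ` Rn d) \<and> x0 \<in> Rn d \<and>
         4 \<le> k \<and> 0 < \<delta> \<and> \<delta> < 1 \<and> 0 < \<epsilon> \<and> 0 < T \<and>
         l = sketch_size k T \<delta> \<and>
         prob_space M \<and> (gaussian_sketches M d l T S \<or> rademacher_sketches M d l T S) \<and>
         zo_parameters d H L0 L1 k l T \<epsilon> \<alpha> \<eta> \<and>
         C L0 L1 (f x0 - (INF x\<in>Rn d. f x)) * iteration_order d H k \<epsilon> \<le> real T
         \<longrightarrow>
         measure M {\<omega> \<in> space M.
           (MIN t\<in>{..<T}. L2_set (grad (zo_iterate d l \<alpha> \<eta> f (\<lambda>s. S s \<omega>) x0 t)) {..<d}) \<le> \<epsilon>}
         \<ge> 1 - \<delta>))
   \<and>
   (\<forall>A>0. \<exists>B>0. \<forall>d H k.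
      1 \<le> d \<and> pos_semidef d H \<and> 4 \<le> k \<longrightarrow>
      (\<forall>\<^sub>F \<epsilon> in at_right 0. \<forall>\<delta> T l \<alpha> \<eta> f S x0.
         0 < \<delta> \<and> \<delta> < 1 \<and> 0 < T \<and> l = sketch_size k T \<delta> \<and>
         real T \<le> A * iteration_order d H k \<epsilon>
         \<longrightarrow>
         real (length (zo_queries d l \<alpha> \<eta> f S x0 T)) \<le> B * query_order d H k \<epsilon> \<delta>))"
proof (intro conjI allI impI)
  show "\<exists>C :: real \<Rightarrow> real \<Rightarrow> real \<Rightarrow> real.
      (\<forall>L0 L1 \<Delta>. 0 < C L0 L1 \<Delta>) \<and>
      (\<forall>d H f grad L0 L1 x0 k \<delta> \<epsilon> T l \<alpha> \<eta> (M :: 'w measure) S.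
         1 \<le> d \<and> pos_semidef d H \<and> 0 \<le> L0 \<and> 0 \<le> L1 \<and>
         (\<forall>x\<in>Rn d. has_gradient d f (grad x) x) \<and>
         L0_L1_smooth d H L0 L1 f grad \<and>
         bdd_below (f ` Rn d) \<and> x0 \<in> Rn d \<and>
         4 \<le> k \<and> 0 < \<delta> \<and> \<delta> < 1 \<and> 0 < \<epsilon> \<and> 0 < T \<and>
         l = sketch_size k T \<delta> \<and>
         prob_space M \<and> (gaussian_sketches M d l T S \<or> rademacher_sketches M d l T S) \<and>
         zo_parameters d H L0 L1 k l T \<epsilon> \<alpha> \<eta> \<and>
         C L0 L1 (f x0 - (INF x\<in>Rn d. f x)) * iteration_order d H k \<epsilon> \<le> real T
         \<longrightarrow>
         measure M {\<omega> \<in> space M.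
           (MIN t\<in>{..<T}. L2_set (grad (zo_iterate d l \<alpha> \<eta> f (\<lambda>s. S s \<omega>) x0 t)) {..<d}) \<le> \<epsilon>}
         \<ge> 1 - \<delta>)"
  proof (intro exI[of _ "\<lambda>L0 L1 \<Delta>. 80 * (\<Delta> + 8 * L0)\<^sup>2 + 1"] conjI allI impI, goal_cases)
    case (1 L0 L1 \<Delta>)
    show ?case by (simp add: add_nonneg_pos)
  next
    case 2
    then show ?case by (elim conjE) (rule prob_small_gradient)
  qed
next
  fix A :: real
  assume "0 < A"
  then show "\<exists>B>0. \<forall>d H k.
      1 \<le> d \<and> pos_semidef d H \<and> 4 \<le> k \<longrightarrow>
      (\<forall>\<^sub>F \<epsilon> in at_right 0. \<forall>\<delta> T l \<alpha> \<eta> f S x0.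
         0 < \<delta> \<and> \<delta> < 1 \<and> 0 < T \<and> l = sketch_size k T \<delta> \<and>
         real T \<le> A * iteration_order d H k \<epsilon>
         \<longrightarrow>
         real (length (zo_queries d l \<alpha> \<eta> f S x0 T)) \<le> B * query_order d H k \<epsilon> \<delta>)"
    using eventually_query_bound by (intro exI[of _ "54 * A"]) simp
qed

end
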